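(* Let $k\ge0$ be an integer and let $\lambda$ be any $k$-strict partition. Then $$\Theta_\lambda(c\,|\,t)=\sum_{uw_\mu=w_\lambda}\Theta_\mu(c)\,\mathfrak{S}_{u^{-1}}(-t)$$ in the ring $C^{(k)}[t]$, where the sum is over all reduced factorizations $uw_\mu=w_\lambda$ with $u\in S_\infty$, that is, over all pairs $(u,\mu)$ with $u\in S_\infty$ and $\mu$ a $k$-strict partition such that $uw_\mu=w_\lambda$ and $\ell(w_\lambda)=\ell(u)+\ell(w_\mu)$.
   Context: Fix an integer $k\ge 0$. Let $c=(c_1,c_2,\ldots)$ and $t=(t_1,t_2,\ldots)$ be two families of independent commuting variables; set $c_0=1$ and $c_p=0$ for $p<0$. For $r\ge1$ and $j\ge 0$ let $e^r_j(t)$ and $h^r_j(t)$ be the elementary and complete homogeneous symmetric polynomials of degree $j$ in $t_1,\ldots,t_r$; set $e^0_j(t)=h^0_j(t)=\delta_{0j}$, and for $r<0$ set $h^r_j(t):=e^{-r}_j(t)$. The argument $-t$ means substituting $-t_i$ for $t_i$. For integers $p,r$ let $c_p^r:=\sum_{j=0}^p c_{p-j}h_j^r(-t)$ (zero for $p<0$). For an integer sequence $\alpha$ with finite support and any integer sequence $\beta$ let $c^\beta_\alpha:=\prod_{i\ge1}c^{\beta_i}_{\alpha_i}$ and $c_\alpha:=\prod_{i\ge1}c_{\alpha_i}$. Raising operators: for $i<j$, $R_{ij}(\alpha):=(\alpha_1,\ldots,\alpha_i+1,\ldots,\alpha_j-1,\ldots)$; a raising operator $R$ is a monomial in the $R_{ij}$,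 and $R\,c^\beta_\alpha:=c^\beta_{R\alpha}$, $R\,c_\alpha:=c_{R\alpha}$ (only subscripts change; factors are regarded as noncommuting for this action). Power series in the $R_{ij}$, with $(1+R_{ij})^{-1}=\sum_{s\ge0}(-1)^sR_{ij}^s$, are applied term by term; only finitely many terms are nonzero. A partition $\lambda$ is $k$-strict if all its parts greater than $k$ are distinct. For such $\lambda$ (with $\mathbb N$ the positive integers) put $\mathcal C(\lambda):=\{(i,j)\in\mathbb N\times\mathbb N : i<j,\ \lambda_i+\lambda_j>2k+j-i\}$, $\beta_j(\lambda):=k+1-\lambda_j+\#\{i<j : (i,j)\notin\mathcal C(\lambda)\}$ for $j\ge1$, and $R^\lambda:=\prod_{i<j}(1-R_{ij})\prod_{(i,j)\in\mathcal C(\lambda)}(1+R_{ij})^{-1}$. The double theta polynomial is $\Theta_\lambda(c\,|\,t):=R^\lambda\,c^{\beta(\lambda)}_\lambda\in\mathbb Z[c,t]$, and the single theta polynomial is $\Theta_\lambda(c):=\Theta_\lambda(c\,|\,0)=R^\lambda c_\lambda$. $I^{(k)}\subset\mathbb Z[c]$ is the ideal generated by $c_pc_p+2\sum_{i=1}^p(-1)^ic_{p+i}c_{p-i}$ for all $p>k$, and $C^{(k)}:=\mathbb Z[c]/I^{(k)}$. Weyl groups: $W_n$ is the hyperoctahedral group of signed permutations of $\{1,\ldots,n\}$, generated by $s_i=(i,i+1)$ for $1\le i\le n-1$ and the sign change $s_0(1)=-1$; $W_n\hookrightarrow W_{n+1}$ by adding the fixed point $n+1$; $W_\infty=\bigcup_nW_n$,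 with length function $\ell$; $S_\infty\subset W_\infty$ is the subgroup generated by the $s_i$ with $i\ge1$. An element $w\in W_\infty$ is $k$-Grassmannian if $\ell(ws_i)=\ell(w)+1$ for all $i\ne k$. There is a bijection between $k$-strict partitions $\lambda$ and $k$-Grassmannian elements $w_\lambda$: if $w_\lambda=(w_1,\ldots,w_n)\in W_n$ (so $0<w_1<\cdots<w_k$ and $w_{k+1}<\cdots<w_n$), then for $1\le i\le n-k$, $\lambda_i=k+|w_{k+i}|$ if $w_{k+i}<0$, and $\lambda_i=\#\{p\le k : w_p>w_{k+i}\}$ if $w_{k+i}>0$. For $u\in S_\infty$, $\mathfrak S_u(t)$ is the (type A, single) Schubert polynomial of Lascoux and Schützenberger: $\mathfrak S_{w_0}(t)=t_1^{n-1}t_2^{n-2}\cdots t_{n-1}$ for the longest element $w_0$ of $S_n$, and $\mathfrak S_{us_i}(t)=\bigl(\mathfrak S_u(t)-s_i\mathfrak S_u(t)\bigr)/(t_i-t_{i+1})$ when $\ell(us_i)=\ell(u)-1$, where $s_i$ ($i\ge1$) interchanges $t_i$ and $t_{i+1}$. *)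

theory Defs
  imports
    "HOL-Library.Poly_Mapping"
    "HOL-Library.Multiset"
    "HOL-Combinatorics.Permutations"
    "HOL-Computational_Algebra.Formal_Power_Series"
begin

section \<open>Polynomials in countably many variables\<close>

text \<open>
  A monomial is a finitely supported exponent vector. The variables are numbered
  $1, 2, \ldots$; variable $i$ sits at position $i - 1$ of the exponent vector, so that the ring has
  no superfluous variable. Only \<open>Xv i\<close> with \<open>i \<ge> 1\<close> and \<open>x i\<close> with \<open>i \<ge> 1\<close> are ever used.
\<close>

type_synonym 'a mvpoly = "(nat \<Rightarrow>\<^sub>0 nat) \<Rightarrow>\<^sub>0 'a"

type_synonym Zc = "int mvpoly"     \<comment> \<open>the ring $\mathbb Z[c]$\<close>
type_synonym Zt = "int mvpoly"     \<comment> \<open>the ring $\mathbb Z[t]$\<close>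
type_synonym Zct = "Zc mvpoly"     \<comment> \<open>the ring $\mathbb Z[c,t] = \mathbb Z[c][t]$\<close>

definition Xv :: "nat \<Rightarrow> 'a::comm_ring_1 mvpoly" where
  "Xv i = Poly_Mapping.single (Poly_Mapping.single (i - 1) 1) 1"

definition const :: "'a::comm_ring_1 \<Rightarrow> 'a mvpoly" where
  "const a = Poly_Mapping.single 0 a"

definition peval :: "int mvpoly \<Rightarrow> (nat \<Rightarrow> 'a::comm_ring_1) \<Rightarrow> 'a" where
  "peval f x = (\<Sum>m\<in>Poly_Mapping.keys f. of_int (Poly_Mapping.lookup f m) *
      (\<Prod>i\<in>Poly_Mapping.keys m. x (Suc i) ^ Poly_Mapping.lookup m i))"


section \<open>The elements $c^r_p$\<close>

text \<open>
  These, and the theta polynomials below, are defined for arbitrary families \<open>c\<close> and \<open>t\<close> of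
  elements of a commutative ring; the polynomials themselves arise by taking \<open>c\<close> and \<open>t\<close> to be
  families of variables.
\<close>

definition esym :: "nat \<Rightarrow> nat \<Rightarrow> (nat \<Rightarrow> 'a::comm_ring_1) \<Rightarrow> 'a" where
  "esym r j t = (\<Sum>S | S \<subseteq> {1..r} \<and> card S = j. \<Prod>i\<in>S. t i)"

definition hsym :: "nat \<Rightarrow> nat \<Rightarrow> (nat \<Rightarrow> 'a::comm_ring_1) \<Rightarrow> 'a" where
  "hsym r j t = (\<Sum>M\<in>multisets_of_size {1..r} j. \<Prod>i\<in>#M. t i)"

definition hgen :: "int \<Rightarrow> nat \<Rightarrow> (nat \<Rightarrow> 'a::comm_ring_1) \<Rightarrow> 'a" where
  "hgen r j t = (if r < 0 then esym (nat (- r)) j t else hsym (nat r) j t)"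

definition cext :: "(nat \<Rightarrow> 'a::comm_ring_1) \<Rightarrow> int \<Rightarrow> 'a" where
  "cext c p = (if p < 0 then 0 else if p = 0 then 1 else c (nat p))"

definition cup :: "(nat \<Rightarrow> 'a::comm_ring_1) \<Rightarrow> (nat \<Rightarrow> 'a) \<Rightarrow> int \<Rightarrow> int \<Rightarrow> 'a" where
  "cup c t r p = (if p < 0 then 0
     else (\<Sum>j=0..nat p. cext c (p - int j) * hgen r j (\<lambda>i. - t i)))"

text \<open>
  Integer sequences are functions on \<open>nat\<close> whose entries at indices \<open>i \<ge> 1\<close> matter.
  For finitely supported \<open>\<alpha>\<close> all but finitely many factors are \<open>1\<close>.
\<close>

definition cprod ::
  "(nat \<Rightarrow> 'a::comm_ring_1) \<Rightarrow> (nat \<Rightarrow> 'a) \<Rightarrow> (nat \<Rightarrow> int) \<Rightarrow> (nat \<Rightarrow> int) \<Rightarrow> 'a" where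
  "cprod c t \<beta> \<alpha> = Prod_any (\<lambda>i. if 1 \<le> i then cup c t (\<beta> i) (\<alpha> i) else 1)"


section \<open>Partitions and theta polynomials\<close>

definition kstrict :: "nat \<Rightarrow> nat list \<Rightarrow> bool" where
  "kstrict k lam \<longleftrightarrow>
     sorted_wrt (\<ge>) lam \<and> (\<forall>p\<in>set lam. 0 < p) \<and> distinct (filter (\<lambda>p. k < p) lam)"

definition part :: "nat list \<Rightarrow> nat \<Rightarrow> nat" where
  "part lam i = (if 1 \<le> i \<and> i \<le> length lam then lam ! (i - 1) else 0)"

definition Cset :: "nat \<Rightarrow> nat list \<Rightarrow> (nat \<times> nat) set" where
  "Cset k lam = {(i, j). 1 \<le> i \<and> i < j \<and> part lam i + part lam j > 2 * k + (j - i)}"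

definition betaseq :: "nat \<Rightarrow> nat list \<Rightarrow> nat \<Rightarrow> int" where
  "betaseq k lam j =
     int k + 1 - int (part lam j) + int (card {i. 1 \<le> i \<and> i < j \<and> (i, j) \<notin> Cset k lam})"

text \<open>
  A raising operator $R = \prod R_{ij}^{n_{ij}}$ is given by its exponents \<open>n\<close>.
\<close>

type_synonym raising = "(nat \<times> nat) \<Rightarrow>\<^sub>0 nat"

definition raise_seq :: "raising \<Rightarrow> (nat \<Rightarrow> int) \<Rightarrow> nat \<Rightarrow> int" where
  "raise_seq n \<alpha> i = \<alpha> i + (\<Sum>(a, b)\<in>Poly_Mapping.keys n.
      int (Poly_Mapping.lookup n (a, b)) * (of_bool (a = i) - of_bool (b = i)))"

text \<open>
  The factor of $R^\lambda$ belonging to the pair $(i,j)$, as a power series in the single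
  variable $R_{ij}$; the second factor is $(1 + R_{ij})^{-1}$ written out.
\<close>

definition rfactor :: "nat \<Rightarrow> nat list \<Rightarrow> nat \<times> nat \<Rightarrow> int fps" where
  "rfactor k lam = (\<lambda>(i, j). if 1 \<le> i \<and> i < j
     then (1 - fps_X) * (if (i, j) \<in> Cset k lam then Abs_fps (\<lambda>s. (-1) ^ s) else 1)
     else 1)"

text \<open>
  The coefficient of the monomial \<open>n\<close> in $R^\lambda$. The factors have constant term \<open>1\<close> and
  involve distinct variables, so only the pairs in the support of \<open>n\<close> contribute.
\<close>

definition Rcoeff :: "nat \<Rightarrow> nat list \<Rightarrow> raising \<Rightarrow> int" where
  "Rcoeff k lam n = Prod_any (\<lambda>p. fps_nth (rfactor k lam p) (Poly_Mapping.lookup n p))"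

text \<open>
  $R^\lambda c^{\beta(\lambda)}_\lambda$, a sum over all monomials with only finitely many nonzero
  terms: $\sum_j j\,\alpha_j$ drops by $\sum (j-i) n_{ij}$, and if $j$ is the largest index
  occurring in the monomial and exceeds the number of parts of $\lambda$ then $(R\lambda)_j < 0$.
\<close>

definition theta :: "nat \<Rightarrow> nat list \<Rightarrow> (nat \<Rightarrow> 'a::comm_ring_1) \<Rightarrow> (nat \<Rightarrow> 'a) \<Rightarrow> 'a" where
  "theta k lam c t = Sum_any (\<lambda>n::raising. of_int (Rcoeff k lam n) *
      cprod c t (betaseq k lam) (raise_seq n (\<lambda>i. int (part lam i))))"

definition theta_double :: "nat \<Rightarrow> nat list \<Rightarrow> Zct" where
  "theta_double k lam = theta k lam (\<lambda>i. const (Xv i)) Xv"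

definition theta_single :: "nat \<Rightarrow> nat list \<Rightarrow> Zc" where
  "theta_single k lam = theta k lam Xv (\<lambda>i. 0)"


section \<open>The rings $C^{(k)}$ and $C^{(k)}[t]$\<close>

definition Irel :: "nat \<Rightarrow> Zc" where
  "Irel p = cext Xv (int p) * cext Xv (int p) +
     2 * (\<Sum>i=1..p. (-1) ^ i * cext Xv (int p + int i) * cext Xv (int p - int i))"

text \<open>The ideal generated by a set is its span in the ring viewed as a module over itself.\<close>

lemma module_times: "module ((*) :: 'a::comm_ring_1 \<Rightarrow> 'a \<Rightarrow> 'a)"
  by unfold_locales (simp_all add: algebra_simps)

definition Iideal :: "nat \<Rightarrow> Zc set" where
  "Iideal k = module.span (*) {Irel p |p. k < p}"

text \<open>
  Equality of the images of two elements of $\mathbb Z[c][t]$ in $C^{(k)}[t]$: the coefficients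
  of every monomial in $t$ agree in $C^{(k)} = \mathbb Z[c]/I^{(k)}$.
\<close>

definition eq_in_Ckt :: "nat \<Rightarrow> Zct \<Rightarrow> Zct \<Rightarrow> bool" where
  "eq_in_Ckt k f g \<longleftrightarrow> (\<forall>m. Poly_Mapping.lookup f m - Poly_Mapping.lookup g m \<in> Iideal k)"


section \<open>The hyperoctahedral group\<close>

text \<open>
  Signed permutations are odd bijections of \<open>int\<close>; the product is composition, and the inclusion
  of \<open>W n\<close> in \<open>W (Suc n)\<close> is set inclusion.
\<close>

definition W :: "nat \<Rightarrow> (int \<Rightarrow> int) set" where
  "W n = {w. w permutes {- int n..int n} \<and> (\<forall>i. w (- i) = - w i)}"

definition Winf :: "(int \<Rightarrow> int) set" where
  "Winf = (\<Union>n. W n)"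

definition sgen :: "nat \<Rightarrow> int \<Rightarrow> int" where
  "sgen i = (if i = 0 then transpose 1 (- 1)
     else transpose (int i) (int i + 1) \<circ> transpose (- int i) (- int i - 1))"

definition wordprod :: "nat list \<Rightarrow> int \<Rightarrow> int" where
  "wordprod ws = foldr (\<lambda>i w. sgen i \<circ> w) ws id"

definition wlen :: "(int \<Rightarrow> int) \<Rightarrow> nat" where
  "wlen w = (LEAST l. \<exists>ws. length ws = l \<and> wordprod ws = w)"

definition Sn :: "nat \<Rightarrow> (int \<Rightarrow> int) set" where
  "Sn n = {wordprod ws |ws. set ws \<subseteq> {1..<n}}"

definition Sinf :: "(int \<Rightarrow> int) set" where
  "Sinf = {wordprod ws |ws. set ws \<subseteq> {1..}}"

definition grassmannian :: "nat \<Rightarrow> (int \<Rightarrow> int) \<Rightarrow> bool" where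
  "grassmannian k w \<longleftrightarrow> w \<in> Winf \<and> (\<forall>i. i \<noteq> k \<longrightarrow> wlen (w \<circ> sgen i) = wlen w + 1)"

text \<open>
  The \<open>i\<close>-th part of the partition of a \<open>k\<close>-Grassmannian element. It vanishes as soon as
  \<open>k + i\<close> exceeds an \<open>n\<close> with \<open>w \<in> W n\<close>, so no \<open>n\<close> has to be mentioned.
\<close>

definition grass_part :: "nat \<Rightarrow> (int \<Rightarrow> int) \<Rightarrow> nat \<Rightarrow> nat" where
  "grass_part k w i = (if w (int (k + i)) < 0 then k + nat \<bar>w (int (k + i))\<bar>
     else card {p. 1 \<le> p \<and> p \<le> k \<and> w (int p) > w (int (k + i))})"

definition welt :: "nat \<Rightarrow> nat list \<Rightarrow> int \<Rightarrow> int" where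
  "welt k lam = (THE w. grassmannian k w \<and> (\<forall>i\<ge>1. part lam i = grass_part k w i))"


section \<open>Schubert polynomials\<close>

definition tswap :: "nat \<Rightarrow> Zt \<Rightarrow> Zt" where
  "tswap i f = peval f (\<lambda>j. Xv (transpose i (Suc i) j))"

inductive is_schubert :: "(int \<Rightarrow> int) \<Rightarrow> Zt \<Rightarrow> bool" where
  longest: "\<lbrakk>1 \<le> n; w \<in> Sn n; \<forall>v\<in>Sn n. wlen v \<le> wlen w\<rbrakk>
    \<Longrightarrow> is_schubert w (\<Prod>i=1..<n. Xv i ^ (n - i))"
| divdiff: "\<lbrakk>is_schubert u f; 1 \<le> i; wlen u = wlen (u \<circ> sgen i) + 1;
     g * (Xv i - Xv (Suc i)) = f - tswap i f\<rbrakk>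
    \<Longrightarrow> is_schubert (u \<circ> sgen i) g"

definition schubert :: "(int \<Rightarrow> int) \<Rightarrow> Zt" where
  "schubert u = (THE f. is_schubert u f)"


section \<open>Reduced factorizations\<close>

definition reduced_facts :: "nat \<Rightarrow> nat list \<Rightarrow> ((int \<Rightarrow> int) \<times> nat list) set" where
  "reduced_facts k lam = {(u, \<mu>). u \<in> Sinf \<and> kstrict k \<mu> \<and> u \<circ> welt k \<mu> = welt k lam \<and>
     wlen (welt k lam) = wlen u + wlen (welt k \<mu>)}"

end

theory Submission
  imports Defs
begin

text \<open>Let \<open>h\<close> be the difference of the two sides. A simple reflection \<open>s\<^sub>i\<close> with \<open>i \<ge> 1\<close> interchanges
  \<open>t\<^sub>i\<close> and \<open>t\<^sub>i\<^sub>+\<^sub>1\<close>. If \<open>s\<^sub>i w\<^sub>\<lambda> = w\<^sub>\<mu>\<close> is shorter than \<open>w\<^sub>\<lambda>\<close>, then \<open>s\<^sub>i \<Theta>\<^sub>\<lambda> = \<Theta>\<^sub>\<lambda> + (t\<^sub>i - t\<^sub>i\<^sub>+\<^sub>1) \<Theta>\<^sub>\<mu>\<close>,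
  and otherwise \<open>s\<^sub>i \<Theta>\<^sub>\<lambda> = \<Theta>\<^sub>\<lambda>\<close> modulo the relations. The sum over reduced factorizations obeys the
  same rule, by the divided differences of Schubert polynomials. So, by induction on the length of
  \<open>w\<^sub>\<lambda>\<close>, \<open>h\<close> is symmetric in \<open>t\<close> modulo the relations. A symmetric polynomial in infinitely many
  variables is constant, and at \<open>t = 0\<close> both sides are the single theta polynomial of \<open>\<lambda>\<close>.\<close>

text \<open>All data of R^\<lambda> are read off from w = w_\<lambda>: (i,j) lies in C(\<lambda>)
  iff w_{k+i} + w_{k+j} < 0, and \<beta>_j is w_{k+j}, plus 1 if this is negative. The element c^r_p
  is moved by s_i only for r = i or r = -i, so s_i sees only rows with value i or -i-1. At a descent
  one row loses a box. If both values occur in the last block, two rows change and produce a factor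
  1 + R_{jl}; this is exactly what cancels when the pair (j,l) leaves C(\<lambda>). At an ascent,
  consecutive rows with values i, i+1 cancel identically, while the values -i-1, -i call on the
  relations. The obstacle is there: raising operators coming from higher rows lower the degrees
  below the range in which the relations hold. Symmetrising in the two rows gives a function that
  changes sign under R_{j,j+1}; on it the operators from higher rows cancel in pairs, and the others
  keep the total degree of the two rows large. This costs a factor 2, which is cancelled in Z[c,t]
  and not in the quotient. Nothing is ever divided by t_i - t_{i+1} modulo the relations: the
  induction multiplies by it.\<close>

section \<open>Length in the hyperoctahedral group\<close>

text \<open>Pairs encode the positive roots of type B: (0,b) stands for e_b, and for 0 < a < b the
  pairs (a,b) and (-a,b) stand for e_b - e_a and e_b + e_a. The condition w b < w a says that w
  makes the root negative.\<close>

definition inv_set :: "(int \<Rightarrow> int) \<Rightarrow> (int \<times> int) set" where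
  "inv_set w = {(a, b). - b < a \<and> a < b \<and> w b < w a}"

lemma sgen_apply:
  "sgen i x = (if i = 0 then if x = 1 then - 1 else if x = - 1 then 1 else x
     else if x = int i then int i + 1 else if x = int i + 1 then int i
     else if x = - int i then - int i - 1 else if x = - int i - 1 then - int i else x)"
  by (auto simp: sgen_def transpose_def)

lemma sgen_sgen [simp]: "sgen i (sgen i x) = x"
  by (auto simp: sgen_apply)

lemma sgen_comp_sgen [simp]: "sgen i \<circ> sgen i = id" "sgen i \<circ> (sgen i \<circ> w) = w"
    "w \<circ> sgen i \<circ> sgen i = w"
  by (auto simp: fun_eq_iff)

lemma sgen_minus [simp]: "sgen i (- x) = - sgen i x"
  by (auto simp: sgen_apply)

lemma bij_sgen: "bij (sgen i)"
  by (rule involuntory_imp_bij) simp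

lemma inv_sgen [simp]: "inv (sgen i) = sgen i"
  by (rule inv_unique_comp) auto

lemma Winf_iff: "w \<in> Winf \<longleftrightarrow> bij w \<and> (\<forall>x. w (- x) = - w x) \<and> (\<exists>n::nat. \<forall>x. int n < \<bar>x\<bar> \<longrightarrow> w x = x)"
proof
  assume "w \<in> Winf"
  then obtain n where n: "w permutes {- int n..int n}" "\<forall>i. w (- i) = - w i"
    by (auto simp: Winf_def W_def)
  have "bij w" using n(1) by (rule permutes_bij)
  moreover have "\<forall>x. int n < \<bar>x\<bar> \<longrightarrow> w x = x"
  proof (intro allI impI)
    fix x assume "int n < \<bar>x\<bar>"
    then have "x \<notin> {- int n..int n}" by auto
    then show "w x = x" by (rule permutes_not_in[OF n(1)])
  qed
  ultimately show "bij w \<and> (\<forall>x. w (- x) = - w x) \<and> (\<exists>n::nat. \<forall>x. int n < \<bar>x\<bar> \<longrightarrow> w x = x)"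
    using n(2) by blast
next
  assume "bij w \<and> (\<forall>x. w (- x) = - w x) \<and> (\<exists>n::nat. \<forall>x. int n < \<bar>x\<bar> \<longrightarrow> w x = x)"
  then obtain n where n: "bij w" "\<forall>x. w (- x) = - w x" "\<forall>x. int n < \<bar>x\<bar> \<longrightarrow> w x = x" by blast
  have "\<forall>x. x \<notin> {- int n..int n} \<longrightarrow> w x = x" using n(3) by auto
  then have "w permutes {- int n..int n}"
    unfolding permutes_def
    using n(1) unfolding bij_iff by blast
  then show "w \<in> Winf" using n(2) by (auto simp: Winf_def W_def)
qed

lemma Winf_bij: "w \<in> Winf \<Longrightarrow> bij w"
  and Winf_minus: "w \<in> Winf \<Longrightarrow> w (- x) = - w x"
  by (simp_all add: Winf_iff)

lemma Winf_inj: "w \<in> Winf \<Longrightarrow> w x = w y \<longleftrightarrow> x = y"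
  by (auto dest!: Winf_bij bij_is_inj dest: injD)

lemma Winf_zero: "w \<in> Winf \<Longrightarrow> w 0 = 0"
  using Winf_minus[of w 0] by simp

lemma Winf_eq_zero_iff: "w \<in> Winf \<Longrightarrow> w x = 0 \<longleftrightarrow> x = 0"
  using Winf_inj[of w x 0] Winf_zero[of w] by simp

lemma Winf_bound:
  assumes "w \<in> Winf"
  obtains n :: nat where "\<And>x. int n < \<bar>x\<bar> \<Longrightarrow> w x = x" "\<And>x. \<bar>x\<bar> \<le> int n \<Longrightarrow> \<bar>w x\<bar> \<le> int n"
proof -
  obtain n :: nat where n: "\<And>x. int n < \<bar>x\<bar> \<Longrightarrow> w x = x" using assms by (auto simp: Winf_iff)
  have "\<bar>w x\<bar> \<le> int n" if "\<bar>x\<bar> \<le> int n" for x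
  proof (rule ccontr)
    assume "\<not> \<bar>w x\<bar> \<le> int n"
    then have "w (w x) = w x" using n by simp
    then show False using Winf_inj[OF assms] that \<open>\<not> \<bar>w x\<bar> \<le> int n\<close> by simp
  qed
  then show ?thesis using n that by blast
qed

lemma id_Winf [simp]: "id \<in> Winf" by (auto simp: Winf_iff)

lemma sgen_Winf [simp]: "sgen i \<in> Winf"
  unfolding Winf_iff using bij_sgen[of i]
  by (auto intro!: exI[of _ "Suc i"] simp: sgen_apply)

lemma comp_Winf [simp]: "v \<in> Winf \<Longrightarrow> w \<in> Winf \<Longrightarrow> v \<circ> w \<in> Winf"
proof -
  assume v: "v \<in> Winf" and w: "w \<in> Winf"
  obtain m where m: "\<forall>x. int m < \<bar>x\<bar> \<longrightarrow> v x = x" using v by (auto simp: Winf_iff)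
  obtain n where n: "\<forall>x. int n < \<bar>x\<bar> \<longrightarrow> w x = x" using w by (auto simp: Winf_iff)
  have "\<forall>x. int (max m n) < \<bar>x\<bar> \<longrightarrow> (v \<circ> w) x = x" using m n by auto
  then show ?thesis using v w unfolding Winf_iff by (auto intro: bij_comp)
qed

lemma inv_Winf [simp]: "w \<in> Winf \<Longrightarrow> inv w \<in> Winf"
proof -
  assume w: "w \<in> Winf"
  obtain m where m: "\<forall>x. int m < \<bar>x\<bar> \<longrightarrow> w x = x" using w by (auto simp: Winf_iff)
  have b: "bij w" using w by (rule Winf_bij)
  have "inv w (- x) = - inv w x" for x
    using b w by (metis Winf_minus bij_inv_eq_iff)
  moreover have "\<forall>x. int m < \<bar>x\<bar> \<longrightarrow> inv w x = x"
    using m b by (metis bij_inv_eq_iff)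
  ultimately show ?thesis using b unfolding Winf_iff by (auto intro: bij_imp_bij_inv)
qed

lemma finite_inv_set: "w \<in> Winf \<Longrightarrow> finite (inv_set w)"
proof -
  assume "w \<in> Winf"
  then obtain n :: nat where n: "\<And>x. int n < \<bar>x\<bar> \<Longrightarrow> w x = x" "\<And>x. \<bar>x\<bar> \<le> int n \<Longrightarrow> \<bar>w x\<bar> \<le> int n"
    by (rule Winf_bound) auto
  have bd: "a \<in> {- int n..int n} \<and> b \<in> {- int n..int n}" if ab: "(a, b) \<in> inv_set w" for a b
  proof -
    have 1: "- b < a" "a < b" "w b < w a" using ab by (auto simp: inv_set_def)
    have "\<not> b > int n"
    proof
      assume b: "b > int n"
      then have "w b = b" using n(1) 1 by simp
      moreover have "w a \<le> max (int n) a" using n(1)[of a] n(2)[of a] by (cases "\<bar>a\<bar> \<le> int n") auto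
      ultimately show False using 1 b by simp
    qed
    then show ?thesis using 1 by auto
  qed
  have "inv_set w \<subseteq> {- int n..int n} \<times> {- int n..int n}"
    by (rule subrelI) (use bd in blast)
  then show ?thesis by (rule finite_subset) simp
qed

text \<open>Two pairs are excluded: the simple root of s_i, which becomes negative, and (-i, i+1).
  The root of the latter is fixed by s_i, but its entries move to (-i-1, i), which violates -b <
  a.\<close>

lemma sgen_order:
  assumes "- b < a" "a < b" "(a, b) \<noteq> (if i = 0 then (0, 1) else (int i, int i + 1))"
    "i = 0 \<or> (a, b) \<noteq> (- int i, int i + 1)"
  shows "- sgen i b < sgen i a" "sgen i a < sgen i b"
proof -
  have "- sgen i b < sgen i a \<and> sgen i a < sgen i b"
  proof (cases "i = 0")
    case True
    then show ?thesis using assms by (auto simp: sgen_apply)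
  next
    case False
    then have i: "int i \<ge> 1" by simp
    have ne: "\<not> (a = int i \<and> b = int i + 1)" "\<not> (a = - int i \<and> b = int i + 1)"
      using assms False by auto
    consider "b = int i" | "b = int i + 1" | "b < int i" | "b > int i + 1" by linarith
    then show ?thesis
      by cases (use assms(1,2) ne i in \<open>auto simp: sgen_apply\<close>)
  qed
  then show "- sgen i b < sgen i a" "sgen i a < sgen i b" by blast+
qed

text \<open>A simple reflection permutes the positive roots other than its own, so right
  multiplication by it at an ascent adds just this root to the inversions.\<close>

lemma inv_set_step:
  assumes w: "w \<in> Winf" and asc: "w (int i) < w (int i + 1)"
  shows "card (inv_set (w \<circ> sgen i)) = Suc (card (inv_set w))"
proof -
  define p0 where "p0 = (if i = 0 then (0, 1) else (int i, int i + 1))"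
  define q0 where "q0 = (- int i, int i + 1)"
  \<comment> \<open>The permutation of the roots in terms of pairs. The pair \<open>q0\<close> is
    kept by hand, since applying \<open>sgen i\<close> to its entries leaves the range of admissible
    pairs although the root is fixed.\<close>
  define g where "g = (\<lambda>p. if i \<noteq> 0 \<and> p = q0 then p else map_prod (sgen i) (sgen i) p)"
  have s1: "sgen i (- int i) = - int i - 1" "sgen i (int i + 1) = int i" if "i \<noteq> 0"
    using that by (auto simp: sgen_apply)
  have wm: "w (- x) = - w x" for x using w by (rule Winf_minus)
  have w0: "w 0 = 0" using w by (rule Winf_zero)
  have wm1: "w (- int i - 1) = - w (int i + 1)" using wm[of "int i + 1"] by simp
  have gq: "g q0 = q0" if "i \<noteq> 0" using that by (simp add: g_def)
  have gn: "g p = (sgen i (fst p), sgen i (snd p))" if "i = 0 \<or> p \<noteq> q0" for p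
    using that by (cases p) (auto simp: g_def)
  have nq: "(sgen i (fst p), sgen i (snd p)) \<noteq> q0" if "- snd p < fst p" "i \<noteq> 0" for p
  proof
    assume "(sgen i (fst p), sgen i (snd p)) = q0"
    then have "sgen i (fst p) = - int i" "sgen i (snd p) = int i + 1" by (simp_all add: q0_def)
    then have "fst p = - int i - 1" "snd p = int i" using s1 that(2) by (metis sgen_sgen)+
    then show False using that by simp
  qed
  have gg: "g (g p) = p" if "- snd p < fst p" for p
  proof (cases "i \<noteq> 0 \<and> p = q0")
    case False
    then show ?thesis using nq[OF that] gn[of p] gn[of "(sgen i (fst p), sgen i (snd p))"] by auto
  qed (use gq in auto)
  have gp0: "g p0 = (if i = 0 then (0, - 1) else (int i + 1, int i))"
    using gn[of p0] by (auto simp: p0_def q0_def sgen_apply)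
  have np: "g p \<noteq> p0" if "- snd p < fst p" "fst p < snd p" for p
  proof
    assume "g p = p0"
    then have "p = g p0" using gg[OF that(1)] by simp
    then show False using that gp0 by (cases "i = 0") simp_all
  qed
  have maps: "g p \<in> inv_set (w \<circ> sgen i) - {p0}" if p: "p \<in> inv_set w" for p
  proof -
    have 1: "- snd p < fst p" "fst p < snd p" "w (snd p) < w (fst p)" using p by (auto simp: inv_set_def)
    have ne: "p \<noteq> p0" using asc 1 by (cases "i = 0") (auto simp: p0_def)
    show ?thesis
    proof (cases "i \<noteq> 0 \<and> p = q0")
      case True
      then have "g p = (- int i, int i + 1)" using gq by (simp add: q0_def)
      moreover have "w (int i) < w (- int i - 1)" using 1 True wm[of "int i"] wm1 by (simp add: q0_def)
      ultimately show ?thesis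
        using np[OF 1(1,2)] s1 True by (simp add: inv_set_def)
    next
      case False
      then have g: "g p = (sgen i (fst p), sgen i (snd p))" using gn[of p] by simp
      have "- sgen i (snd p) < sgen i (fst p)" "sgen i (fst p) < sgen i (snd p)"
        using sgen_order[of "snd p" "fst p" i] 1 ne False by (simp_all add: p0_def q0_def)
      then show ?thesis using np[OF 1(1,2)] 1 unfolding g by (simp add: inv_set_def)
    qed
  qed
  have maps2: "g p \<in> inv_set w" if p: "p \<in> inv_set (w \<circ> sgen i) - {p0}" for p
  proof -
    have 1: "- snd p < fst p" "fst p < snd p" "w (sgen i (snd p)) < w (sgen i (fst p))" and ne: "p \<noteq> p0"
      using p by (auto simp: inv_set_def)
    show ?thesis
    proof (cases "i \<noteq> 0 \<and> p = q0")
      case True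
      then have "g p = (- int i, int i + 1)" using gq by (simp add: q0_def)
      moreover have "w (int i + 1) < w (- int i)" using 1 True wm[of "int i"] wm1 s1 by (simp add: q0_def)
      ultimately show ?thesis by (simp add: inv_set_def)
    next
      case False
      then have g: "g p = (sgen i (fst p), sgen i (snd p))" using gn[of p] by simp
      have "- sgen i (snd p) < sgen i (fst p)" "sgen i (fst p) < sgen i (snd p)"
        using sgen_order[of "snd p" "fst p" i] 1 ne False by (simp_all add: p0_def q0_def)
      then show ?thesis using 1 unfolding g by (simp add: inv_set_def)
    qed
  qed
  have bij: "bij_betw g (inv_set w) (inv_set (w \<circ> sgen i) - {p0})"
  proof (rule bij_betwI[where g = g])
    show "g \<in> inv_set w \<rightarrow> inv_set (w \<circ> sgen i) - {p0}" using maps by blast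
    show "g \<in> inv_set (w \<circ> sgen i) - {p0} \<rightarrow> inv_set w" using maps2 by blast
  qed (auto intro!: gg simp: inv_set_def)
  have mem: "p0 \<in> inv_set (w \<circ> sgen i)"
    using asc wm[of 1] w0 by (cases "i = 0") (auto simp: p0_def inv_set_def sgen_apply)
  have fin: "finite (inv_set (w \<circ> sgen i))" using w by (intro finite_inv_set) simp
  show ?thesis
    using bij_betw_same_card[OF bij] card_Suc_Diff1[OF fin mem] by simp
qed

lemma inv_set_step_desc:
  assumes w: "w \<in> Winf" and desc: "w (int i + 1) < w (int i)"
  shows "card (inv_set w) = Suc (card (inv_set (w \<circ> sgen i)))"
proof -
  have wm: "w (- x) = - w x" for x using w by (rule Winf_minus)
  have "(w \<circ> sgen i) (int i) < (w \<circ> sgen i) (int i + 1)"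
    using desc wm[of 1] Winf_zero[OF w] by (auto simp: sgen_apply)
  from inv_set_step[of "w \<circ> sgen i" i, OF _ this] show ?thesis using w by simp
qed

section \<open>Words in the simple reflections and Coxeter length\<close>

lemma wordprod_Nil [simp]: "wordprod [] = id"
  and wordprod_Cons [simp]: "wordprod (i # ws) = sgen i \<circ> wordprod ws"
  by (auto simp: wordprod_def)

lemma wordprod_append: "wordprod (us @ vs) = wordprod us \<circ> wordprod vs"
  by (induction us) (auto simp: o_assoc)

lemma wordprod_Winf [simp]: "wordprod ws \<in> Winf"
proof (induction ws)
  case Nil
  show ?case unfolding wordprod_Nil by (rule id_Winf)
next
  case (Cons i ws)
  then show ?case unfolding wordprod_Cons by (intro comp_Winf sgen_Winf)
qed

lemma inv_wordprod: "inv (wordprod ws) = wordprod (rev ws)"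
proof (induction ws)
  case (Cons i ws)
  have "inv (sgen i \<circ> wordprod ws) = inv (wordprod ws) \<circ> inv (sgen i)"
    by (rule o_inv_distrib) (auto intro: bij_sgen Winf_bij)
  then show ?case using Cons by (simp only: wordprod_append wordprod_Cons wordprod_Nil rev.simps comp_id inv_sgen)
qed (simp only: wordprod_Nil rev.simps inv_id)

lemma card_inv_set_wordprod: "card (inv_set (wordprod ws)) \<le> length ws"
proof (induction ws rule: rev_induct)
  case Nil
  have "inv_set id = {}" by (auto simp: inv_set_def)
  then show ?case by (simp add: id_def)
next
  case (snoc i ws)
  have "card (inv_set (wordprod ws \<circ> sgen i)) \<le> Suc (card (inv_set (wordprod ws)))"
    using inv_set_step[of "wordprod ws" i] inv_set_step_desc[of "wordprod ws" i]
      Winf_inj[OF wordprod_Winf, of ws "int i" "int i + 1"]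
    by (cases "wordprod ws (int i)" "wordprod ws (int i + 1)" rule: linorder_cases) auto
  moreover have "wordprod (ws @ [i]) = wordprod ws \<circ> sgen i" by (simp add: wordprod_append)
  ultimately show "card (inv_set (wordprod (ws @ [i]))) \<le> length (ws @ [i])" using snoc by simp
qed

text \<open>A strictly increasing w with w 0 = 0 satisfies w i \<ge> i for i \<ge> 0; a strict
  inequality would persist to the right, where w is eventually the identity.\<close>

lemma no_descents_id:
  assumes w: "w \<in> Winf" and asc: "\<And>i. w (int i) < w (int i + 1)"
  shows "w = id"
proof -
  have le: "int i \<le> w (int i)" for i
  proof (induction i)
    case (Suc i)
    then show ?case using asc[of i] by (simp add: add.commute)
  qed (use Winf_zero[OF w] in simp)
  obtain n :: nat where n: "\<And>x. int n < \<bar>x\<bar> \<Longrightarrow> w x = x" using w by (auto simp: Winf_iff)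
  have pos: "w (int i) = int i" for i
  proof -
    have ge: "w (int i) + int m \<le> w (int (i + m))" for m
    proof (induction m)
      case (Suc m)
      then show ?case using asc[of "i + m"] by (simp add: algebra_simps)
    qed simp
    have "w (int i) + int (Suc n) \<le> int (i + Suc n)" using ge[of "Suc n"] n[of "int (i + Suc n)"] by simp
    then show ?thesis using le[of i] by simp
  qed
  have "w x = x" for x
  proof (cases "x \<ge> 0")
    case True then show ?thesis using pos[of "nat x"] by simp
  next
    case False then show ?thesis using pos[of "nat (- x)"] Winf_minus[OF w, of "-x"] by simp
  qed
  then show ?thesis by (simp add: fun_eq_iff)
qed

lemma ex_descent:
  assumes "w \<in> Winf" "w \<noteq> id"
  obtains i where "w (int i + 1) < w (int i)"
proof -
  from no_descents_id[OF assms(1)] assms(2) obtain i where "\<not> w (int i) < w (int i + 1)" by blast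
  moreover have "w (int i) \<noteq> w (int i + 1)" using Winf_inj[OF assms(1)] by simp
  ultimately show ?thesis using that[of i] by simp
qed

text \<open>Sorting: an element other than the identity has a descent, and splitting it off as the
  last letter removes one inversion.\<close>

lemma ex_reduced_word:
  assumes "w \<in> Winf"
  shows "\<exists>ws. length ws = card (inv_set w) \<and> wordprod ws = w"
  using assms
proof (induction "card (inv_set w)" arbitrary: w)
  case 0
  have "w = id"
  proof (rule ccontr)
    assume "w \<noteq> id"
    then obtain i where "w (int i + 1) < w (int i)" using ex_descent 0 by blast
    from inv_set_step_desc[OF _ this] 0 show False by simp
  qed
  then show ?case using 0 by (intro exI[of _ "[]"]) auto
next
  case (Suc m)
  have "w \<noteq> id"
  proof
    assume "w = id"
    then have "inv_set w = {}" by (auto simp: inv_set_def)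
    then show False using Suc by simp
  qed
  then obtain i where "w (int i + 1) < w (int i)" using ex_descent Suc by blast
  from inv_set_step_desc[OF _ this] have c: "card (inv_set w) = Suc (card (inv_set (w \<circ> sgen i)))" using Suc by simp
  have "w \<circ> sgen i \<in> Winf" "m = card (inv_set (w \<circ> sgen i))" using Suc.prems Suc.hyps(2) c by simp_all
  then obtain ws where "length ws = card (inv_set (w \<circ> sgen i))" "wordprod ws = w \<circ> sgen i"
    using Suc.hyps(1)[of "w \<circ> sgen i"] by blast
  then show ?case using c by (intro exI[of _ "ws @ [i]"]) (simp add: wordprod_append)
qed

lemma wlen_eq: "w \<in> Winf \<Longrightarrow> wlen w = card (inv_set w)"
  unfolding wlen_def
  by (rule Least_equality) (use ex_reduced_word card_inv_set_wordprod in auto)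

lemma reduced_word:
  assumes "w \<in> Winf" obtains ws where "length ws = wlen w" "wordprod ws = w"
  using ex_reduced_word[OF assms] wlen_eq[OF assms] by auto

lemma wlen_wordprod_le: "wlen (wordprod ws) \<le> length ws"
  by (simp add: wlen_eq card_inv_set_wordprod)

lemma wlen_id [simp]: "wlen id = 0"
  using wlen_wordprod_le[of "[]"] by simp

lemma wlen_eq_0_iff: "w \<in> Winf \<Longrightarrow> wlen w = 0 \<longleftrightarrow> w = id"
  by (metis length_0_conv reduced_word wlen_id wordprod_Nil)

lemma wlen_asc: "w \<in> Winf \<Longrightarrow> w (int i) < w (int i + 1) \<Longrightarrow> wlen (w \<circ> sgen i) = Suc (wlen w)"
  by (simp add: wlen_eq inv_set_step)

lemma wlen_desc: "w \<in> Winf \<Longrightarrow> w (int i + 1) < w (int i) \<Longrightarrow> wlen w = Suc (wlen (w \<circ> sgen i))"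
  by (simp add: wlen_eq inv_set_step_desc)

lemma wlen_asc_iff: "w \<in> Winf \<Longrightarrow> wlen (w \<circ> sgen i) = wlen w + 1 \<longleftrightarrow> w (int i) < w (int i + 1)"
  using wlen_asc[of w i] wlen_desc[of w i] Winf_inj[of w "int i" "int i + 1"]
  by (cases "w (int i) < w (int i + 1)") force+

lemma wlen_desc_iff: "w \<in> Winf \<Longrightarrow> wlen w = wlen (w \<circ> sgen i) + 1 \<longleftrightarrow> w (int i + 1) < w (int i)"
  using wlen_asc[of w i] wlen_desc[of w i] Winf_inj[of w "int i" "int i + 1"]
  by (cases "w (int i) < w (int i + 1)") force+

lemma wlen_comp_le: "v \<in> Winf \<Longrightarrow> w \<in> Winf \<Longrightarrow> wlen (v \<circ> w) \<le> wlen v + wlen w"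
  by (metis length_append reduced_word wlen_wordprod_le wordprod_append)

lemma inv_inv_Winf [simp]: "w \<in> Winf \<Longrightarrow> inv (inv w) = w"
  by (simp add: Winf_bij inv_inv_eq)

lemma inv_comp_Winf: "v \<in> Winf \<Longrightarrow> w \<in> Winf \<Longrightarrow> inv (v \<circ> w) = inv w \<circ> inv v"
  by (simp add: Winf_bij o_inv_distrib)

lemma inv_left [simp]: "w \<in> Winf \<Longrightarrow> inv w \<circ> w = id" "w \<in> Winf \<Longrightarrow> w \<circ> inv w = id"
  using Winf_bij[of w] by (simp_all add: bij_is_inj surj_iff[symmetric] bij_is_surj)

lemma inv_left_apply: "w \<in> Winf \<Longrightarrow> inv w (w x) = x" "w \<in> Winf \<Longrightarrow> w (inv w x) = x"
  using inv_left[of w] by (metis comp_apply id_apply)+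

lemma wlen_inv: "w \<in> Winf \<Longrightarrow> wlen (inv w) = wlen w"
proof -
  have le: "wlen (inv w) \<le> wlen w" if "w \<in> Winf" for w
    using reduced_word[OF that] inv_wordprod by (metis length_rev wlen_wordprod_le)
  assume "w \<in> Winf"
  then show ?thesis using le[of w] le[of "inv w"] by simp
qed

lemma wlen_left_desc:
  assumes "w \<in> Winf"
  shows "wlen w = Suc (wlen (sgen i \<circ> w)) \<longleftrightarrow> inv w (int i + 1) < inv w (int i)"
    "wlen (sgen i \<circ> w) = Suc (wlen w) \<longleftrightarrow> inv w (int i) < inv w (int i + 1)"
proof -
  have 1: "wlen (sgen i \<circ> w) = wlen (inv w \<circ> sgen i)"
    using assms by (metis inv_comp_Winf inv_sgen sgen_Winf wlen_inv comp_Winf)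
  show "wlen w = Suc (wlen (sgen i \<circ> w)) \<longleftrightarrow> inv w (int i + 1) < inv w (int i)"
    "wlen (sgen i \<circ> w) = Suc (wlen w) \<longleftrightarrow> inv w (int i) < inv w (int i + 1)"
    using wlen_desc_iff[of "inv w" i] wlen_asc_iff[of "inv w" i] assms by (auto simp: 1 wlen_inv)
qed

lemma wlen_left_cases:
  assumes "w \<in> Winf"
  shows "wlen w = Suc (wlen (sgen i \<circ> w)) \<or> wlen (sgen i \<circ> w) = Suc (wlen w)"
  using wlen_left_desc[OF assms, of i] Winf_inj[of "inv w" "int i" "int i + 1"] assms by force

section \<open>Grassmannian elements and strict partitions\<close>

lemma grassmannian_iff:
  "grassmannian k w \<longleftrightarrow> w \<in> Winf \<and> (\<forall>i. i \<noteq> k \<longrightarrow> w (int i) < w (int i + 1))"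
  unfolding grassmannian_def using wlen_asc_iff by blast

lemma grassmannian_Winf: "grassmannian k w \<Longrightarrow> w \<in> Winf"
  by (simp add: grassmannian_def)

lemma grassmannian_mono_first:
  assumes "grassmannian k w" "a < b" "b \<le> k"
  shows "w (int a) < w (int b)"
  using assms(2,3)
proof (induction b)
  case (Suc b)
  have "w (int b) < w (int (Suc b))"
    using assms(1) Suc.prems by (simp add: grassmannian_iff add.commute)
  then show ?case using Suc by (cases "a = b") auto
qed simp

lemma grassmannian_mono_last:
  assumes "grassmannian k w" "k < a" "a < b"
  shows "w (int a) < w (int b)"
  using assms(3)
proof (induction b)
  case (Suc b)
  have "w (int b) < w (int (Suc b))"
    using assms(1,2) Suc.prems by (simp add: grassmannian_iff add.commute)
  then show ?case using Suc by (cases "a = b") auto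
qed simp

lemma grassmannian_last_less_iff:
  assumes "grassmannian k w" "1 \<le> i" "1 \<le> j"
  shows "w (int (k + i)) < w (int (k + j)) \<longleftrightarrow> i < j"
  using grassmannian_mono_last[OF assms(1), of "k + i" "k + j"]
    grassmannian_mono_last[OF assms(1), of "k + j" "k + i"] assms(2,3)
  by (cases i j rule: linorder_cases) (auto simp del: of_nat_add)

lemma grassmannian_pos_first:
  assumes "grassmannian k w" "1 \<le> p" "p \<le> k"
  shows "0 < w (int p)"
  using grassmannian_mono_first[OF assms(1), of 0 p] assms Winf_zero[of w]
  by (simp add: grassmannian_Winf)

lemma grassmannian_last_gap:
  assumes "grassmannian k w" "1 \<le> i"
  shows "w (int (k + i)) + int d \<le> w (int (k + (i + d)))"
proof (induction d)
  case (Suc d)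
  have "w (int (k + (i + d))) < w (int (k + (i + Suc d)))"
    using grassmannian_mono_last[OF assms(1), of "k + (i + d)" "k + (i + Suc d)"] assms(2) by simp
  then show ?case using Suc by simp
qed simp

lemma Winf_nonzero: "w \<in> Winf \<Longrightarrow> 1 \<le> p \<Longrightarrow> w (int p) \<noteq> 0"
  using Winf_eq_zero_iff[of w "int p"] by simp

lemma Winf_inj_abs:
  assumes "w \<in> Winf" "1 \<le> p" "1 \<le> q" "\<bar>w (int p)\<bar> = \<bar>w (int q)\<bar>"
  shows "p = q"
proof -
  have "w (int p) = w (int q) \<or> w (int p) = w (- int q)"
    using assms(4) Winf_minus[OF assms(1)] by (simp add: abs_eq_iff)
  then show ?thesis using Winf_inj[OF assms(1)] assms(2,3) by auto
qed

lemma Winf_ex_abs: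
  assumes "w \<in> Winf" "0 < v"
  obtains p where "1 \<le> p" "\<bar>w (int p)\<bar> = v"
proof -
  define x where "x = inv w v"
  have wx: "w x = v" using assms(1) by (simp add: x_def inv_left_apply)
  have "x \<noteq> 0" using wx assms Winf_zero by force
  moreover have "\<bar>w (int (nat \<bar>x\<bar>))\<bar> = v"
    using wx Winf_minus[OF assms(1), of x] assms(2) by (cases "x \<ge> 0") auto
  ultimately show ?thesis using that[of "nat \<bar>x\<bar>"] by auto
qed

lemma value_cases:
  assumes "grassmannian k w" "0 < v"
  obtains (first) p where "1 \<le> p" "p \<le> k" "w (int p) = v"
  | (pos) j where "1 \<le> j" "w (int (k + j)) = v"
  | (neg) j where "1 \<le> j" "w (int (k + j)) = - v"
proof -
  obtain p where p: "1 \<le> p" "\<bar>w (int p)\<bar> = v" using Winf_ex_abs grassmannian_Winf assms by blast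
  show ?thesis
  proof (cases "p \<le> k")
    case True
    then show ?thesis using first[of p] p grassmannian_pos_first[OF assms(1) p(1)] by simp
  next
    case False
    then have "k + (p - k) = p" "1 \<le> p - k" by auto
    then show ?thesis using pos[of "p - k"] neg[of "p - k"] p(2)
      by (cases "w (int p) < 0") (simp_all del: of_nat_add)
  qed
qed

text \<open>The absolute values |w 1|, |w 2|, ... run through the positive integers once each, so
  exactly x of them are at most x. The count is split into the first k positions, where the values
  are positive, and the rest.\<close>

lemma count_values:
  assumes "grassmannian k w" "0 \<le> x"
  shows "nat x = card {p. 1 \<le> p \<and> p \<le> k \<and> w (int p) \<le> x} + card {i. 1 \<le> i \<and> \<bar>w (int (k + i))\<bar> \<le> x}"
    "finite {i. 1 \<le> i \<and> \<bar>w (int (k + i))\<bar> \<le> x}"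
proof -
  have w: "w \<in> Winf" using assms by (simp add: grassmannian_Winf)
  let ?P = "{p. 1 \<le> p \<and> \<bar>w (int p)\<bar> \<le> x}"
  let ?A = "{p. 1 \<le> p \<and> p \<le> k \<and> w (int p) \<le> x}" and ?B = "{i. 1 \<le> i \<and> \<bar>w (int (k + i))\<bar> \<le> x}"
  have bij: "bij_betw (\<lambda>p. \<bar>w (int p)\<bar>) ?P {1..x}"
  proof (rule bij_betw_imageI)
    show "inj_on (\<lambda>p. \<bar>w (int p)\<bar>) ?P" using Winf_inj_abs[OF w] by (auto intro: inj_onI)
    show "(\<lambda>p. \<bar>w (int p)\<bar>) ` ?P = {1..x}"
    proof (intro equalityI subsetI)
      fix v assume "v \<in> (\<lambda>p. \<bar>w (int p)\<bar>) ` ?P"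
      then obtain p where "v = \<bar>w (int p)\<bar>" "p \<in> ?P" by blast
      then show "v \<in> {1..x}" using Winf_nonzero[OF w, of p] by auto
    next
      fix v assume v: "v \<in> {1..x}"
      obtain p where p: "1 \<le> p" "\<bar>w (int p)\<bar> = v" by (rule Winf_ex_abs[OF w, of v]) (use v in auto)
      then have "p \<in> ?P" using v by simp
      then show "v \<in> (\<lambda>p. \<bar>w (int p)\<bar>) ` ?P" using p(2) by force
    qed
  qed
  have finP: "finite ?P" using bij_betw_finite[OF bij] by simp
  have cardP: "card ?P = nat x" using bij_betw_same_card[OF bij] by simp
  have un: "?P = ?A \<union> (\<lambda>i. k + i) ` ?B"
  proof (intro equalityI subsetI)
    fix p assume p: "p \<in> ?P"
    show "p \<in> ?A \<union> (\<lambda>i. k + i) ` ?B"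
    proof (cases "p \<le> k")
      case True then show ?thesis using p by auto
    next
      case False
      then have "p = k + (p - k)" "p - k \<in> ?B" using p by auto
      then show ?thesis by blast
    qed
  next
    fix p assume "p \<in> ?A \<union> (\<lambda>i. k + i) ` ?B"
    then show "p \<in> ?P" using grassmannian_pos_first[OF assms(1), of p] by auto
  qed
  have finB: "finite ((\<lambda>i. k + i) ` ?B)"
    by (rule finite_subset[OF _ finP]) (subst un, blast)
  have inj: "inj_on (\<lambda>i. k + i) ?B" by (simp add: inj_on_def)
  show "finite ?B" using finB inj by (rule finite_imageD)
  have "card ?P = card ?A + card ((\<lambda>i. k + i) ` ?B)"
    unfolding un by (rule card_Un_disjoint) (use finB in auto)
  then show "nat x = card ?A + card ?B" using cardP card_image[OF inj] by simp
qed

lemma grass_part_neg: "w (int (k + j)) < 0 \<Longrightarrow> int (grass_part k w j) = int k - w (int (k + j))"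
  by (simp add: grass_part_def)

lemma grass_part_pos:
  assumes "grassmannian k w" "1 \<le> j" "0 < w (int (k + j))"
  shows "int (grass_part k w j) = int k - int (card {p. 1 \<le> p \<and> p \<le> k \<and> w (int p) \<le> w (int (k + j))})"
    "grass_part k w j \<le> k"
proof -
  let ?b = "w (int (k + j))"
  let ?A = "{p. 1 \<le> p \<and> p \<le> k \<and> w (int p) \<le> ?b}" and ?B = "{p. 1 \<le> p \<and> p \<le> k \<and> w (int p) > ?b}"
  have "?A \<union> ?B = {1..k}" by auto
  moreover have "card (?A \<union> ?B) = card ?A + card ?B" by (rule card_Un_disjoint) auto
  ultimately have "card ?A + card ?B = k" by simp
  moreover have "grass_part k w j = card ?B" using assms(3) by (simp add: grass_part_def)
  ultimately show "int (grass_part k w j) = int k - int (card ?A)" "grass_part k w j \<le> k" by simp_all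
qed

lemma grass_part_gt_iff:
  assumes "grassmannian k w" "1 \<le> j"
  shows "k < grass_part k w j \<longleftrightarrow> w (int (k + j)) < 0"
  using grass_part_pos(2)[OF assms] grass_part_neg[of w k j] Winf_nonzero[OF grassmannian_Winf[OF assms(1)], of "k + j"] assms(2)
  by (cases "w (int (k + j))" "0::int" rule: linorder_cases) (auto simp del: of_nat_add)

text \<open>Count the positions whose absolute value is at most the given value b. In the last block
  these are j itself and the earlier rows i with w(k+i) > -b; the first block contributes k minus
  the part. The formula is the shape of \<beta>_j for a positive value.\<close>

lemma grass_value:
  assumes "grassmannian k w" "1 \<le> j" "0 < w (int (k + j))"
  shows "w (int (k + j)) = int k + 1 - int (grass_part k w j)
    + int (card {i. 1 \<le> i \<and> i < j \<and> 0 < w (int (k + i)) + w (int (k + j))})"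
proof -
  let ?b = "w (int (k + j))"
  let ?I = "{i. 1 \<le> i \<and> i < j \<and> 0 < w (int (k + i)) + ?b}"
  have "{i. 1 \<le> i \<and> \<bar>w (int (k + i))\<bar> \<le> ?b} = insert j ?I"
  proof (intro equalityI subsetI)
    fix i assume i: "i \<in> {i. 1 \<le> i \<and> \<bar>w (int (k + i))\<bar> \<le> ?b}"
    then have "\<not> j < i" using grassmannian_last_less_iff[OF assms(1,2), of i] by auto
    moreover have "w (int (k + i)) \<noteq> - ?b"
    proof
      assume "w (int (k + i)) = - ?b"
      then have "k + i = k + j" using Winf_inj_abs[OF grassmannian_Winf[OF assms(1)], of "k+i" "k+j"] i assms(2) by simp
      then show False using \<open>w (int (k + i)) = - ?b\<close> assms(3) by simp
    qed
    ultimately show "i \<in> insert j ?I" using i by auto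
  next
    fix i assume i: "i \<in> insert j ?I"
    then show "i \<in> {i. 1 \<le> i \<and> \<bar>w (int (k + i))\<bar> \<le> ?b}"
      using grassmannian_last_less_iff[OF assms(1), of i j] assms by auto
  qed
  then have "nat ?b = card {p. 1 \<le> p \<and> p \<le> k \<and> w (int p) \<le> ?b} + card (insert j ?I)"
    using count_values(1)[OF assms(1), of ?b] assms(3) by simp
  then show ?thesis using grass_part_pos(1)[OF assms] assms(3) by simp
qed

text \<open>Two negative values at distance j - i differ by at least j - i, and positive values have
  parts at most k, so equal signs are immediate. For opposite signs both sides compare -w(k+i) with
  a count of absolute values.\<close>

lemma grass_pair_iff:
  assumes "grassmannian k w" "1 \<le> i" "i < j"
  shows "2 * k + (j - i) < grass_part k w i + grass_part k w j \<longleftrightarrow> w (int (k + i)) + w (int (k + j)) < 0"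
proof -
  let ?a = "w (int (k + i))" and ?b = "w (int (k + j))"
  have w: "w \<in> Winf" using assms by (simp add: grassmannian_Winf)
  have j: "1 \<le> j" using assms by simp
  have ab: "?a < ?b" using grassmannian_last_less_iff[OF assms(1,2) j] assms(3) by blast
  have nz: "?a \<noteq> 0" "?b \<noteq> 0" using Winf_nonzero[OF w, of "k+i"] Winf_nonzero[OF w, of "k+j"] assms j by auto
  consider "?b < 0" | "?a < 0" "0 < ?b" | "0 < ?a" using nz by linarith
  then show ?thesis
  proof cases
    case 1
    have "?a + int (j - i) \<le> ?b" using grassmannian_last_gap[OF assms(1,2), of "j - i"] assms(3) by simp
    then show ?thesis using 1 ab grass_part_neg[of w k i] grass_part_neg[of w k j] by simp
  next
    case 3
    then have "grass_part k w i \<le> k" "grass_part k w j \<le> k"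
      using grass_part_pos(2)[OF assms(1)] assms(2) j ab by auto
    then show ?thesis using 3 ab by simp
  next
    case 2
    \<comment> \<open>The number -?a is \<open>?N (- ?a)\<close> plus the size of \<open>?A\<close>.
      If the sum of the values is negative, \<open>?A\<close> contains \<open>{i..j}\<close>;
      otherwise it lies in \<open>{i..<j}\<close>. This difference of one separates the two sides of
      the inequality.\<close>
    let ?N = "\<lambda>x. card {p. 1 \<le> p \<and> p \<le> k \<and> w (int p) \<le> x}"
    let ?A = "{m. 1 \<le> m \<and> \<bar>w (int (k + m))\<bar> \<le> - ?a}"
    have cnt: "nat (- ?a) = ?N (- ?a) + card ?A" and fin: "finite ?A"
      using count_values[OF assms(1), of "- ?a"] 2 by auto
    have g: "int (grass_part k w i) = int k - ?a" "int (grass_part k w j) = int k - int (?N ?b)"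
      using grass_part_neg[of w k i] grass_part_pos(1)[OF assms(1) j] 2 by auto
    have ne: "- ?a \<noteq> ?b"
    proof
      assume "- ?a = ?b"
      then have "\<bar>?a\<bar> = \<bar>?b\<bar>" by simp
      then have "k + i = k + j" by (intro Winf_inj_abs[OF w]) (use assms j in auto)
      then show False using assms(3) by simp
    qed
    show ?thesis
    proof (cases "?a + ?b < 0")
      case True
      have "{i..j} \<subseteq> ?A"
      proof
        fix m assume m: "m \<in> {i..j}"
        have "?a \<le> w (int (k + m))" "w (int (k + m)) \<le> ?b"
          using m grassmannian_last_less_iff[OF assms(1), of i m] grassmannian_last_less_iff[OF assms(1), of m j] assms(2)
          by (cases "m = i"; cases "m = j"; force)+
        then show "m \<in> ?A" using True m assms(2) by auto
      qed
      then have "j - i + 1 \<le> card ?A" using card_mono[OF fin, of "{i..j}"] assms(3) by simp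
      moreover have "?N ?b \<le> ?N (- ?a)" by (rule card_mono) (use True in auto)
      ultimately have "int (?N ?b) + int (j - i) + 1 \<le> - ?a" using cnt 2 by linarith
      then show ?thesis using True g by linarith
    next
      case False
      have "?A \<subseteq> {i..<j}"
      proof
        fix m assume m: "m \<in> ?A"
        then have "\<not> m < i" "\<not> j \<le> m"
          using grassmannian_last_less_iff[OF assms(1), of m i] grassmannian_last_less_iff[OF assms(1), of j m] assms(2) j False ne
          by (cases "m = j"; auto)+
        then show "m \<in> {i..<j}" by simp
      qed
      then have "card ?A \<le> j - i" using card_mono[of "{i..<j}" ?A] by simp
      moreover have "?N (- ?a) \<le> ?N ?b" by (rule card_mono) (use False ne in auto)
      ultimately have "- ?a \<le> int (?N ?b) + int (j - i)" using cnt 2 by linarith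
      then show ?thesis using False g by linarith
    qed
  qed
qed

lemma Cset_grass:
  assumes "grassmannian k w" "\<And>i. 1 \<le> i \<Longrightarrow> part lam i = grass_part k w i"
  shows "(i, j) \<in> Cset k lam \<longleftrightarrow> 1 \<le> i \<and> i < j \<and> w (int (k + i)) + w (int (k + j)) < 0"
  using grass_pair_iff[OF assms(1), of i j] assms(2)[of i] assms(2)[of j]
  by (auto simp: Cset_def simp del: of_nat_add)

text \<open>With \<open>Cset_grass\<close> this is the dictionary from \<lambda> to w: afterwards
  the effect of a reflection on the upper indices and on the raising operator is read off from
  values of w. The +1 for negative values reflects that w skips 0.\<close>

lemma betaseq_grass:
  assumes "grassmannian k w" "\<And>i. 1 \<le> i \<Longrightarrow> part lam i = grass_part k w i" "1 \<le> j"
  shows "betaseq k lam j = (if w (int (k + j)) < 0 then w (int (k + j)) + 1 else w (int (k + j)))"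
proof (cases "w (int (k + j)) < 0")
  case True
  have "{i. 1 \<le> i \<and> i < j \<and> (i, j) \<notin> Cset k lam} = {}"
    using True grassmannian_last_less_iff[OF assms(1) _ assms(3)] Cset_grass[OF assms(1,2)] by fastforce
  then show ?thesis using True grass_part_neg[of w k j] assms(2,3)
    by (simp add: betaseq_def del: of_nat_add)
next
  case False
  then have pos: "0 < w (int (k + j))"
    using Winf_nonzero[OF grassmannian_Winf[OF assms(1)], of "k + j"] assms(3) by simp
  have "{i. 1 \<le> i \<and> i < j \<and> (i, j) \<notin> Cset k lam} = {i. 1 \<le> i \<and> i < j \<and> 0 < w (int (k + i)) + w (int (k + j))}"
  proof -
    have "w (int (k + i)) + w (int (k + j)) \<noteq> 0" if "1 \<le> i" "i < j" for i
    proof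
      assume "w (int (k + i)) + w (int (k + j)) = 0"
      then have "\<bar>w (int (k + i))\<bar> = \<bar>w (int (k + j))\<bar>" by simp
      then have "k + i = k + j" by (intro Winf_inj_abs[OF grassmannian_Winf[OF assms(1)]]) (use that in auto)
      then show False using that by simp
    qed
    then show ?thesis using Cset_grass[OF assms(1,2)] by force
  qed
  then show ?thesis using False grass_value[OF assms(1,3) pos] assms(2,3)
    by (simp add: betaseq_def del: of_nat_add)
qed

text \<open>The quotient of v by w fixes all positions beyond k and maps the first k to themselves.
  There it is increasing because v and w are, so it has no descent.\<close>

lemma grassmannian_eqI:
  assumes v: "grassmannian k v" and w: "grassmannian k w"
    and eq: "\<And>j. 1 \<le> j \<Longrightarrow> v (int (k + j)) = w (int (k + j))"
  shows "v = w"
proof -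
  have W: "v \<in> Winf" "w \<in> Winf" using v w by (auto intro: grassmannian_Winf)
  define x where "x = inv w \<circ> v"
  have xW: "x \<in> Winf" using W by (simp add: x_def)
  have wx: "w (x p) = v p" for p using W by (simp add: x_def inv_left_apply)
  have last: "x (int p) = int p" if "k < p" for p
  proof -
    have "w (x (int p)) = w (int p)" using wx eq[of "p - k"] that by simp
    then show ?thesis using Winf_inj[OF W(2)] by blast
  qed
  have first: "1 \<le> x (int p) \<and> x (int p) \<le> int k" if p: "1 \<le> p" "p \<le> k" for p
  proof -
    obtain q where q: "1 \<le> q" "\<bar>w (int q)\<bar> = v (int p)"
      by (rule Winf_ex_abs[OF W(2) grassmannian_pos_first[OF v p]])
    have "q \<le> k"
    proof (rule ccontr)
      assume "\<not> q \<le> k"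
      then have "v (int q) = w (int q)" using eq[of "q - k"] by simp
      then have "\<bar>v (int q)\<bar> = \<bar>v (int p)\<bar>" using q(2) by simp
      then have "q = p" using Winf_inj_abs[OF W(1) q(1) p(1)] by blast
      then show False using \<open>\<not> q \<le> k\<close> p by simp
    qed
    then have "w (int q) = w (x (int p))" using q wx grassmannian_pos_first[OF w q(1)] by simp
    then have "x (int p) = int q" using Winf_inj[OF W(2)] by simp
    then show ?thesis using q(1) \<open>q \<le> k\<close> by simp
  qed
  have "x (int i) < x (int i + 1)" for i
  proof (cases "i \<ge> k")
    case True
    then have "x (int i + 1) = int i + 1" using last[of "Suc i"] by (simp add: add.commute)
    moreover have "x (int i) \<le> int i" using last[of i] first[of i] True Winf_zero[OF xW]
      by (cases "i = 0"; cases "i = k") auto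
    ultimately show ?thesis by simp
  next
    case False
    show ?thesis
    proof (cases "i = 0")
      case True
      then show ?thesis using first[of 1] False Winf_zero[OF xW] by simp
    next
      case i0: False
      define a where "a = nat (x (int i))"
      define b where "b = nat (x (int (Suc i)))"
      have a: "x (int i) = int a" "1 \<le> a" "a \<le> k" using first[of i] False i0 by (auto simp: a_def)
      have b: "x (int (Suc i)) = int b" "1 \<le> b" "b \<le> k" using first[of "Suc i"] False unfolding b_def by linarith+
      have "w (int a) < w (int b)" using wx[of "int i"] wx[of "int (Suc i)"] a b grassmannian_mono_first[OF v, of i "Suc i"] False by simp
      then have "a < b" using grassmannian_mono_first[OF w, of b a] a by (cases a b rule: linorder_cases) auto
      then show ?thesis using a b by (simp add: add.commute)
    qed
  qed
  then have "x = id" using no_descents_id[OF xW] by blast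
  then have "w \<circ> x = w" by simp
  then show ?thesis using wx by (auto simp: fun_eq_iff)
qed

text \<open>A part above k gives a negative value directly. A positive value follows from
  \<open>grass_value\<close>, where the signs of the sums being counted are again determined by the
  parts.\<close>

lemma grassmannian_determined:
  assumes v: "grassmannian k v" and w: "grassmannian k w"
    and eq: "\<And>j. 1 \<le> j \<Longrightarrow> grass_part k v j = grass_part k w j"
  shows "v = w"
proof (rule grassmannian_eqI[OF v w])
  fix j :: nat assume j: "1 \<le> j"
  have neg: "v (int (k + j)) < 0 \<longleftrightarrow> w (int (k + j)) < 0" if "1 \<le> j" for j
    using grass_part_gt_iff[OF v that] grass_part_gt_iff[OF w that] eq[OF that] by simp
  show "v (int (k + j)) = w (int (k + j))"
  proof (cases "w (int (k + j)) < 0")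
    case True
    then show ?thesis using neg[OF j] grass_part_neg[of v k j] grass_part_neg[of w k j] eq[OF j] by simp
  next
    case False
    have pos: "0 < w (int (k + j))" "0 < v (int (k + j))"
      using False neg[OF j] j Winf_nonzero[OF grassmannian_Winf[OF v], of "k + j"]
        Winf_nonzero[OF grassmannian_Winf[OF w], of "k + j"] by simp_all
    have nz: "u (int (k + i)) + u (int (k + j)) \<noteq> 0" if "grassmannian k u" "1 \<le> i" "i < j" for u i
    proof
      assume "u (int (k + i)) + u (int (k + j)) = 0"
      then have "\<bar>u (int (k + i))\<bar> = \<bar>u (int (k + j))\<bar>" by simp
      then have "k + i = k + j" by (intro Winf_inj_abs[OF grassmannian_Winf[OF that(1)]]) (use that j in auto)
      then show False using that by simp
    qed
    have "1 \<le> i \<and> i < j \<and> 0 < v (int (k + i)) + v (int (k + j)) \<longleftrightarrow>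
        1 \<le> i \<and> i < j \<and> 0 < w (int (k + i)) + w (int (k + j))" for i
    proof (cases "1 \<le> i \<and> i < j")
      case True
      then have "v (int (k + i)) + v (int (k + j)) < 0 \<longleftrightarrow> w (int (k + i)) + w (int (k + j)) < 0"
        using grass_pair_iff[OF v, of i j] grass_pair_iff[OF w, of i j] eq[of i] eq[OF j] by simp
      then show ?thesis using nz[OF v, of i] nz[OF w, of i] True by (auto simp del: of_nat_add)
    qed auto
    then have "{i. 1 \<le> i \<and> i < j \<and> 0 < v (int (k + i)) + v (int (k + j))} =
      {i. 1 \<le> i \<and> i < j \<and> 0 < w (int (k + i)) + w (int (k + j))}" by blast
    then show ?thesis using grass_value[OF v j pos(2)] grass_value[OF w j pos(1)] eq[OF j] by simp
  qed
qed

section \<open>Left multiplication of Grassmannian elements by simple reflections\<close>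

lemma sgen_less:
  assumes "x < y" "\<not> (i \<noteq> 0 \<and> (x = int i \<and> y = int i + 1 \<or> x = - int i - 1 \<and> y = - int i))"
    "\<not> (i = 0 \<and> \<bar>x\<bar> \<le> 1 \<and> \<bar>y\<bar> \<le> 1)"
  shows "sgen i x < sgen i y"
proof (cases "i = 0")
  case True
  then show ?thesis using assms by (auto simp: sgen_apply)
next
  case False
  then have i: "int i \<ge> 1" by simp
  consider "x = int i" | "x = int i + 1" | "x = - int i" | "x = - int i - 1"
    | "x \<noteq> int i" "x \<noteq> int i + 1" "x \<noteq> - int i" "x \<noteq> - int i - 1" by blast
  then show ?thesis
    by cases (use assms i False in \<open>auto simp: sgen_apply\<close>)
qed

lemma grassmannian_left:
  assumes w: "grassmannian k w"
    and nb: "\<And>p. p \<noteq> k \<Longrightarrow> i \<noteq> 0 \<Longrightarrow> \<not> (w (int p) = int i \<and> w (int (Suc p)) = int i + 1)"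
      "\<And>p. p \<noteq> k \<Longrightarrow> i \<noteq> 0 \<Longrightarrow> \<not> (w (int p) = - int i - 1 \<and> w (int (Suc p)) = - int i)"
      "\<And>p. p \<noteq> k \<Longrightarrow> i = 0 \<Longrightarrow> \<not> (\<bar>w (int p)\<bar> \<le> 1 \<and> \<bar>w (int (Suc p))\<bar> \<le> 1)"
  shows "grassmannian k (sgen i \<circ> w)"
  unfolding grassmannian_iff
proof (intro conjI allI impI)
  show "sgen i \<circ> w \<in> Winf" using w by (simp add: grassmannian_Winf)
  fix p assume p: "p \<noteq> k"
  have "w (int p) < w (int (Suc p))" using w p by (simp add: grassmannian_iff add.commute)
  then have "sgen i (w (int p)) < sgen i (w (int (Suc p)))"
    using nb[OF p] by (intro sgen_less) blast+
  then show "(sgen i \<circ> w) (int p) < (sgen i \<circ> w) (int p + 1)" by (simp add: add.commute)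
qed

text \<open>The left multiplications that remove a box: \<open>s\<^sub>i w\<close> is shorter and its partition is that of
  \<open>w\<close> with the \<open>j\<close>-th part decreased by one.\<close>

definition lowers :: "nat \<Rightarrow> (int \<Rightarrow> int) \<Rightarrow> nat \<Rightarrow> nat \<Rightarrow> bool" where
  "lowers k w i j \<longleftrightarrow> 1 \<le> j \<and>
     (1 \<le> i \<and> w (int (k + j)) = int i \<and> (\<exists>p. 1 \<le> p \<and> p \<le> k \<and> w (int p) = int i + 1) \<or>
      w (int (k + j)) = - int i - 1 \<and> (i \<noteq> 0 \<longrightarrow> (\<forall>m\<ge>1. w (int (k + m)) \<noteq> - int i)))"

lemma sgen_fix: "\<bar>x\<bar> \<noteq> int i \<Longrightarrow> \<bar>x\<bar> \<noteq> int i + 1 \<Longrightarrow> sgen i x = x"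
  by (auto simp: sgen_apply)

lemma lowers_grassmannian:
  assumes w: "grassmannian k w" and l: "lowers k w i j"
  shows "grassmannian k (sgen i \<circ> w)"
proof -
  have W: "w \<in> Winf" using w by (rule grassmannian_Winf)
  have j: "1 \<le> j" using l by (simp add: lowers_def)
  have pos: "0 < w (int p) \<or> k < p" if "p \<noteq> 0" for p using grassmannian_pos_first[OF w, of p] that by linarith
  consider (A) p where "1 \<le> i" "w (int (k + j)) = int i" "1 \<le> p" "p \<le> k" "w (int p) = int i + 1"
    | (B) "w (int (k + j)) = - int i - 1" "i \<noteq> 0 \<Longrightarrow> \<forall>m\<ge>1. w (int (k + m)) \<noteq> - int i"
    using l unfolding lowers_def by blast
  then show ?thesis
  proof cases
    case A
    show ?thesis
    proof (rule grassmannian_left[OF w])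
      fix q assume q: "q \<noteq> k"
      show "\<not> (w (int q) = int i \<and> w (int (Suc q)) = int i + 1)"
      proof
        assume h: "w (int q) = int i \<and> w (int (Suc q)) = int i + 1"
        then have "int q = int (k + j)" "int (Suc q) = int p" using A Winf_inj[OF W] by metis+
        then show False using A by simp
      qed
      show "\<not> (w (int q) = - int i - 1 \<and> w (int (Suc q)) = - int i)"
      proof
        assume h: "w (int q) = - int i - 1 \<and> w (int (Suc q)) = - int i"
        then have "q \<noteq> 0" using Winf_zero[OF W] by (cases "q = 0") auto
        then have "q = p" using Winf_inj_abs[OF W, of q p] h A by simp
        then show False using h A by simp
      qed
    qed (use A in auto)
  next
    case B
    have ni: "\<bar>w (int q)\<bar> = int i + 1 \<Longrightarrow> q \<noteq> 0 \<Longrightarrow> q = k + j" for q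
      using Winf_inj_abs[OF W, of q "k + j"] B(1) j by simp
    show ?thesis
    proof (rule grassmannian_left[OF w])
      fix q assume q: "q \<noteq> k"
      show "\<not> (w (int q) = int i \<and> w (int (Suc q)) = int i + 1)"
      proof
        assume h: "w (int q) = int i \<and> w (int (Suc q)) = int i + 1"
        then have "Suc q = k + j" using ni[of "Suc q"] by simp
        then show False using h B(1) by simp
      qed
      assume i0: "i \<noteq> 0"
      show "\<not> (w (int q) = - int i - 1 \<and> w (int (Suc q)) = - int i)"
      proof
        assume h: "w (int q) = - int i - 1 \<and> w (int (Suc q)) = - int i"
        have "\<not> Suc q \<le> k" using pos[of "Suc q"] h i0 by auto
        then have "Suc q = k + (Suc q - k)" "1 \<le> Suc q - k" by auto
        then show False using B(2)[OF i0] h by metis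
      qed
    next
      fix q assume q: "q \<noteq> k" and i0: "i = 0"
      show "\<not> (\<bar>w (int q)\<bar> \<le> 1 \<and> \<bar>w (int (Suc q))\<bar> \<le> 1)"
      proof
        assume h: "\<bar>w (int q)\<bar> \<le> 1 \<and> \<bar>w (int (Suc q))\<bar> \<le> 1"
        have 1: "\<bar>w (int r)\<bar> = 1" if "r \<noteq> 0" "\<bar>w (int r)\<bar> \<le> 1" for r
          using Winf_nonzero[OF W, of r] that by linarith
        have "Suc q = k + j" using ni[of "Suc q"] 1[of "Suc q"] h i0 by simp
        moreover have "q = k + j" if "q \<noteq> 0" using ni[of q] 1[of q] h i0 that by simp
        ultimately have "q = 0" by linarith
        then show False using \<open>Suc q = k + j\<close> j q by simp
      qed
    qed
  qed
qed

text \<open>If the value i in row j is exchanged with i+1 at a position p of the first block, then p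
  alone leaves the set counted by the part. If -i-1 is replaced by -i, the absolute value drops by
  one; for i = 0 the value -1 becomes 1, below all of the first block, and the part drops from k+1
  to k.\<close>

lemma lowers_part:
  assumes w: "grassmannian k w" and l: "lowers k w i j"
  shows "grass_part k w j = Suc (grass_part k (sgen i \<circ> w) j)"
    and "1 \<le> m \<Longrightarrow> m \<noteq> j \<Longrightarrow> grass_part k (sgen i \<circ> w) m = grass_part k w m"
proof -
  have W: "w \<in> Winf" using w by (rule grassmannian_Winf)
  have j: "1 \<le> j" using l by (simp add: lowers_def)
  have posf: "0 < w (int p)" if "1 \<le> p" "p \<le> k" for p using grassmannian_pos_first[OF w that] .
  have cases: "(\<exists>p. 1 \<le> i \<and> w (int (k + j)) = int i \<and> 1 \<le> p \<and> p \<le> k \<and> w (int p) = int i + 1) \<or>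
     (w (int (k + j)) = - int i - 1 \<and> (i \<noteq> 0 \<longrightarrow> (\<forall>m\<ge>1. w (int (k + m)) \<noteq> - int i)))"
    using l unfolding lowers_def by blast
  have same: "p = q" if "1 \<le> p" "1 \<le> q" "\<bar>w (int p)\<bar> = \<bar>w (int q)\<bar>" for p q
    using Winf_inj_abs[OF W that] .
  consider (A) p where "1 \<le> i" "w (int (k + j)) = int i" "1 \<le> p" "p \<le> k" "w (int p) = int i + 1"
    | (B) "w (int (k + j)) = - int i - 1" "i \<noteq> 0 \<longrightarrow> (\<forall>m\<ge>1. w (int (k + m)) \<noteq> - int i)"
    using cases by blast
  note split = this
  show "grass_part k w j = Suc (grass_part k (sgen i \<circ> w) j)"
    using cases
  proof (elim disjE exE conjE)
    fix p assume A: "1 \<le> i" "w (int (k + j)) = int i" "1 \<le> p" "p \<le> k" "w (int p) = int i + 1"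
    let ?S = "{q. 1 \<le> q \<and> q \<le> k \<and> w (int q) > int i}" and ?T = "{q. 1 \<le> q \<and> q \<le> k \<and> sgen i (w (int q)) > int i + 1}"
    have "?T = ?S - {p}"
    proof (intro set_eqI)
      fix q
      show "q \<in> ?T \<longleftrightarrow> q \<in> ?S - {p}"
      proof (cases "1 \<le> q \<and> q \<le> k")
        case True
        have "w (int q) \<noteq> int i" using same[of q "k + j"] A True j by auto
        moreover have "w (int q) = int i + 1 \<longleftrightarrow> q = p" using same[of q p] A True by auto
        ultimately show ?thesis using True posf[of q] A by (auto simp: sgen_apply)
      qed auto
    qed
    moreover have "p \<in> ?S" using A by simp
    ultimately have "card ?S = Suc (card ?T)" using card_Suc_Diff1[of ?S p] by simp
    moreover have "sgen i (int i) = int i + 1" using A(1) by (simp add: sgen_apply)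
    ultimately show ?thesis using A(1,2) by (simp add: grass_part_def del: of_nat_add)
  next
    assume B: "w (int (k + j)) = - int i - 1"
    show ?thesis
    proof (cases "i = 0")
      case True
      have "{q. 1 \<le> q \<and> q \<le> k \<and> sgen i (w (int q)) > 1} = {1..k}"
      proof (intro equalityI subsetI)
        fix q assume q: "q \<in> {1..k}"
        have "w (int q) \<noteq> 1" using same[of q "k + j"] B True q j by auto
        then show "q \<in> {q. 1 \<le> q \<and> q \<le> k \<and> sgen i (w (int q)) > 1}"
          using posf[of q] q True by (auto simp: sgen_apply)
      qed auto
      then have "card {q. 1 \<le> q \<and> q \<le> k \<and> sgen i (w (int q)) > 1} = k" by simp
      moreover have "sgen i (- 1) = 1" using True by (simp add: sgen_apply)
      ultimately show ?thesis using B True by (simp add: grass_part_def del: of_nat_add)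
    next
      case False
      have "sgen i (- int i - 1) = - int i" using False by (simp add: sgen_apply)
      then show ?thesis using B False by (simp add: grass_part_def nat_add_distrib del: of_nat_add)
    qed
  qed
  assume m: "1 \<le> m" "m \<noteq> j"
  let ?x = "w (int (k + m))"
  have nj: "\<bar>?x\<bar> \<noteq> \<bar>w (int (k + j))\<bar>" using same[of "k + m" "k + j"] m j by auto
  have nz: "?x \<noteq> 0" using Winf_nonzero[OF W, of "k + m"] m by simp
  show "grass_part k (sgen i \<circ> w) m = grass_part k w m"
  proof (cases "?x < 0")
    case True
    have "\<bar>?x\<bar> \<noteq> int i \<and> \<bar>?x\<bar> \<noteq> int i + 1"
      using split
    proof cases
      case (A p)
      then show ?thesis using nj same[of "k + m" p] m by auto
    next
      case B
      then show ?thesis using m True nj by (cases "i = 0") (auto simp del: of_nat_add)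
    qed
    then have "sgen i ?x = ?x" by (intro sgen_fix) auto
    then show ?thesis using True by (simp add: grass_part_def del: of_nat_add)
  next
    case False
    have x: "0 < ?x" using False nz by simp
    have iff: "sgen i ?x < sgen i (w (int q)) \<longleftrightarrow> ?x < w (int q)" if q: "1 \<le> q" "q \<le> k" for q
    proof -
      have ne: "w (int q) \<noteq> ?x" using Winf_inj[OF W, of "int q" "int (k + m)"] q m by simp
      have bad: "\<not> (?x = int i \<and> w (int q) = int i + 1) \<and> \<not> (w (int q) = int i \<and> ?x = int i + 1) \<and>
        \<not> (i = 0 \<and> \<bar>?x\<bar> \<le> 1)"
        using split
      proof cases
        case (A p)
        then show ?thesis using nj same[of "k + m" p] m by auto
      next
        case B
        then show ?thesis using nj x same[of q "k + j"] q j by (auto simp del: of_nat_add)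
      qed
      have "sgen i u < sgen i v" if "u < v" "{u, v} = {?x, w (int q)}" for u v
        by (rule sgen_less[OF that(1)]) (use that(2) bad x posf[OF q] in \<open>auto simp: doubleton_eq_iff\<close>)
      then show ?thesis using ne by (metis insert_commute linorder_less_linear order_less_asym)
    qed
    have "0 < sgen i ?x"
    proof (cases "i = 0")
      case True
      have "?x \<noteq> 1" using cases nj x True by auto
      then show ?thesis using x True by (simp add: sgen_apply)
    next
      case False
      then show ?thesis using x by (auto simp: sgen_apply)
    qed
    then have "{p. 1 \<le> p \<and> p \<le> k \<and> sgen i ?x < sgen i (w (int p))} = {p. 1 \<le> p \<and> p \<le> k \<and> ?x < w (int p)}"
      using iff by blast
    then show ?thesis using x \<open>0 < sgen i ?x\<close> by (simp add: grass_part_def del: of_nat_add)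
  qed
qed

lemma inv_eqI: "w \<in> Winf \<Longrightarrow> w x = y \<Longrightarrow> inv w y = x"
  by (auto simp: inv_left_apply)

lemma inv_eqI_minus: "w \<in> Winf \<Longrightarrow> w x = - y \<Longrightarrow> inv w y = - x"
  by (rule inv_eqI) (simp_all add: Winf_minus)

text \<open>The case depends on where the absolute values i and i+1 occur and with which signs. Two
  consecutive integers in the last block occupy consecutive positions, as this block is increasing;
  this is the origin of \<open>Suc j\<close>.\<close>

lemma left_reflection_cases:
  assumes w: "grassmannian k w" and i: "1 \<le> i"
  obtains (low) j where "lowers k w i j" "inv w (int i + 1) < inv w (int i)"
  | (none) "\<And>j. 1 \<le> j \<Longrightarrow> w (int (k + j)) \<noteq> int i" "\<And>j. 1 \<le> j \<Longrightarrow> w (int (k + j)) \<noteq> - int i - 1"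
      "inv w (int i) < inv w (int i + 1)"
  | (pos) j where "1 \<le> j" "w (int (k + j)) = int i" "w (int (k + Suc j)) = int i + 1"
      "inv w (int i) < inv w (int i + 1)"
  | (neg) j where "1 \<le> j" "w (int (k + j)) = - int i - 1" "w (int (k + Suc j)) = - int i"
      "inv w (int i) < inv w (int i + 1)"
proof -
  have W: "w \<in> Winf" using w by (rule grassmannian_Winf)
  note inv1 = inv_eqI[OF W] and inv2 = inv_eqI_minus[OF W]
  have same: "p = q" if "1 \<le> p" "1 \<le> q" "\<bar>w (int p)\<bar> = \<bar>w (int q)\<bar>" for p q
    using Winf_inj_abs[OF W that] .
  have nolast: "\<bar>w (int (k + j))\<bar> \<noteq> \<bar>w (int p)\<bar>" if "1 \<le> j" "1 \<le> p" "p \<le> k" for j p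
    using same[of "k + j" p] that by auto
  have adj: "m = Suc j" if "1 \<le> j" "1 \<le> m" "w (int (k + m)) = w (int (k + j)) + 1" for j m
  proof -
    have "j < m" using grassmannian_last_less_iff[OF w that(1,2)] that(3) by simp
    moreover have "\<not> Suc j < m"
    proof
      assume "Suc j < m"
      then have "w (int (k + j)) < w (int (k + Suc j))" "w (int (k + Suc j)) < w (int (k + m))"
        using grassmannian_last_less_iff[OF w] that(1,2) by (simp_all del: of_nat_add of_nat_Suc add_Suc_right)
      then show False using that(3) by simp
    qed
    ultimately show ?thesis by simp
  qed
  show ?thesis
  proof (rule value_cases[OF w, of "int i"])
    show "0 < int i" using i by simp
  next
    fix p assume p: "1 \<le> p" "p \<le> k" "w (int p) = int i"
    show ?thesis
    proof (rule value_cases[OF w, of "int i + 1"])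
      fix q assume q: "1 \<le> q" "q \<le> k" "w (int q) = int i + 1"
      have "p < q" using grassmannian_mono_first[OF w, of q p] p q by (cases p q rule: linorder_cases) auto
      then show ?thesis using nolast[of _ p] nolast[of _ q] p q inv1[of "int p"] inv1[of "int q"]
        by (intro none) force+
    next
      fix q assume q: "1 \<le> q" "w (int (k + q)) = int i + 1"
      show ?thesis
      proof (rule none)
        show "inv w (int i) < inv w (int i + 1)" using inv1[OF p(3)] inv1[OF q(2)] p q by simp
        show "w (int (k + j)) \<noteq> - int i - 1" if "1 \<le> j" for j
          using same[of "k + j" "k + q"] that q by auto
      qed (use nolast[of _ p] p in force)
    next
      fix q assume q: "1 \<le> q" "w (int (k + q)) = - (int i + 1)"
      have "lowers k w i q" unfolding lowers_def using q nolast[of _ p] p by force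
      then show ?thesis using inv1[OF p(3)] inv2[OF q(2)] p q by (intro low[of q]) auto
    qed simp
  next
    fix p assume p: "1 \<le> p" "w (int (k + p)) = int i"
    show ?thesis
    proof (rule value_cases[OF w, of "int i + 1"])
      fix q assume q: "1 \<le> q" "q \<le> k" "w (int q) = int i + 1"
      have "lowers k w i p" unfolding lowers_def using p q i by blast
      then show ?thesis using inv1[OF p(2)] inv1[OF q(3)] p q by (intro low[of p]) auto
    next
      fix q assume q: "1 \<le> q" "w (int (k + q)) = int i + 1"
      have "q = Suc p" using adj[of p q] p q by simp
      then show ?thesis using inv1[OF p(2)] inv1[OF q(2)] p q by (intro pos[of p]) auto
    next
      fix q assume q: "1 \<le> q" "w (int (k + q)) = - (int i + 1)"
      have "w (int (k + m)) \<noteq> - int i" if "1 \<le> m" for m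
        using same[of "k + m" "k + p"] that p i by auto
      then have "lowers k w i q" unfolding lowers_def using q by auto
      then show ?thesis using inv1[OF p(2)] inv2[OF q(2)] p q by (intro low[of q]) auto
    qed simp
  next
    fix p assume p: "1 \<le> p" "w (int (k + p)) = - int i"
    have np: "w (int (k + j)) \<noteq> int i" if "1 \<le> j" for j
      using same[of "k + j" "k + p"] that p i by auto
    show ?thesis
    proof (rule value_cases[OF w, of "int i + 1"])
      fix q assume q: "1 \<le> q" "q \<le> k" "w (int q) = int i + 1"
      show ?thesis
        by (rule none) (use np nolast[of _ q] q inv2[OF p(2)] inv1[OF q(3)] in force)+
    next
      fix q assume q: "1 \<le> q" "w (int (k + q)) = int i + 1"
      have "w (int (k + j)) \<noteq> - int i - 1" if "1 \<le> j" for j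
        using same[of "k + j" "k + q"] that q by auto
      then show ?thesis
        by (intro none) (use np inv2[OF p(2)] inv1[OF q(2)] p q in auto)
    next
      fix q assume q: "1 \<le> q" "w (int (k + q)) = - (int i + 1)"
      have "p = Suc q" using adj[of q p] p q by simp
      then show ?thesis using inv2[OF p(2)] inv2[OF q(2)] p q by (intro neg[of q]) auto
    qed simp
  qed
qed


section \<open>The bijection between k-strict partitions and Grassmannian elements\<close>

definition strict_seq :: "nat \<Rightarrow> (nat \<Rightarrow> nat) \<Rightarrow> bool" where
  "strict_seq k f \<longleftrightarrow> (\<forall>i j. 1 \<le> i \<longrightarrow> i < j \<longrightarrow> f j \<le> f i \<and> (k < f i \<longrightarrow> f j < f i)) \<and> (\<exists>m. \<forall>i>m. f i = 0)"

lemma strict_seqD: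
  assumes "strict_seq k f" "1 \<le> i" "i < j"
  shows "f j \<le> f i" "k < f i \<Longrightarrow> f j < f i"
  using assms by (auto simp: strict_seq_def)

lemma strict_seq_grass_part:
  assumes w: "grassmannian k w"
  shows "strict_seq k (grass_part k w)"
  unfolding strict_seq_def
proof (intro conjI allI impI)
  have W: "w \<in> Winf" using w by (rule grassmannian_Winf)
  obtain n :: nat where n: "\<And>x. int n < \<bar>x\<bar> \<Longrightarrow> w x = x" "\<And>x. \<bar>x\<bar> \<le> int n \<Longrightarrow> \<bar>w x\<bar> \<le> int n"
    by (rule Winf_bound[OF W]) auto
  have "grass_part k w i = 0" if i: "n < i" for i
  proof -
    have 1: "w (int (k + i)) = int (k + i)" using n(1)[of "int (k + i)"] i by simp
    have 2: "w (int p) < int (k + i)" if "p \<le> k" for p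
      using n(1)[of "int p"] n(2)[of "int p"] i that by (cases "p \<le> n") auto
    have "{p. 1 \<le> p \<and> p \<le> k \<and> w (int p) > int (k + i)} = {}"
    proof safe
      fix p assume "p \<le> k" "int (k + i) < w (int p)"
      then show "p \<in> {}" using 2[of p] by simp
    qed
    then show ?thesis using 1 by (simp add: grass_part_def del: of_nat_add)
  qed
  then show "\<exists>m. \<forall>i>m. grass_part k w i = 0" by blast
  fix i j :: nat assume i: "1 \<le> i" and j: "i < j"
  have j1: "1 \<le> j" using i j by simp
  have lt: "w (int (k + i)) < w (int (k + j))" using grassmannian_last_less_iff[OF w i j1] j by blast
  have le: "grass_part k w j \<le> grass_part k w i \<and> (k < grass_part k w i \<longrightarrow> grass_part k w j < grass_part k w i)"
  proof (cases "w (int (k + j)) < 0")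
    case True
    then show ?thesis using lt grass_part_neg[of w k i] grass_part_neg[of w k j] by simp
  next
    case False
    then have gj: "grass_part k w j \<le> k" using grass_part_gt_iff[OF w j1] by simp
    show ?thesis
    proof (cases "w (int (k + i)) < 0")
      case True
      then show ?thesis using gj grass_part_gt_iff[OF w i] by simp
    next
      case pi: False
      have "grass_part k w j \<le> grass_part k w i"
        unfolding grass_part_def using False pi lt by (auto intro!: card_mono simp del: of_nat_add)
      then show ?thesis using pi grass_part_gt_iff[OF w i] by simp
    qed
  qed
  then show "grass_part k w j \<le> grass_part k w i" by blast
  show "k < grass_part k w i \<Longrightarrow> grass_part k w j < grass_part k w i" using le by blast
qed

lemma filter_distinct_nth:
  assumes "distinct (filter P xs)" "i < j" "j < length xs" "P (xs ! i)"
  shows "xs ! i \<noteq> xs ! j"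
proof
  assume eq: "xs ! i = xs ! j"
  have "filter P xs = filter P (take j xs) @ filter P (drop j xs)"
    by (metis append_take_drop_id filter_append)
  then have d: "set (filter P (take j xs)) \<inter> set (filter P (drop j xs)) = {}"
    using assms(1) by (metis distinct_append)
  have "xs ! i \<in> set (take j xs)" using assms by (auto simp: in_set_conv_nth intro!: exI[of _ i])
  moreover have "xs ! i \<in> set (drop j xs)" using assms eq by (auto simp: in_set_conv_nth intro!: exI[of _ 0])
  ultimately show False using d assms(4) by auto
qed

lemma strict_seq_part:
  assumes "kstrict k lam"
  shows "strict_seq k (part lam)"
  unfolding strict_seq_def
proof (intro conjI allI impI)
  show "\<exists>m. \<forall>i>m. part lam i = 0" by (auto simp: part_def intro!: exI[of _ "length lam"])
  fix i j :: nat assume i: "1 \<le> i" and j: "i < j"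
  show "part lam j \<le> part lam i"
    using assms i j by (auto simp: part_def kstrict_def sorted_wrt_iff_nth_less)
  assume "k < part lam i"
  moreover have "lam ! (i - 1) \<noteq> lam ! (j - 1)" if "j \<le> length lam" "k < lam ! (i - 1)"
    using filter_distinct_nth[of "\<lambda>p. k < p" lam "i - 1" "j - 1"] assms that i j by (simp add: kstrict_def)
  ultimately show "part lam j < part lam i"
    using \<open>part lam j \<le> part lam i\<close> i j by (auto simp: part_def split: if_splits)
qed

text \<open>\<open>strict_seq\<close> is k-strictness for a sequence with trailing zeros. The list
  is cut at the least m beyond which f vanishes, which makes all its entries positive.\<close>

lemma ex_kstrict:
  assumes f: "strict_seq k f"
  obtains lam where "kstrict k lam" "\<And>i. 1 \<le> i \<Longrightarrow> part lam i = f i"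
proof -
  define m where "m = (LEAST m. \<forall>i>m. f i = 0)"
  have m: "\<forall>i>m. f i = 0" unfolding m_def by (rule LeastI_ex) (use f in \<open>simp add: strict_seq_def\<close>)
  have fm: "f m \<noteq> 0" if "m \<noteq> 0"
  proof
    assume "f m = 0"
    then have "\<forall>i>m - 1. f i = 0" using m by (metis Suc_pred' bot_nat_0.not_eq_extremum less_Suc_eq nat_neq_iff not_less_eq that)
    then have "m \<le> m - 1" unfolding m_def by (rule Least_le)
    then show False using that by simp
  qed
  define lam where "lam = map f [1..<Suc m]"
  have part: "part lam i = f i" if "1 \<le> i" for i
    using that m by (auto simp: part_def lam_def simp del: upt_Suc)
  have inj: "f i \<noteq> f j" if "1 \<le> i" "1 \<le> j" "k < f i" "k < f j" "i \<noteq> j" for i j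
    using strict_seqD(2)[OF f, of i j] strict_seqD(2)[OF f, of j i] that by (cases i j rule: linorder_cases) auto
  have "0 < f i" if "1 \<le> i" "i \<le> m" for i
  proof (cases "i = m")
    case False
    then show ?thesis using strict_seqD(1)[OF f, of i m] that fm by fastforce
  qed (use that fm in auto)
  then have "kstrict k lam"
    unfolding kstrict_def
  proof (intro conjI)
    show "sorted_wrt (\<ge>) lam" unfolding sorted_wrt_iff_nth_less lam_def
      using strict_seqD(1)[OF f] by (auto simp del: upt_Suc)
    show "distinct (filter ((<) k) lam)"
      unfolding lam_def filter_map distinct_map
      by (auto intro!: inj_onI simp del: upt_Suc) (metis inj One_nat_def)
  qed (auto simp: lam_def)
  then show ?thesis using that part by blast
qed

lemma kstrict_eqI:
  assumes "kstrict k lam" "kstrict k mu" "\<And>i. 1 \<le> i \<Longrightarrow> part lam i = part mu i"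
  shows "lam = mu"
proof -
  have le: "length mu \<le> length lam" if "kstrict k mu" "\<And>i. 1 \<le> i \<Longrightarrow> part lam i = part mu i" for lam mu
  proof (rule ccontr)
    assume h: "\<not> length mu \<le> length lam"
    then have "mu ! (length mu - 1) \<in> set mu" by (intro nth_mem) simp
    then have "part mu (length mu) \<noteq> 0" using that(1) h by (auto simp: part_def kstrict_def)
    moreover have "part lam (length mu) = 0" using h by (simp add: part_def)
    ultimately show False using that(2)[of "length mu"] h by simp
  qed
  have len: "length lam = length mu" using le[of mu lam] le[of lam mu] assms by force
  show ?thesis
  proof (rule nth_equalityI[OF len])
    fix i assume "i < length lam"
    then show "lam ! i = mu ! i" using assms(3)[of "Suc i"] len by (simp add: part_def)
  qed
qed

text \<open>Induction on the number of boxes. A box is taken from the last row longer than k or, if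
  there is none, from the last nonempty row; a simple reflection that acts on the smaller element as
  the inverse of a \<open>lowers\<close> step puts it back.\<close>

lemma ex_grassmannian:
  assumes "strict_seq k f"
  shows "\<exists>w. grassmannian k w \<and> (\<forall>i\<ge>1. f i = grass_part k w i)"
proof -
  obtain m where "\<forall>i>m. f i = 0" using assms by (auto simp: strict_seq_def)
  then show ?thesis using assms
  proof (induction "\<Sum>i=1..m. f i" arbitrary: f rule: less_induct)
    case less
    note f = less.prems(2) and m = less.prems(1)
    have dec: "\<exists>w. grassmannian k w \<and> (\<forall>i\<ge>1. (f(q := f q - 1)) i = grass_part k w i)"
      if q: "1 \<le> q" "0 < f q" and nxt: "\<And>j. q < j \<Longrightarrow> f j \<le> f q - 1 \<and> (k < f q - 1 \<longrightarrow> f j < f q - 1)" for q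
    proof (rule less.hyps)
      have "q \<le> m" using q(2) m by (metis less_irrefl not_le_imp_less)
      show "(\<Sum>i=1..m. (f(q := f q - 1)) i) < (\<Sum>i=1..m. f i)"
        by (rule sum_strict_mono_ex1) (use q \<open>q \<le> m\<close> in \<open>auto intro!: bexI[of _ q]\<close>)
      show "\<forall>i>m. (f(q := f q - 1)) i = 0" using m by auto
      have "(f(q := f q - 1)) j \<le> (f(q := f q - 1)) i \<and> (k < (f(q := f q - 1)) i \<longrightarrow> (f(q := f q - 1)) j < (f(q := f q - 1)) i)"
        if "1 \<le> i" "i < j" for i j
        using strict_seqD[OF f that] nxt[of j] that by (auto simp: fun_upd_def)
      then show "strict_seq k (f(q := f q - 1))"
        using \<open>\<forall>i>m. (f(q := f q - 1)) i = 0\<close> unfolding strict_seq_def by blast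
    qed
    have lift: ?case
      if q: "1 \<le> q" "0 < f q" and v: "grassmannian k v" "\<forall>i\<ge>1. (f(q := f q - 1)) i = grass_part k v i"
        and g: "grassmannian k (sgen i \<circ> v)" and l: "lowers k (sgen i \<circ> v) i q" for q v i
    proof (intro exI[of _ "sgen i \<circ> v"] conjI allI impI)
      fix j :: nat assume j: "1 \<le> j"
      have "grass_part k (sgen i \<circ> v) q = Suc (grass_part k v q)" using lowers_part(1)[OF g l] by simp
      moreover have "grass_part k v j = grass_part k (sgen i \<circ> v) j" if "j \<noteq> q"
        using lowers_part(2)[OF g l j that] by simp
      ultimately show "f j = grass_part k (sgen i \<circ> v) j"
        using v(2) j q by (cases "j = q") auto
    qed (rule g)
    consider (large) "\<exists>i\<ge>1. k < f i" | (small) "\<forall>i\<ge>1. f i \<le> k" "\<exists>i\<ge>1. 0 < f i" | (zero) "\<forall>i\<ge>1. f i = 0"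
      by (metis gr0I linorder_not_le)
    then show ?case
    proof cases
      case large
      define Q where "Q = {i. 1 \<le> i \<and> k < f i}"
      have "Q \<subseteq> {..m}" using m by (auto simp: Q_def) (metis less_nat_zero_code not_le_imp_less)
      then have fin: "finite Q" by (rule finite_subset) simp
      define q where "q = Max Q"
      have "q \<in> Q" unfolding q_def by (rule Max_in) (use fin large in \<open>auto simp: Q_def\<close>)
      then have q: "1 \<le> q" "k < f q" by (auto simp: Q_def)
      have after: "f j \<le> k" if "q < j" for j
      proof (rule ccontr)
        assume "\<not> f j \<le> k"
        then have "j \<in> Q" using that q by (simp add: Q_def)
        then show False using Max_ge[OF fin] that unfolding q_def by (meson linorder_not_le)
      qed
      have neqq: "f j \<noteq> f q" if "1 \<le> j" "j \<noteq> q" for j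
        using after[of j] strict_seqD[OF f that(1), of q] q that by (cases j q rule: linorder_cases) auto
      obtain v where v: "grassmannian k v" "\<forall>i\<ge>1. (f(q := f q - 1)) i = grass_part k v i"
        using dec[of q] q after by force
      have vW: "v \<in> Winf" using v(1) by (rule grassmannian_Winf)
      have gq: "grass_part k v q = f q - 1" and gj: "grass_part k v j = f j" if "1 \<le> j" "j \<noteq> q" for j
        using v(2) q that by (metis fun_upd_same, metis fun_upd_other)
      have gq: "grass_part k v q = f q - 1" using v(2) q by (metis fun_upd_same)
      have vpos: "0 < v (int p)" if "1 \<le> p" "p \<le> k" for p using grassmannian_pos_first[OF v(1) that] .
      have noneg: "v (int (k + j)) \<noteq> int k - int (f q)" if j: "1 \<le> j" for j
      proof
        assume h: "v (int (k + j)) = int k - int (f q)"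
        then have "grass_part k v j = f q" using grass_part_neg[of v k j] q by simp
        then show False using gq gj[OF j] neqq[OF j] q by (cases "j = q") auto
      qed
      show ?thesis
      proof (cases "f q - 1 = k")
        case False
        \<comment> \<open>The shortened row q is still longer than k, so its value is -a, and s_a
          lengthens it to -a-1. By \<open>noneg\<close> the value -a-1 is vacant in the last
          block.\<close>
        define a where "a = f q - 1 - k"
        have a: "f q = k + Suc a" "a \<noteq> 0" using False q by (auto simp: a_def)
        have va: "v (int (k + q)) = - int a"
        proof -
          have "v (int (k + q)) < 0" using grass_part_gt_iff[OF v(1) q(1)] gq a by simp
          then show ?thesis using grass_part_neg[of v k q] gq a by simp
        qed
        have nn: "v (int p) \<noteq> - int a - 1" if "p \<noteq> 0" for p
        proof (cases "p \<le> k")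
          case True then show ?thesis using vpos[of p] that by auto
        next
          case False
          then have "1 \<le> p - k" "k + (p - k) = p" by auto
          then have "v (int p) \<noteq> int k - int (f q)" using noneg by metis
          then show ?thesis using a by (simp add: algebra_simps)
        qed
        have g: "grassmannian k (sgen a \<circ> v)"
        proof (rule grassmannian_left[OF v(1)])
          fix p
          show "\<not> (v (int p) = int a \<and> v (int (Suc p)) = int a + 1)"
          proof
            assume h: "v (int p) = int a \<and> v (int (Suc p)) = int a + 1"
            then have "p \<noteq> 0" using a Winf_zero[OF vW] by (cases "p = 0") auto
            then have "p = k + q" using Winf_inj_abs[OF vW, of p "k + q"] h va q by simp
            then show False using h va a by simp
          qed
          show "\<not> (v (int p) = - int a - 1 \<and> v (int (Suc p)) = - int a)"
            using nn[of p] Winf_zero[OF vW] by (cases "p = 0") auto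
        qed (use a in auto)
        have "(sgen a \<circ> v) (int (k + j)) \<noteq> - int a" if "1 \<le> j" for j
        proof
          assume "(sgen a \<circ> v) (int (k + j)) = - int a"
          then have "sgen a (sgen a (v (int (k + j)))) = sgen a (- int a)" by simp
          moreover have "sgen a (- int a) = - int a - 1" using a by (simp add: sgen_apply)
          ultimately have "v (int (k + j)) = - int a - 1" by (simp only: sgen_sgen)
          then show False using nn[of "k + j"] that by simp
        qed
        then have "lowers k (sgen a \<circ> v) a q"
          unfolding lowers_def using q va a by (simp add: sgen_apply del: of_nat_add)
        then show ?thesis using lift[OF q(1) _ v g] q by simp
      next
        case True
        then have fq: "f q = Suc k" using q by simp
        have vq: "0 < v (int (k + q))"
          using grass_part_gt_iff[OF v(1) q(1)] gq True Winf_nonzero[OF vW, of "k + q"] q by simp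
        have n1: "v (int (k + j)) \<noteq> - 1" if "1 \<le> j" for j using noneg[OF that] fq by simp
        \<comment> \<open>The shortened row has length exactly k, so its value lies below the whole
          first block. Since -1 does not occur in the last block, this value is 1, and s_0 turns it
          into -1.\<close>
        have v1: "v (int (k + q)) = 1"
        proof (rule value_cases[OF v(1), of 1])
          fix p assume p: "1 \<le> p" "p \<le> k" "v (int p) = 1"
          have "card {p. 1 \<le> p \<and> p \<le> k \<and> v (int p) \<le> v (int (k + q))} = 0"
            using grass_part_pos(1)[OF v(1) q(1) vq] gq True by simp
          moreover have "p \<in> {p. 1 \<le> p \<and> p \<le> k \<and> v (int p) \<le> v (int (k + q))}" using p vq by simp
          moreover have "finite {p. 1 \<le> p \<and> p \<le> k \<and> v (int p) \<le> v (int (k + q))}" by simp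
          ultimately show ?thesis using card_0_eq by blast
        next
          fix j assume j: "1 \<le> j" "v (int (k + j)) = 1"
          have "\<not> j < q"
          proof
            assume jq: "j < q"
            have "grass_part k v j \<le> k" using grass_part_gt_iff[OF v(1) j(1)] j(2) by simp
            then have "f j \<le> k" using gj[of j] j(1) jq by simp
            then show False using strict_seqD(1)[OF f j(1) jq] q by simp
          qed
          moreover have "\<not> q < j" using grassmannian_last_less_iff[OF v(1) q(1) j(1)] j(2) vq by simp
          ultimately show ?thesis using j by (cases j q rule: linorder_cases) auto
        qed (use n1 in auto)
        have g: "grassmannian k (sgen 0 \<circ> v)"
        proof (rule grassmannian_left[OF v(1)])
          fix p assume p: "p \<noteq> k"
          show "\<not> (\<bar>v (int p)\<bar> \<le> 1 \<and> \<bar>v (int (Suc p))\<bar> \<le> 1)"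
          proof
            assume h: "\<bar>v (int p)\<bar> \<le> 1 \<and> \<bar>v (int (Suc p))\<bar> \<le> 1"
            have 1: "r = k + q" if "r \<noteq> 0" "\<bar>v (int r)\<bar> \<le> 1" for r
              using Winf_nonzero[OF vW, of r] Winf_inj_abs[OF vW, of r "k + q"] that v1 q by simp
            have "Suc p = k + q" using 1[of "Suc p"] h by simp
            moreover have "p = k + q" if "p \<noteq> 0" using 1[of p] h that by simp
            ultimately have "p = 0" by linarith
            then show False using \<open>Suc p = k + q\<close> q p by simp
          qed
        qed auto
        have "lowers k (sgen 0 \<circ> v) 0 q"
          unfolding lowers_def using q v1 by (simp add: sgen_apply del: of_nat_add)
        then show ?thesis using lift[OF q(1) _ v g] q by simp
      qed
    next
      case small
      define Q where "Q = {i. 1 \<le> i \<and> 0 < f i}"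
      have "Q \<subseteq> {..m}" using m by (auto simp: Q_def) (metis less_nat_zero_code not_le_imp_less)
      then have fin: "finite Q" by (rule finite_subset) simp
      define q where "q = Max Q"
      have "q \<in> Q" unfolding q_def by (rule Max_in) (use fin small in \<open>auto simp: Q_def\<close>)
      then have q: "1 \<le> q" "0 < f q" by (auto simp: Q_def)
      have after: "f j = 0" if "q < j" for j
      proof (rule ccontr)
        assume "f j \<noteq> 0"
        then have "j \<in> Q" using that q by (simp add: Q_def)
        then show False using Max_ge[OF fin] that unfolding q_def by (meson linorder_not_le)
      qed
      have fk: "f q \<le> k" using small q by simp
      obtain v where v: "grassmannian k v" "\<forall>i\<ge>1. (f(q := f q - 1)) i = grass_part k v i"
        using dec[of q] q after fk by force
      have vW: "v \<in> Winf" using v(1) by (rule grassmannian_Winf)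
      have gj: "grass_part k v j = f j" if "1 \<le> j" "j \<noteq> q" for j
        using v(2) that by (metis fun_upd_other)
      have gq: "grass_part k v q = f q - 1" using v(2) q by (metis fun_upd_same)
      have vpos: "0 < v (int p)" if "1 \<le> p" for p
      proof (cases "p \<le> k")
        case True then show ?thesis using grassmannian_pos_first[OF v(1) that] by simp
      next
        case False
        then have "1 \<le> p - k" "k + (p - k) = p" by auto
        moreover have "grass_part k v (p - k) \<le> k" if "1 \<le> p - k"
          using gj[OF that] gq fk small(1) that by (cases "p - k = q") auto
        ultimately show ?thesis
          using grass_part_gt_iff[OF v(1), of "p - k"] Winf_nonzero[OF vW that] by (metis leD linorder_neqE)
      qed
      define b where "b = nat (v (int (k + q)))"
      have vq: "v (int (k + q)) = int b" "0 < b" using vpos[of "k + q"] q by (auto simp: b_def simp del: of_nat_add)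
      have "int (f q - 1) = int k - int (card {p. 1 \<le> p \<and> p \<le> k \<and> v (int p) \<le> int b})"
        using grass_part_pos(1)[OF v(1) q(1)] vq(2) gq unfolding vq(1) by simp
      then have "card {p. 1 \<le> p \<and> p \<le> k \<and> v (int p) \<le> int b} \<noteq> 0" using q fk by linarith
      then have "{p. 1 \<le> p \<and> p \<le> k \<and> v (int p) \<le> int b} \<noteq> {}" by (metis card.empty)
      then obtain p0 where p0: "1 \<le> p0" "p0 \<le> k" "v (int p0) \<le> int b" by blast
      have "v (int p0) \<noteq> int b" using Winf_inj[OF vW, of "int p0" "int (k + q)"] p0 vq q by simp
      then have b2: "2 \<le> b" using p0 vpos[of p0] by simp
      \<comment> \<open>The missing box comes from exchanging the value b of row q with b-1 in the
        first block. If b-1 were the value of a row j < q, rows j and q of v would have equal parts,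
        whence f j = f q - 1, contradicting monotonicity.\<close>
      define i where "i = b - 1"
      have i: "1 \<le> i" "int b = int i + 1" using b2 by (auto simp: i_def)
      obtain p where p: "1 \<le> p" "p \<le> k" "v (int p) = int i"
      proof (rule value_cases[OF v(1), of "int i"])
        show "0 < int i" using i by simp
      next
        fix j assume j: "1 \<le> j" "v (int (k + j)) = - int i"
        then show thesis using vpos[of "k + j"] by simp
      next
        fix j assume j: "1 \<le> j" "v (int (k + j)) = int i"
        have jq: "j < q" using grassmannian_last_less_iff[OF v(1) j(1) q(1)] j vq i by simp
        have "{p. 1 \<le> p \<and> p \<le> k \<and> v (int p) > v (int (k + j))} = {p. 1 \<le> p \<and> p \<le> k \<and> v (int p) > v (int (k + q))}"
        proof -
          have "v (int p) \<noteq> int b" if "p \<le> k" for p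
            using Winf_inj[OF vW, of "int p" "int (k + q)"] vq q that by simp
          then show ?thesis using j vq i by force
        qed
        then have "grass_part k v j = grass_part k v q" using j vq i by (simp add: grass_part_def del: of_nat_add)
        then have "f j = f q - 1" using gj[of j] gq j jq by simp
        then show thesis using strict_seqD(1)[OF f j(1) jq] q by simp
      qed (rule that)
      have g: "grassmannian k (sgen i \<circ> v)"
      proof (rule grassmannian_left[OF v(1)])
        fix r assume r: "r \<noteq> k"
        show "\<not> (v (int r) = int i \<and> v (int (Suc r)) = int i + 1)"
        proof
          assume h: "v (int r) = int i \<and> v (int (Suc r)) = int i + 1"
          then have "int r = int p" "int (Suc r) = int (k + q)"
            using p(3) vq(1) i(2) Winf_inj[OF vW] by metis+
          then show False using r p q by simp
        qed
        show "\<not> (v (int r) = - int i - 1 \<and> v (int (Suc r)) = - int i)"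
          using vpos[of "Suc r"] by auto
      qed (use i in auto)
      have "(sgen i \<circ> v) (int (k + q)) = int i" "(sgen i \<circ> v) (int p) = int i + 1"
        using vq i p by (auto simp: sgen_apply simp del: of_nat_add)
      then have "lowers k (sgen i \<circ> v) i q"
        unfolding lowers_def using q i p by blast
      then show ?thesis using lift[OF q v g] by simp
    next
      case zero
      have g: "grassmannian k id" by (simp add: grassmannian_iff)
      have "grass_part k id i = 0" if "1 \<le> i" for i
      proof -
        have "{p. 1 \<le> p \<and> p \<le> k \<and> int (k + i) < int p} = {}" by auto
        then show ?thesis by (simp add: grass_part_def del: of_nat_add)
      qed
      then show ?thesis using zero g by (intro exI[of _ id]) auto
    qed
  qed
qed

lemma welt:
  assumes "kstrict k lam"
  shows "grassmannian k (welt k lam)" "1 \<le> i \<Longrightarrow> part lam i = grass_part k (welt k lam) i"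
proof -
  have ex: "\<exists>!w. grassmannian k w \<and> (\<forall>i\<ge>1. part lam i = grass_part k w i)"
    using ex_grassmannian[OF strict_seq_part[OF assms]] grassmannian_determined
    by (metis (no_types, lifting))
  from theI'[OF ex] have "grassmannian k (welt k lam) \<and> (\<forall>i\<ge>1. part lam i = grass_part k (welt k lam) i)"
    unfolding welt_def .
  then show "grassmannian k (welt k lam)" "1 \<le> i \<Longrightarrow> part lam i = grass_part k (welt k lam) i" by auto
qed

lemma bij_betw_welt: "bij_betw (welt k) {lam. kstrict k lam} {w. grassmannian k w}"
proof (rule bij_betw_imageI)
  show "inj_on (welt k) {lam. kstrict k lam}"
    using welt(2) by (auto intro!: inj_onI kstrict_eqI)
  show "welt k ` {lam. kstrict k lam} = {w. grassmannian k w}"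
  proof (intro equalityI subsetI)
    fix w assume "w \<in> {w. grassmannian k w}"
    then have w: "grassmannian k w" by simp
    obtain lam where lam: "kstrict k lam" "\<And>i. 1 \<le> i \<Longrightarrow> part lam i = grass_part k w i"
      using ex_kstrict[OF strict_seq_grass_part[OF w]] by blast
    have "w = welt k lam" by (rule grassmannian_determined[OF w]) (use welt[OF lam(1)] lam(2) in auto)
    then show "w \<in> welt k ` {lam. kstrict k lam}" using lam(1) by blast
  qed (use welt in auto)
qed

section \<open>Polynomial rings\<close>

lemma sum_singles: "f = (\<Sum>m\<in>Poly_Mapping.keys f. Poly_Mapping.single m (Poly_Mapping.lookup f m))"
  for f :: "'a \<Rightarrow>\<^sub>0 'b::comm_monoid_add"
  by (rule poly_mapping_eqI) (simp add: lookup_sum lookup_single when_def in_keys_iff)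

lemma poly_mapping_single_induct [case_names single add]:
  fixes f :: "'a \<Rightarrow>\<^sub>0 'b::comm_monoid_add"
  assumes single: "\<And>m a. P (Poly_Mapping.single m a)"
    and add: "\<And>f g. P f \<Longrightarrow> P g \<Longrightarrow> P (f + g)"
  shows "P f"
proof -
  have "P (\<Sum>m\<in>S. Poly_Mapping.single m (Poly_Mapping.lookup f m))" if "finite S" for S
    using that
  proof (induction S)
    case empty
    show ?case using single[of _ 0] by simp
  qed (auto intro: single add)
  from this[OF finite_keys[of f]] show ?thesis by (subst sum_singles)
qed

lemma single_Xv_power: "Poly_Mapping.single (Poly_Mapping.single i n) 1 = Xv (Suc i) ^ n"
proof (induction n)
  case (Suc n)
  have "Poly_Mapping.single (Poly_Mapping.single i (Suc n)) (1::'a) =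
    Poly_Mapping.single (Poly_Mapping.single i 1) 1 * Poly_Mapping.single (Poly_Mapping.single i n) 1"
    by (simp add: mult_single flip: single_add)
  then show ?case using Suc by (simp add: Xv_def)
qed simp

lemma mvpoly_induct [case_names const Xv add mult]:
  fixes f :: "'a::comm_ring_1 mvpoly"
  assumes const: "\<And>a. P (const a)" and Xv: "\<And>i. 1 \<le> i \<Longrightarrow> P (Xv i)"
    and add: "\<And>f g. P f \<Longrightarrow> P g \<Longrightarrow> P (f + g)" and mult: "\<And>f g. P f \<Longrightarrow> P g \<Longrightarrow> P (f * g)"
  shows "P f"
proof (induction f rule: poly_mapping_single_induct)
  case (single m a)
  have pow: "P (Xv (Suc i) ^ n)" for i n
  proof (induction n)
    case 0
    show ?case using const[of 1] by (simp add: const_def)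
  next
    case (Suc n)
    show ?case unfolding power_Suc by (intro mult Xv Suc) simp
  qed
  have "P (Poly_Mapping.single m 1)"
  proof (induction m rule: poly_mapping_single_induct)
    case (single i n)
    show ?case unfolding single_Xv_power by (rule pow)
  next
    case (add m m')
    have "Poly_Mapping.single (m + m') (1::'a) = Poly_Mapping.single m 1 * Poly_Mapping.single m' 1"
      by (simp add: mult_single)
    then show ?case using mult add by simp
  qed
  moreover have "Poly_Mapping.single m a = const a * Poly_Mapping.single m 1"
    by (simp add: const_def mult_single)
  ultimately show ?case using mult const by metis
qed (rule add)

lemma const_0 [simp]: "const 0 = 0" and const_1 [simp]: "const 1 = 1"
  and const_add: "const (a + b) = const a + const b"
  and const_mult: "const (a * b) = const a * const b"
  and const_uminus: "const (- a) = - const a"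
  and const_diff: "const (a - b) = const a - const b"
  and const_of_int: "const (of_int n) = of_int n"
  by (simp_all add: const_def single_add mult_single single_uminus single_diff)

text \<open>Evaluation, constants, interchange of variables and the constant term are all ring
  homomorphisms. With one predicate, their compatibility with c^r_p, products and raising operators
  is proved once.\<close>

definition rhom :: "('a::comm_ring_1 \<Rightarrow> 'b::comm_ring_1) \<Rightarrow> bool" where
  "rhom h \<longleftrightarrow> (\<forall>a b. h (a + b) = h a + h b) \<and> (\<forall>a b. h (a * b) = h a * h b) \<and> h 1 = 1"

lemma rhomI: "(\<And>a b. h (a + b) = h a + h b) \<Longrightarrow> (\<And>a b. h (a * b) = h a * h b) \<Longrightarrow> h 1 = 1 \<Longrightarrow> rhom h"
  by (simp add: rhom_def)

lemma rhom_add: "rhom h \<Longrightarrow> h (a + b) = h a + h b"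
  and rhom_mult: "rhom h \<Longrightarrow> h (a * b) = h a * h b"
  and rhom_1: "rhom h \<Longrightarrow> h 1 = 1"
  by (auto simp: rhom_def)

lemma rhom_0: "rhom h \<Longrightarrow> h 0 = 0"
  using rhom_add[of h 0 0] by simp

lemma rhom_uminus: "rhom h \<Longrightarrow> h (- a) = - h a"
  using rhom_add[of h a "- a"] rhom_0[of h] by (simp add: eq_neg_iff_add_eq_0 add.commute)

lemma rhom_diff: "rhom h \<Longrightarrow> h (a - b) = h a - h b"
  using rhom_add[of h a "- b"] rhom_uminus[of h b] by simp

lemma rhom_sum: "rhom h \<Longrightarrow> h (\<Sum>x\<in>A. f x) = (\<Sum>x\<in>A. h (f x))"
  by (induction A rule: infinite_finite_induct) (auto simp: rhom_0 rhom_add)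

lemma rhom_prod: "rhom h \<Longrightarrow> h (\<Prod>x\<in>A. f x) = (\<Prod>x\<in>A. h (f x))"
  by (induction A rule: infinite_finite_induct) (auto simp: rhom_1 rhom_mult)

lemma rhom_power: "rhom h \<Longrightarrow> h (a ^ n) = h a ^ n"
  by (induction n) (auto simp: rhom_1 rhom_mult)

lemma rhom_of_nat: "rhom h \<Longrightarrow> h (of_nat n) = of_nat n"
  by (induction n) (auto simp: rhom_0 rhom_1 rhom_add)

lemma rhom_of_int: "rhom h \<Longrightarrow> h (of_int n) = of_int n"
  by (cases n) (auto simp: rhom_of_nat rhom_uminus rhom_diff rhom_1)

lemma rhom_comp: "rhom g \<Longrightarrow> rhom h \<Longrightarrow> rhom (\<lambda>x. g (h x))"
  by (auto simp: rhom_def)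

lemma rhom_const: "rhom const"
  by (auto intro: rhomI simp: const_add const_mult)

definition mon_eval :: "(nat \<Rightarrow>\<^sub>0 nat) \<Rightarrow> (nat \<Rightarrow> 'a::comm_ring_1) \<Rightarrow> 'a" where
  "mon_eval m x = (\<Prod>i\<in>Poly_Mapping.keys m. x (Suc i) ^ Poly_Mapping.lookup m i)"

lemma mon_eval_superset:
  assumes "finite S" "Poly_Mapping.keys m \<subseteq> S"
  shows "mon_eval m x = (\<Prod>i\<in>S. x (Suc i) ^ Poly_Mapping.lookup m i)"
  unfolding mon_eval_def
  by (rule prod.mono_neutral_left[OF assms]) (auto simp: in_keys_iff)

lemma mon_eval_add: "mon_eval (m + n) x = mon_eval m x * mon_eval n x"
proof -
  let ?S = "Poly_Mapping.keys m \<union> Poly_Mapping.keys n"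
  have "mon_eval (m + n) x = (\<Prod>i\<in>?S. x (Suc i) ^ Poly_Mapping.lookup (m + n) i)"
    by (rule mon_eval_superset) (use keys_add[of m n] in auto)
  also have "\<dots> = (\<Prod>i\<in>?S. x (Suc i) ^ Poly_Mapping.lookup m i) * (\<Prod>i\<in>?S. x (Suc i) ^ Poly_Mapping.lookup n i)"
    by (simp add: lookup_add power_add prod.distrib)
  also have "\<dots> = mon_eval m x * mon_eval n x"
    by (simp add: mon_eval_superset[of ?S])
  finally show ?thesis .
qed

lemma mon_eval_0 [simp]: "mon_eval 0 x = 1"
  by (simp add: mon_eval_def)

lemma peval_superset:
  assumes "finite S" "Poly_Mapping.keys f \<subseteq> S"
  shows "peval f x = (\<Sum>m\<in>S. of_int (Poly_Mapping.lookup f m) * mon_eval m x)"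
  unfolding peval_def mon_eval_def
  by (rule sum.mono_neutral_left[OF assms]) (auto simp: in_keys_iff)

lemma peval_add: "peval (f + g) x = peval f x + peval g x"
proof -
  let ?S = "Poly_Mapping.keys f \<union> Poly_Mapping.keys g"
  have "peval (f + g) x = (\<Sum>m\<in>?S. of_int (Poly_Mapping.lookup (f + g) m) * mon_eval m x)"
    by (rule peval_superset) (use keys_add[of f g] in auto)
  also have "\<dots> = (\<Sum>m\<in>?S. of_int (Poly_Mapping.lookup f m) * mon_eval m x) + (\<Sum>m\<in>?S. of_int (Poly_Mapping.lookup g m) * mon_eval m x)"
    by (simp add: lookup_add distrib_right sum.distrib)
  also have "\<dots> = peval f x + peval g x"
    by (simp add: peval_superset[of ?S])
  finally show ?thesis .
qed

lemma peval_single: "peval (Poly_Mapping.single m a) x = of_int a * mon_eval m x"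
  by (subst peval_superset[of "{m}"]) auto

lemma peval_mult: "peval (f * g) x = peval f x * peval g x"
proof (induction f rule: poly_mapping_single_induct)
  case (single m a)
  show ?case
    by (induction g rule: poly_mapping_single_induct)
      (simp_all add: mult_single peval_single mon_eval_add peval_add distrib_left)
qed (simp add: peval_add distrib_right)

lemma peval_const: "peval (const a) x = of_int a"
  by (simp add: const_def peval_single)

lemma rhom_peval: "rhom (\<lambda>f. peval f x)"
  by (rule rhomI) (use peval_const[of 1 x] in \<open>simp_all add: peval_add peval_mult\<close>)

lemma peval_Xv: "1 \<le> i \<Longrightarrow> peval (Xv i) x = x i"
  by (simp add: Xv_def peval_single mon_eval_def)

lemma rhom_eq_peval:
  assumes "rhom h"
  shows "h f = peval f (\<lambda>i. h (Xv i))"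
proof (induction f rule: mvpoly_induct)
  case (const a)
  have "const a = (of_int a :: Zt)" by (simp add: const_def flip: single_of_int)
  then have "h (const a) = of_int a" using rhom_of_int[OF assms, of a] by (simp only:)
  then show ?case by (simp only: peval_const)
qed (simp_all add: peval_Xv peval_add peval_mult rhom_add[OF assms] rhom_mult[OF assms])

lemma peval_cong: "(\<And>i. 1 \<le> i \<Longrightarrow> x i = y i) \<Longrightarrow> peval f x = peval f y"
  by (induction f rule: mvpoly_induct) (simp_all add: peval_const peval_Xv peval_add peval_mult)

lemma rhom_peval_apply: "rhom h \<Longrightarrow> h (peval f x) = peval f (\<lambda>i. h (x i))"
  by (subst rhom_eq_peval[of "\<lambda>f. h (peval f x)"])
    (auto intro: rhom_comp rhom_peval peval_cong simp: peval_Xv)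

lemma peval_zero: "peval f (\<lambda>_. 0) = of_int (Poly_Mapping.lookup f 0)"
proof (induction f rule: poly_mapping_single_induct)
  case (single m a)
  show ?case
  proof (cases "m = 0")
    case False
    then obtain i where "i \<in> Poly_Mapping.keys m" by (metis all_not_in_conv keys_eq_empty)
    then have "mon_eval m (\<lambda>_. 0::'a) = 0"
      unfolding mon_eval_def by (intro prod_zero bexI[of _ i]) (auto simp: in_keys_iff zero_power)
    then show ?thesis using False by (simp add: peval_single lookup_single)
  qed (simp add: peval_single)
qed (simp add: peval_add lookup_add)

subsection \<open>Interchanging two variables\<close>

definition mon_swap :: "nat \<Rightarrow> (nat \<Rightarrow>\<^sub>0 nat) \<Rightarrow> (nat \<Rightarrow>\<^sub>0 nat)" where
  "mon_swap i m = Poly_Mapping.map_key (transpose (i - 1) i) m"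

text \<open>The coefficient ring is arbitrary so that s_i acts on Z[t] and, fixing c, on Z[c][t].
  Variable i sits at position i - 1, hence the transposition of i - 1 and i in
  \<open>mon_swap\<close>; for i = 0 it degenerates to the identity.\<close>

definition vswap :: "nat \<Rightarrow> 'a::comm_ring_1 mvpoly \<Rightarrow> 'a mvpoly" where
  "vswap i f = Poly_Mapping.map_key (mon_swap i) f"

lemma lookup_mon_swap: "Poly_Mapping.lookup (mon_swap i m) j = Poly_Mapping.lookup m (transpose (i - 1) i j)"
  unfolding mon_swap_def by (simp add: map_key.rep_eq)

lemma mon_swap_mon_swap [simp]: "mon_swap i (mon_swap i m) = m"
  by (rule poly_mapping_eqI) (simp add: lookup_mon_swap)

lemma inj_mon_swap: "inj (mon_swap i)"
  by (metis injI mon_swap_mon_swap)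

lemma mon_swap_add: "mon_swap i (m + n) = mon_swap i m + mon_swap i n"
  by (rule poly_mapping_eqI) (simp add: lookup_mon_swap lookup_add)

lemma mon_swap_0 [simp]: "mon_swap i 0 = 0"
  by (rule poly_mapping_eqI) (simp add: lookup_mon_swap)

lemma lookup_vswap: "Poly_Mapping.lookup (vswap i f) m = Poly_Mapping.lookup f (mon_swap i m)"
  unfolding vswap_def by (simp add: map_key.rep_eq inj_mon_swap)

lemma vswap_single: "vswap i (Poly_Mapping.single m a) = Poly_Mapping.single (mon_swap i m) a"
  by (rule poly_mapping_eqI) (auto simp: lookup_vswap lookup_single when_def)

lemma vswap_add: "vswap i (f + g) = vswap i f + vswap i g"
  by (rule poly_mapping_eqI) (simp add: lookup_vswap lookup_add)

lemma vswap_mult: "vswap i (f * g) = vswap i f * vswap i g"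
proof (induction f rule: poly_mapping_single_induct)
  case (single m a)
  show ?case
    by (induction g rule: poly_mapping_single_induct)
      (simp_all add: mult_single vswap_single mon_swap_add vswap_add distrib_left)
qed (simp add: vswap_add distrib_right)

lemma vswap_const [simp]: "vswap i (const a) = const a"
  by (simp add: const_def vswap_single)

lemma rhom_vswap: "rhom (vswap i)"
  by (rule rhomI) (use vswap_const[of i 1] in \<open>simp_all add: vswap_add vswap_mult\<close>)

lemma vswap_vswap [simp]: "vswap i (vswap i f) = f"
  by (rule poly_mapping_eqI) (simp add: lookup_vswap)

lemma vswap_Xv: "1 \<le> i \<Longrightarrow> 1 \<le> j \<Longrightarrow> vswap i (Xv j) = Xv (transpose i (Suc i) j)"
proof -
  assume ij: "1 \<le> i" "1 \<le> j"
  have "mon_swap i (Poly_Mapping.single (j - 1) 1) = Poly_Mapping.single (transpose i (Suc i) j - 1) 1"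
    by (rule poly_mapping_eqI)
      (use ij in \<open>auto simp: lookup_mon_swap lookup_single when_def transpose_def\<close>)
  then show ?thesis by (simp add: Xv_def vswap_single)
qed

lemma vswap_Xv_other: "1 \<le> i \<Longrightarrow> 1 \<le> j \<Longrightarrow> j \<noteq> i \<Longrightarrow> j \<noteq> Suc i \<Longrightarrow> vswap i (Xv j) = Xv j"
  and vswap_Xv_left: "1 \<le> i \<Longrightarrow> vswap i (Xv i) = Xv (Suc i)"
  and vswap_Xv_right: "1 \<le> i \<Longrightarrow> vswap i (Xv (Suc i)) = Xv i"
  by (simp_all add: vswap_Xv transpose_def)

lemma tswap_eq: "1 \<le> i \<Longrightarrow> tswap i f = vswap i f"
  unfolding tswap_def by (subst rhom_eq_peval[OF rhom_vswap]) (auto intro: peval_cong simp: vswap_Xv)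

lemma mon_swap_braid:
  "1 \<le> i \<Longrightarrow> mon_swap i (mon_swap (Suc i) (mon_swap i m)) = mon_swap (Suc i) (mon_swap i (mon_swap (Suc i) m))"
  by (rule poly_mapping_eqI) (auto simp: lookup_mon_swap transpose_def)

lemma mon_swap_commute:
  "1 \<le> i \<Longrightarrow> Suc i < j \<Longrightarrow> mon_swap i (mon_swap j m) = mon_swap j (mon_swap i m)"
  by (rule poly_mapping_eqI) (auto simp: lookup_mon_swap transpose_def)

lemma vswap_braid: "1 \<le> i \<Longrightarrow> vswap i (vswap (Suc i) (vswap i f)) = vswap (Suc i) (vswap i (vswap (Suc i) f))"
  by (rule poly_mapping_eqI) (simp add: lookup_vswap mon_swap_braid)

lemma vswap_commute: "1 \<le> i \<Longrightarrow> Suc i < j \<Longrightarrow> vswap i (vswap j f) = vswap j (vswap i f)"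
  by (rule poly_mapping_eqI) (simp only: lookup_vswap mon_swap_commute[of i j])

section \<open>Divided differences\<close>

lemma Xv_neq: "1 \<le> i \<Longrightarrow> 1 \<le> j \<Longrightarrow> i \<noteq> j \<Longrightarrow> (Xv i :: 'a::comm_ring_1 mvpoly) \<noteq> Xv j"
proof
  assume "1 \<le> i" "1 \<le> j" "i \<noteq> j" and eq: "(Xv i :: 'a mvpoly) = Xv j"
  then have "Poly_Mapping.single (i - 1) (1::nat) \<noteq> Poly_Mapping.single (j - 1) 1"
    by (metis One_nat_def Suc_pred' keys_single not_one_le_zero singleton_inject zero_less_one zero_neq_one gr0I)
  then have "Poly_Mapping.lookup (Xv i :: 'a mvpoly) (Poly_Mapping.single (i - 1) 1) \<noteq>
    Poly_Mapping.lookup (Xv j) (Poly_Mapping.single (i - 1) 1)"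
    by (simp add: Xv_def lookup_single when_def)
  then show False using eq by simp
qed

text \<open>The twisted Leibniz rule fg - s(f)s(g) = f (g - s(g)) + (f - s(f)) s(g) reduces
  divisibility to the variables.\<close>

lemma vswap_diff_dvd:
  assumes "1 \<le> i"
  shows "(Xv i - Xv (Suc i)) dvd (f - vswap i f)"
proof (induction f rule: mvpoly_induct)
  case (Xv j)
  show ?case
    using assms Xv dvd_minus_iff[of "Xv i - Xv (Suc i)" "Xv i - Xv (Suc i) :: 'a mvpoly"]
    by (cases "j = i"; cases "j = Suc i")
      (simp_all add: vswap_Xv_left vswap_Xv_right vswap_Xv_other)
next
  case (add f g)
  have eq: "f + g - vswap i (f + g) = (f - vswap i f) + (g - vswap i g)" by (simp add: vswap_add)
  show ?case unfolding eq by (rule dvd_add[OF add])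
next
  case (mult f g)
  have eq: "f * g - vswap i (f * g) = f * (g - vswap i g) + (f - vswap i f) * vswap i g"
    by (simp add: vswap_mult algebra_simps)
  show ?case unfolding eq by (rule dvd_add[OF dvd_mult[OF mult(2)] dvd_mult2[OF mult(1)]])
qed simp

text \<open>The quotient exists by \<open>vswap_diff_dvd\<close> and is unique because Z[t] is an
  integral domain, so the choice is harmless.\<close>

definition ddiff :: "nat \<Rightarrow> Zt \<Rightarrow> Zt" where
  "ddiff i f = (SOME g. g * (Xv i - Xv (Suc i)) = f - vswap i f)"

lemma ddiff: "1 \<le> i \<Longrightarrow> ddiff i f * (Xv i - Xv (Suc i)) = f - vswap i f"
  unfolding ddiff_def by (rule someI_ex) (metis vswap_diff_dvd dvdE mult.commute)

lemma Xv_diff_neq0: "1 \<le> i \<Longrightarrow> 1 \<le> j \<Longrightarrow> i \<noteq> j \<Longrightarrow> Xv i - Xv j \<noteq> (0::Zt)"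
  using Xv_neq by auto

lemma ddiff_eqI: "1 \<le> i \<Longrightarrow> g * (Xv i - Xv (Suc i)) = f - vswap i f \<Longrightarrow> ddiff i f = g"
  using ddiff[of i f] Xv_diff_neq0[of i "Suc i"] by (metis One_nat_def le_SucI mult_right_cancel n_not_Suc_n)

lemma ddiff_symmetric: "1 \<le> i \<Longrightarrow> vswap i f = f \<Longrightarrow> ddiff i f = 0"
  by (rule ddiff_eqI) auto

lemma ddiff_mult_symmetric: "1 \<le> i \<Longrightarrow> vswap i f = f \<Longrightarrow> ddiff i (f * g) = f * ddiff i g"
  by (rule ddiff_eqI, simp, simp only: mult.assoc ddiff) (simp add: vswap_mult right_diff_distrib)

lemma vswap_ddiff: "1 \<le> i \<Longrightarrow> vswap i (ddiff i f) = ddiff i f"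
proof -
  assume i: "1 \<le> i"
  have "vswap i (ddiff i f * (Xv i - Xv (Suc i))) = vswap i (f - vswap i f)" using ddiff[OF i] by simp
  then have "vswap i (ddiff i f) * (Xv (Suc i) - Xv i) = vswap i f - f"
    using i by (simp add: vswap_mult rhom_diff[OF rhom_vswap] vswap_Xv_left vswap_Xv_right)
  then have "vswap i (ddiff i f) * (Xv i - Xv (Suc i)) = f - vswap i f"
    by (simp add: algebra_simps)
  from ddiff_eqI[OF i this] show ?thesis by (rule sym)
qed

lemma ddiff_ddiff: "1 \<le> i \<Longrightarrow> ddiff i (ddiff i f) = 0"
  by (simp add: ddiff_symmetric vswap_ddiff)

lemma ddiff_commute:
  assumes "1 \<le> i" "Suc i < j"
  shows "ddiff i (ddiff j f) = ddiff j (ddiff i f)"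
proof -
  have eq: "ddiff a (ddiff b f) * ((Xv a - Xv (Suc a)) * (Xv b - Xv (Suc b))) = f - vswap a f - vswap b f + vswap a (vswap b f)"
    if "1 \<le> a" "1 \<le> b" "a \<noteq> b" "a \<noteq> Suc b" "b \<noteq> Suc a" for a b
  proof -
    have sw: "vswap a (Xv b - Xv (Suc b)) = (Xv b - Xv (Suc b) :: Zt)"
      using that by (simp add: rhom_diff[OF rhom_vswap] vswap_Xv_other)
    have "ddiff a (ddiff b f) * ((Xv a - Xv (Suc a)) * (Xv b - Xv (Suc b))) =
      (ddiff a (ddiff b f) * (Xv a - Xv (Suc a))) * (Xv b - Xv (Suc b))" by (simp add: mult.assoc)
    also have "\<dots> = ddiff b f * (Xv b - Xv (Suc b)) - vswap a (ddiff b f * (Xv b - Xv (Suc b)))"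
      using that by (simp only: ddiff[OF that(1)] vswap_mult sw left_diff_distrib)
    also have "\<dots> = f - vswap a f - vswap b f + vswap a (vswap b f)"
      using that by (simp only: ddiff[OF that(2)] rhom_diff[OF rhom_vswap]) (simp add: algebra_simps)
    finally show ?thesis .
  qed
  have 1: "ddiff i (ddiff j f) * ((Xv i - Xv (Suc i)) * (Xv j - Xv (Suc j))) = f - vswap i f - vswap j f + vswap i (vswap j f)"
    by (rule eq) (use assms in auto)
  have 2: "ddiff j (ddiff i f) * ((Xv j - Xv (Suc j)) * (Xv i - Xv (Suc i))) = f - vswap j f - vswap i f + vswap j (vswap i f)"
    by (rule eq) (use assms in auto)
  have "ddiff i (ddiff j f) * ((Xv i - Xv (Suc i)) * (Xv j - Xv (Suc j))) = ddiff j (ddiff i f) * ((Xv i - Xv (Suc i)) * (Xv j - Xv (Suc j)))"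
    by (rule trans[OF 1], subst mult.commute[of "Xv i - Xv (Suc i)"], rule trans[OF _ 2[symmetric]])
      (simp add: vswap_commute[OF assms])
  moreover have "(Xv i - Xv (Suc i)) * (Xv j - Xv (Suc j)) \<noteq> (0::Zt)"
    using assms by (intro no_zero_divisors Xv_diff_neq0) auto
  ultimately show ?thesis using mult_right_cancel by blast
qed

text \<open>Multiplied by the Vandermonde product of x, y, z, either side becomes the alternating
  sum of f over the symmetric group on these variables. The sums differ only in how the longest
  element is written, and those expressions agree by the braid relation of the swaps.\<close>

lemma ddiff_braid:
  assumes i: "1 \<le> i"
  shows "ddiff i (ddiff (Suc i) (ddiff i f)) = ddiff (Suc i) (ddiff i (ddiff (Suc i) f))"
proof -
  define x y z :: Zt where "x = Xv i" and "y = Xv (Suc i)" and "z = Xv (Suc (Suc i))"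
  define s t :: "Zt \<Rightarrow> Zt" where "s = vswap i" and "t = vswap (Suc i)"
  have d1: "ddiff i g * (x - y) = g - s g" for g using ddiff[OF i] by (simp add: x_def y_def s_def)
  have d2: "ddiff (Suc i) g * (y - z) = g - t g" for g using ddiff[of "Suc i"] by (simp add: z_def y_def t_def)
  have sx: "s x = y" "s y = x" "s z = z" "t x = x" "t y = z" "t z = y"
    using i by (simp_all add: s_def t_def x_def y_def z_def vswap_Xv_left vswap_Xv_right vswap_Xv_other)
  have s: "s (g * h) = s g * s h" "s (g - h) = s g - s h" "s (s g) = g"
    and t: "t (g * h) = t g * t h" "t (g - h) = t g - t h" "t (t g) = g" for g h
    by (simp_all add: s_def t_def vswap_mult rhom_diff[OF rhom_vswap])
  have sd: "s (ddiff i g) = ddiff i g" and td: "t (ddiff (Suc i) g) = ddiff (Suc i) g" for g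
    using i by (simp_all add: s_def t_def vswap_ddiff)
  have 1: "ddiff i (ddiff (Suc i) (ddiff i f)) * ((x - y) * (y - z) * (x - z)) =
    f - s f - t f + t (s f) + s (t f) - s (t (s f))"
  proof -
    define g where "g = ddiff i f"
    have gx: "g * (x - y) = f - s f" by (simp add: g_def d1)
    have tg: "t g * (x - z) = t f - t (s f)" using arg_cong[OF d1[of f], of t] by (simp add: t sx g_def)
    have stg: "s (t g) * (y - z) = s (t f) - s (t (s f))" using arg_cong[OF tg, of s] by (simp add: s sx)
    have sd2: "s (ddiff (Suc i) g) * (x - z) = g - s (t g)"
      using arg_cong[OF d2[of g], of s] sd by (simp add: s sx g_def)
    have "ddiff i (ddiff (Suc i) g) * ((x - y) * (y - z) * (x - z)) =
      (ddiff i (ddiff (Suc i) g) * (x - y)) * ((y - z) * (x - z))" by (simp only: ac_simps)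
    also have "\<dots> = (ddiff (Suc i) g * (y - z)) * (x - z) - (s (ddiff (Suc i) g) * (x - z)) * (y - z)"
      by (simp only: d1) (simp add: algebra_simps)
    also have "\<dots> = g * (x - y) - t g * (x - z) + s (t g) * (y - z)"
      by (simp only: d2 sd2) (simp add: algebra_simps)
    also have "\<dots> = f - s f - t f + t (s f) + s (t f) - s (t (s f))"
      by (simp only: tg stg gx) (simp add: algebra_simps)
    finally show ?thesis by (simp add: g_def)
  qed
  have 2: "ddiff (Suc i) (ddiff i (ddiff (Suc i) f)) * ((x - y) * (y - z) * (x - z)) =
    f - s f - t f + t (s f) + s (t f) - t (s (t f))"
  proof -
    define g where "g = ddiff (Suc i) f"
    have gx: "g * (y - z) = f - t f" by (simp add: g_def d2)
    have sg: "s g * (x - z) = s f - s (t f)" using arg_cong[OF d2[of f], of s] by (simp add: s sx g_def)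
    have tsg: "t (s g) * (x - y) = t (s f) - t (s (t f))" using arg_cong[OF sg, of t] by (simp add: t sx)
    have td1: "t (ddiff i g) * (x - z) = g - t (s g)"
      using arg_cong[OF d1[of g], of t] td by (simp add: t sx g_def)
    have "ddiff (Suc i) (ddiff i g) * ((x - y) * (y - z) * (x - z)) =
      (ddiff (Suc i) (ddiff i g) * (y - z)) * ((x - y) * (x - z))" by (simp only: ac_simps)
    also have "\<dots> = (ddiff i g * (x - y)) * (x - z) - (t (ddiff i g) * (x - z)) * (x - y)"
      by (simp only: d2) (simp add: algebra_simps)
    also have "\<dots> = g * (y - z) - s g * (x - z) + t (s g) * (x - y)"
      by (simp only: d1 td1) (simp add: algebra_simps)
    also have "\<dots> = f - s f - t f + t (s f) + s (t f) - t (s (t f))"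
      by (simp only: sg tsg gx) (simp add: algebra_simps)
    finally show ?thesis by (simp add: g_def)
  qed
  have "s (t (s f)) = t (s (t f))" unfolding s_def t_def by (rule vswap_braid[OF i])
  then have "ddiff i (ddiff (Suc i) (ddiff i f)) * ((x - y) * (y - z) * (x - z)) =
    ddiff (Suc i) (ddiff i (ddiff (Suc i) f)) * ((x - y) * (y - z) * (x - z))" using 1 2 by simp
  moreover have "(x - y) * (y - z) * (x - z) \<noteq> 0"
    unfolding x_def y_def z_def using i by (intro no_zero_divisors Xv_diff_neq0) auto
  ultimately show ?thesis using mult_right_cancel by blast
qed

section \<open>The symmetric group\<close>

lemma Sinf_pos: "u \<in> Sinf \<Longrightarrow> u \<in> Winf \<and> (\<forall>x>0. 0 < u x)"
proof -
  assume "u \<in> Sinf"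
  then obtain ws where ws: "set ws \<subseteq> {1..}" "u = wordprod ws" by (auto simp: Sinf_def)
  have "set ws \<subseteq> {1..} \<Longrightarrow> \<forall>x>0. 0 < wordprod ws x"
  proof (induction ws)
    case (Cons i ws)
    have "0 < sgen i y" if "0 < y" for y using that Cons.prems by (simp add: sgen_apply)
    then show ?case using Cons by auto
  qed simp
  then show ?thesis using ws by simp
qed

text \<open>Removing descents from the right never leaves the symmetric group: positivity excludes a
  descent at 0, and the fixed points beyond n exclude one at i \<ge> n.\<close>

lemma ex_word_bounded:
  assumes "u \<in> Winf" "\<forall>x>0. 0 < u x" "\<forall>x>int n. u x = x"
  shows "\<exists>ws. set ws \<subseteq> {1..<n} \<and> length ws = wlen u \<and> wordprod ws = u"
  using assms
proof (induction "wlen u" arbitrary: u)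
  case 0
  then have "u = id" using wlen_eq_0_iff[of u] by simp
  then show ?case using 0 by (intro exI[of _ "[]"]) simp
next
  case (Suc l)
  have "u \<noteq> id" using Suc.hyps(2) by auto
  then obtain i where i: "u (int i + 1) < u (int i)" using ex_descent[OF Suc.prems(1)] by blast
  have inj: "u x = u y \<longleftrightarrow> x = y" for x y using Winf_inj[OF Suc.prems(1)] .
  have i1: "1 \<le> i"
  proof (rule ccontr)
    assume "\<not> 1 \<le> i"
    then have "i = 0" by simp
    then have "u 1 < u 0" using i by simp
    then show False using Suc.prems(2) Winf_zero[OF Suc.prems(1)] by (metis less_asym zero_less_one)
  qed
  have iN: "i < n"
  proof (rule ccontr)
    assume "\<not> i < n"
    then have 1: "u (int i + 1) = int i + 1" using Suc.prems(3) by simp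
    then have "int i + 1 < u (int i)" using i by simp
    then have "u (u (int i)) = u (int i)" using Suc.prems(3) \<open>\<not> i < n\<close> by simp
    then show False using inj[of "u (int i)" "int i"] \<open>int i + 1 < u (int i)\<close> by simp
  qed
  let ?v = "u \<circ> sgen i"
  have W: "?v \<in> Winf" using Suc.prems(1) by simp
  have l: "l = wlen ?v" using wlen_desc[OF Suc.prems(1) i] Suc.hyps(2) by simp
  have "\<forall>x>0. 0 < ?v x" using Suc.prems(2) i1 by (simp add: sgen_apply)
  moreover have "\<forall>x>int n. ?v x = x" using Suc.prems(3) iN by (simp add: sgen_apply)
  ultimately obtain ws where ws: "set ws \<subseteq> {1..<n}" "length ws = wlen ?v" "wordprod ws = ?v"
    using Suc.hyps(1)[OF l W] by blast
  have "wordprod (ws @ [i]) = u" using ws(3) by (simp add: wordprod_append)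
  then show ?case using ws i1 iN l Suc.hyps(2) by (intro exI[of _ "ws @ [i]"]) simp
qed

lemma Sn_iff: "u \<in> Sn n \<longleftrightarrow> u \<in> Winf \<and> (\<forall>x>0. 0 < u x) \<and> (\<forall>x>int n. u x = x)"
proof
  assume "u \<in> Sn n"
  then obtain ws where ws: "set ws \<subseteq> {1..<n}" "u = wordprod ws" by (auto simp: Sn_def)
  have "set ws \<subseteq> {1..}" using ws(1) by auto
  then have "u \<in> Sinf" unfolding Sinf_def using ws(2) by blast
  moreover have "set ws \<subseteq> {1..<n} \<Longrightarrow> \<forall>x>int n. wordprod ws x = x"
  proof (induction ws)
    case (Cons i ws)
    then show ?case by (simp add: sgen_apply)
  qed simp
  ultimately show "u \<in> Winf \<and> (\<forall>x>0. 0 < u x) \<and> (\<forall>x>int n. u x = x)"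
    using Sinf_pos ws by simp
next
  assume "u \<in> Winf \<and> (\<forall>x>0. 0 < u x) \<and> (\<forall>x>int n. u x = x)"
  then show "u \<in> Sn n" using ex_word_bounded[of u n] unfolding Sn_def by blast
qed

lemma Sinf_iff: "u \<in> Sinf \<longleftrightarrow> u \<in> Winf \<and> (\<forall>x>0. 0 < u x)"
proof
  assume h: "u \<in> Winf \<and> (\<forall>x>0. 0 < u x)"
  then obtain n :: nat where n: "\<forall>x. int n < \<bar>x\<bar> \<longrightarrow> u x = x" by (auto simp: Winf_iff)
  then have "\<forall>x>int n. u x = x" by simp
  then obtain ws where "set ws \<subseteq> {1..<n}" "wordprod ws = u" using ex_word_bounded[of u n] h by blast
  moreover have "{1..<n} \<subseteq> {1..}" by auto
  ultimately show "u \<in> Sinf" unfolding Sinf_def by blast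
qed (use Sinf_pos in blast)

lemma Sinf_Sn:
  assumes "u \<in> Sinf" obtains n where "1 \<le> n" "u \<in> Sn n"
proof -
  obtain n :: nat where n: "\<forall>x. int n < \<bar>x\<bar> \<longrightarrow> u x = x" using assms by (auto simp: Sinf_iff Winf_iff)
  then have "u \<in> Sn (Suc n)" using assms by (auto simp: Sn_iff Sinf_iff)
  then show ?thesis using that[of "Suc n"] by simp
qed

lemma Sn_Sinf: "u \<in> Sn n \<Longrightarrow> u \<in> Sinf"
  by (simp add: Sn_iff Sinf_iff)

lemma Sinf_Winf: "u \<in> Sinf \<Longrightarrow> u \<in> Winf"
  by (simp add: Sinf_iff)

lemma Sinf_comp_sgen: "u \<in> Sinf \<Longrightarrow> 1 \<le> i \<Longrightarrow> u \<circ> sgen i \<in> Sinf"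
  by (auto simp: Sinf_iff sgen_apply)

lemma Sinf_sgen_comp: "u \<in> Sinf \<Longrightarrow> 1 \<le> i \<Longrightarrow> sgen i \<circ> u \<in> Sinf"
  by (auto simp: Sinf_iff sgen_apply)

lemma Sinf_inv: "u \<in> Sinf \<Longrightarrow> inv u \<in> Sinf"
  unfolding Sinf_iff
proof (intro conjI allI impI)
  assume u: "u \<in> Winf \<and> (\<forall>x>0. 0 < u x)"
  then show "inv u \<in> Winf" by simp
  fix x :: int assume x: "0 < x"
  show "0 < inv u x"
  proof (rule ccontr)
    assume "\<not> 0 < inv u x"
    moreover have "inv u x \<noteq> 0" using inv_left_apply(2)[of u x] u x Winf_zero[of u] by force
    ultimately have "0 < u (- inv u x)" using u by simp
    then show False using u x by (simp add: Winf_minus inv_left_apply)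
  qed
qed

lemma Sinf_reduced_word:
  assumes "u \<in> Sinf"
  obtains ws where "set ws \<subseteq> {1..}" "length ws = wlen u" "wordprod ws = u"
proof -
  obtain n :: nat where n: "\<forall>x. int n < \<bar>x\<bar> \<longrightarrow> u x = x" using assms by (auto simp: Sinf_iff Winf_iff)
  then have "\<forall>x>int n. u x = x" by simp
  then obtain ws where "set ws \<subseteq> {1..<n}" "length ws = wlen u" "wordprod ws = u"
    using ex_word_bounded[of u n] assms by (auto simp: Sinf_iff)
  moreover from this have "set ws \<subseteq> {1..}" by auto
  ultimately show ?thesis using that[of ws] by simp
qed

lemma sgen_commute:
  assumes "1 \<le> i" "Suc i < j"
  shows "sgen i \<circ> sgen j = sgen j \<circ> sgen i"
proof
  fix x
  have fx: "sgen a y = y" if "\<bar>y\<bar> \<noteq> int a" "\<bar>y\<bar> \<noteq> int a + 1" for a y using sgen_fix[OF that] .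
  show "(sgen i \<circ> sgen j) x = (sgen j \<circ> sgen i) x"
  proof (cases "\<bar>x\<bar> \<noteq> int i \<and> \<bar>x\<bar> \<noteq> int i + 1")
    case True
    then have "\<bar>sgen j x\<bar> \<noteq> int i \<and> \<bar>sgen j x\<bar> \<noteq> int i + 1" using assms by (auto simp: sgen_apply)
    then show ?thesis using True fx by simp
  next
    case False
    then have "\<bar>x\<bar> \<noteq> int j \<and> \<bar>x\<bar> \<noteq> int j + 1" "\<bar>sgen i x\<bar> \<noteq> int j \<and> \<bar>sgen i x\<bar> \<noteq> int j + 1"
      using assms by (auto simp: sgen_apply)
    then show ?thesis using fx by simp
  qed
qed

lemma sgen_braid:
  assumes "1 \<le> i"
  shows "sgen i \<circ> sgen (Suc i) \<circ> sgen i = sgen (Suc i) \<circ> sgen i \<circ> sgen (Suc i)"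
proof
  fix x
  consider "x = int i" | "x = int i + 1" | "x = int i + 2" | "x = - int i" | "x = - int i - 1" | "x = - int i - 2"
    | "\<bar>x\<bar> \<noteq> int i" "\<bar>x\<bar> \<noteq> int i + 1" "\<bar>x\<bar> \<noteq> int i + 2" by linarith
  then show "(sgen i \<circ> sgen (Suc i) \<circ> sgen i) x = (sgen (Suc i) \<circ> sgen i \<circ> sgen (Suc i)) x"
  proof cases
    case 7
    then have "sgen i x = x" "sgen (Suc i) x = x" by (auto intro!: sgen_fix)
    then show ?thesis by simp
  qed (use assms in \<open>simp_all add: sgen_apply\<close>)
qed

section \<open>Schubert polynomials\<close>

text \<open>The last letter acts first, as in \<open>wordprod\<close>, so that reduced words of one
  element may be compared letter by letter from the right.\<close>

definition dword :: "nat list \<Rightarrow> Zt \<Rightarrow> Zt" where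
  "dword ws f = foldr ddiff ws f"

lemma dword_simps [simp]: "dword [] f = f" "dword (i # ws) f = ddiff i (dword ws f)"
  "dword (us @ vs) f = dword us (dword vs f)"
  by (simp_all add: dword_def)

definition reduced :: "nat list \<Rightarrow> bool" where
  "reduced ws \<longleftrightarrow> set ws \<subseteq> {1..} \<and> wlen (wordprod ws) = length ws"

lemma reduced_wordprod_Sinf: "reduced ws \<Longrightarrow> wordprod ws \<in> Sinf"
  unfolding reduced_def Sinf_def by blast

lemma reduced_snoc:
  assumes "reduced (ws @ [i])"
  shows "reduced ws" "1 \<le> i" "wordprod (ws @ [i]) \<circ> sgen i = wordprod ws"
    "wordprod (ws @ [i]) (int i + 1) < wordprod (ws @ [i]) (int i)"
proof -
  let ?u = "wordprod (ws @ [i])"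
  have eq: "?u \<circ> sgen i = wordprod ws" by (simp add: wordprod_append)
  show "1 \<le> i" using assms by (simp add: reduced_def)
  have W: "?u \<in> Winf" by simp
  have l: "wlen ?u = Suc (length ws)" using assms by (simp add: reduced_def)
  have le: "wlen (?u \<circ> sgen i) \<le> length ws" unfolding eq by (rule wlen_wordprod_le)
  show d: "?u (int i + 1) < ?u (int i)"
  proof (rule ccontr)
    assume "\<not> ?u (int i + 1) < ?u (int i)"
    then have "?u (int i) < ?u (int i + 1)" using Winf_inj[OF W, of "int i" "int i + 1"] by simp
    then have "wlen (?u \<circ> sgen i) = Suc (wlen ?u)" by (rule wlen_asc[OF W])
    then show False using le l by simp
  qed
  show "reduced ws" using wlen_desc[OF W d] l assms unfolding eq by (simp add: reduced_def)
  show "?u \<circ> sgen i = wordprod ws" by (rule eq)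
qed

lemma reducedI:
  assumes "set ws \<subseteq> {1..}" "wordprod ws = u" "length ws = wlen u"
  shows "reduced ws"
  using assms by (simp add: reduced_def)

text \<open>Matsumoto's argument: two reduced words of the same element with different last letters
  \<open>i\<close>, \<open>j\<close> are compared through words ending in the two words of the longest element of the
  subgroup generated by \<open>s\<^sub>i\<close> and \<open>s\<^sub>j\<close>.\<close>

lemma dword_eq:
  assumes "reduced ws" "reduced vs" "wordprod ws = wordprod vs"
  shows "dword ws f = dword vs f"
  using assms
proof (induction "length ws" arbitrary: ws vs f)
  case 0
  then have "length vs = wlen (wordprod ws)" by (simp only: reduced_def)
  then have "length vs = 0" using 0 by (simp only: reduced_def)
  then show ?case using 0 by simp
next
  case (Suc l)
  have lv: "length vs = Suc l" using Suc by (metis reduced_def)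
  obtain ws' i where ws: "ws = ws' @ [i]" using Suc.hyps(2) by (metis length_0_conv nat.distinct(1) rev_exhaust)
  obtain vs' j where vs: "vs = vs' @ [j]" using lv by (metis length_0_conv nat.distinct(1) rev_exhaust)
  define u where "u = wordprod ws"
  have u2: "u = wordprod vs" using Suc.prems by (simp add: u_def)
  note w = reduced_snoc[OF Suc.prems(1)[unfolded ws], folded ws, folded u_def]
  note v = reduced_snoc[OF Suc.prems(2)[unfolded vs], folded vs, folded u2]
  have uS: "u \<in> Sinf" unfolding u_def by (rule reduced_wordprod_Sinf[OF Suc.prems(1)])
  have uW: "u \<in> Winf" using uS by (rule Sinf_Winf)
  have lu: "wlen u = Suc l" using Suc.prems(1) Suc.hyps(2) by (simp add: reduced_def u_def)
  have IH: "dword a g = dword b g" if "reduced a" "reduced b" "wordprod a = wordprod b" "length a = l" for a b g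
    using Suc.hyps(1)[OF that(4)[symmetric] that(1-3)] .
  have lw': "length ws' = l" and lv': "length vs' = l" using ws vs Suc.hyps(2) lv by auto
  \<comment> \<open>Both commuting letters are descents of u, so a reduced word xs of u s_p s_q
    extends by q and by p to reduced words of u s_p and u s_q, to which the induction hypothesis
    applies.\<close>
  have far: "dword a (ddiff p f) = dword b (ddiff q f)"
    if "reduced a" "wordprod a = u \<circ> sgen p" "reduced b" "wordprod b = u \<circ> sgen q" "length a = l" "length b = l"
      "1 \<le> p" "Suc p < q" "u (int p + 1) < u (int p)" "u (int q + 1) < u (int q)" for a b p q
  proof -
    let ?x = "u \<circ> sgen p \<circ> sgen q"
    have x2: "?x = u \<circ> sgen q \<circ> sgen p" using sgen_commute[OF that(7,8)] by (simp add: comp_assoc)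
    have 1: "wlen (u \<circ> sgen p) = l" using wlen_desc[OF uW that(9)] lu by simp
    have 2: "wlen (u \<circ> sgen q) = l" using wlen_desc[OF uW that(10)] lu by simp
    have "(u \<circ> sgen p) (int q + 1) < (u \<circ> sgen p) (int q)" using that by (simp add: sgen_apply)
    then have lx: "Suc (wlen ?x) = l" using wlen_desc[of "u \<circ> sgen p" q] uW 1 by simp
    have "?x \<in> Sinf" using uS that by (intro Sinf_comp_sgen) auto
    then obtain xs where xs: "set xs \<subseteq> {1..}" "length xs = wlen ?x" "wordprod xs = ?x"
      by (rule Sinf_reduced_word)
    have wp: "wordprod (xs @ [q]) = u \<circ> sgen p" "wordprod (xs @ [p]) = u \<circ> sgen q"
      using xs(3) by (simp_all add: wordprod_append) (simp add: x2)
    have r: "reduced (xs @ [q])" "reduced (xs @ [p])"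
      by (rule reducedI[OF _ wp(1)]; use xs lx 1 that in simp) (rule reducedI[OF _ wp(2)]; use xs lx 2 that in simp)
    have "dword a (ddiff p f) = dword (xs @ [q]) (ddiff p f)" by (rule IH) (use that r wp in auto)
    also have "\<dots> = dword (xs @ [p]) (ddiff q f)" using ddiff_commute[OF that(7,8)] by simp
    also have "\<dots> = dword b (ddiff q f)" by (rule IH) (use that r wp xs lx in auto)
    finally show ?thesis .
  qed
  \<comment> \<open>Descents at p and p+1 mean that u decreases on three consecutive positions, so u
    can be shortened three times. With xs a reduced word of the result, the two tails p, q and q, p
    complete to the two sides of the braid relation.\<close>
  have near: "dword a (ddiff p f) = dword b (ddiff (Suc p) f)"
    if "reduced a" "wordprod a = u \<circ> sgen p" "reduced b" "wordprod b = u \<circ> sgen (Suc p)" "length a = l" "length b = l"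
      "1 \<le> p" "u (int p + 1) < u (int p)" "u (int (Suc p) + 1) < u (int (Suc p))" for a b p
  proof -
    let ?q = "Suc p"
    let ?x = "u \<circ> sgen p \<circ> sgen ?q \<circ> sgen p"
    have x2: "?x = u \<circ> sgen ?q \<circ> sgen p \<circ> sgen ?q" using sgen_braid[OF that(7)] by (simp add: comp_assoc)
    have 1: "wlen (u \<circ> sgen p) = l" using wlen_desc[OF uW that(8)] lu by simp
    have 2: "wlen (u \<circ> sgen ?q) = l" using wlen_desc[OF uW that(9)] lu by simp
    have "(u \<circ> sgen p) (int ?q + 1) < (u \<circ> sgen p) (int ?q)" using that by (simp add: sgen_apply add.commute)
    then have l1: "Suc (wlen (u \<circ> sgen p \<circ> sgen ?q)) = l" using wlen_desc[of "u \<circ> sgen p" ?q] uW 1 by simp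
    have "(u \<circ> sgen p \<circ> sgen ?q) (int p + 1) < (u \<circ> sgen p \<circ> sgen ?q) (int p)" using that by (simp add: sgen_apply add.commute)
    then have lx: "Suc (Suc (wlen ?x)) = l" using wlen_desc[of "u \<circ> sgen p \<circ> sgen ?q" p] uW l1 by simp
    have "?x \<in> Sinf" using uS that by (intro Sinf_comp_sgen) auto
    then obtain xs where xs: "set xs \<subseteq> {1..}" "length xs = wlen ?x" "wordprod xs = ?x"
      by (rule Sinf_reduced_word)
    have wp1: "wordprod (xs @ [p, ?q]) = u \<circ> sgen p"
      using xs(3) by (simp add: wordprod_append flip: comp_assoc)
    have wp2: "wordprod (xs @ [?q, p]) = u \<circ> sgen ?q"
      using xs(3) unfolding x2 by (simp add: wordprod_append flip: comp_assoc)
    have r1: "reduced (xs @ [p, ?q])" by (rule reducedI[OF _ wp1]) (use xs lx 1 that in auto)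
    have r2: "reduced (xs @ [?q, p])" by (rule reducedI[OF _ wp2]) (use xs lx 2 that in auto)
    have "dword a (ddiff p f) = dword (xs @ [p, ?q]) (ddiff p f)" by (rule IH) (use that r1 wp1 in auto)
    also have "\<dots> = dword (xs @ [?q, p]) (ddiff ?q f)" using ddiff_braid[OF that(7)] by simp
    also have "\<dots> = dword b (ddiff ?q f)" by (rule IH) (use that r2 wp2 xs lx in auto)
    finally show ?thesis .
  qed
  have "dword ws' (ddiff i f) = dword vs' (ddiff j f)"
  proof -
    consider "i = j" | "Suc i < j" | "j = Suc i" | "Suc j < i" | "i = Suc j" by linarith
    then show ?thesis
    proof cases
      case 1
      then show ?thesis using IH[OF w(1) v(1) _ lw'] w(3) v(3) by simp
    next
      case 2
      show ?thesis by (rule far[OF w(1) w(3)[symmetric] v(1) v(3)[symmetric] lw' lv' w(2) 2 w(4) v(4)])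
    next
      case 3
      show ?thesis using near[OF w(1) w(3)[symmetric] v(1) _ lw' lv' w(2) w(4)] v(3,4) 3 by simp
    next
      case 4
      show ?thesis by (rule far[OF v(1) v(3)[symmetric] w(1) w(3)[symmetric] lv' lw' v(2) 4 v(4) w(4), symmetric])
    next
      case 5
      show ?thesis using near[OF v(1) v(3)[symmetric] w(1) _ lv' lw' v(2) v(4)] w(3,4) 5 by simp
    qed
  qed
  then show ?case by (simp add: ws vs)
qed

section \<open>Longest elements and staircase monomials\<close>

definition wlong :: "nat \<Rightarrow> int \<Rightarrow> int" where
  "wlong n x = (if 1 \<le> x \<and> x \<le> int n then int n + 1 - x
     else if - int n \<le> x \<and> x \<le> - 1 then - int n - 1 - x else x)"

definition stair :: "nat \<Rightarrow> Zt" where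
  "stair n = (\<Prod>i=1..<n. Xv i ^ (n - i))"

lemma wlong_Sn [simp]: "wlong n \<in> Sn n"
proof -
  have inv: "wlong n (wlong n x) = x" for x by (auto simp: wlong_def)
  have "bij (wlong n)" by (rule involuntory_imp_bij) (rule inv)
  then have "wlong n \<in> Winf" unfolding Winf_iff by (auto simp: wlong_def intro!: exI[of _ n])
  then show ?thesis unfolding Sn_iff by (auto simp: wlong_def)
qed

lemma wlong_Sinf [simp]: "wlong n \<in> Sinf" and wlong_Winf [simp]: "wlong n \<in> Winf"
  using wlong_Sn Sn_Sinf Sinf_Winf by blast+

lemma inv_set_wlong: "inv_set (wlong n) = {(a, b). 1 \<le> a \<and> a < b \<and> b \<le> int n}"
proof (intro set_eqI)
  fix p :: "int \<times> int"
  obtain a b where p: "p = (a, b)" by force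
  show "p \<in> inv_set (wlong n) \<longleftrightarrow> p \<in> {(a, b). 1 \<le> a \<and> a < b \<and> b \<le> int n}"
    unfolding p by (auto simp: inv_set_def wlong_def split: if_splits)
qed

lemma wlen_wlong_Suc: "wlen (wlong (Suc n)) = wlen (wlong n) + n"
proof -
  have "inv_set (wlong (Suc n)) = inv_set (wlong n) \<union> (\<lambda>a. (a, int (Suc n))) ` {1..int n}"
    unfolding inv_set_wlong by force
  then have "card (inv_set (wlong (Suc n))) = card (inv_set (wlong n)) + card ((\<lambda>a. (a, int (Suc n))) ` {1..int n})"
    by (simp only:, intro card_Un_disjoint finite_inv_set wlong_Winf) (auto simp: inv_set_wlong)
  also have "card ((\<lambda>a. (a, int (Suc n))) ` {1..int n}) = n"
    by (subst card_image) (auto simp: inj_on_def)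
  finally show ?thesis by (simp add: wlen_eq)
qed

lemma wlong_0: "wlong 0 = id" "wlong (Suc 0) = id"
  by (auto simp: wlong_def fun_eq_iff)

lemma Sn_bounds:
  assumes "u \<in> Sn n" "1 \<le> x" "x \<le> int n"
  shows "1 \<le> u x" "u x \<le> int n"
proof -
  have u: "u \<in> Winf" "\<forall>x>0. 0 < u x" "\<forall>x>int n. u x = x" using assms by (auto simp: Sn_iff)
  show "1 \<le> u x" using u(2) assms by (simp add: int_one_le_iff_zero_less)
  show "u x \<le> int n"
  proof (rule ccontr)
    assume "\<not> u x \<le> int n"
    then have "u (u x) = u x" using u(3) by simp
    then show False using Winf_inj[OF u(1), of "u x" x] assms \<open>\<not> u x \<le> int n\<close> by simp
  qed
qed

lemma Sn_comp_sgen: "u \<in> Sn n \<Longrightarrow> 1 \<le> i \<Longrightarrow> i < n \<Longrightarrow> u \<circ> sgen i \<in> Sn n"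
  unfolding Sn_iff by (auto simp: sgen_apply)

text \<open>Decreasing from the left bounds u i above by n+1-i, decreasing towards the right end
  bounds it below by the same number; oddness extends the equality to negative arguments.\<close>

lemma all_descents_wlong:
  assumes u: "u \<in> Sn n" and d: "\<And>i. 1 \<le> i \<Longrightarrow> i < n \<Longrightarrow> u (int i + 1) < u (int i)"
  shows "u = wlong n"
proof -
  have up: "u (int i) \<le> int n + 1 - int i" if "1 \<le> i" "i \<le> n" for i
    using that
  proof (induction i)
    case (Suc i)
    show ?case
    proof (cases "i = 0")
      case True then show ?thesis using Sn_bounds(2)[OF u, of 1] Suc.prems by simp
    next
      case False
      then show ?thesis using Suc d[of i] by (simp add: add.commute)
    qed
  qed simp
  have low: "int m + 1 \<le> u (int (n - m))" if "m < n" for m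
    using that
  proof (induction m)
    case 0 then show ?case using Sn_bounds(1)[OF u, of "int n"] by simp
  next
    case (Suc m)
    have eq: "Suc (n - Suc m) = n - m" using Suc.prems by simp
    have "u (int (n - Suc m) + 1) < u (int (n - Suc m))" using d[of "n - Suc m"] Suc.prems by simp
    then have "u (int (n - m)) < u (int (n - Suc m))" using eq by (metis of_nat_Suc add.commute)
    then show ?case using Suc by simp
  qed
  have val: "u (int i) = int n + 1 - int i" if "1 \<le> i" "i \<le> n" for i
    using up[OF that] low[of "n - i"] that by simp
  have pos: "u x = wlong n x" if "0 < x" for x
  proof (cases "x \<le> int n")
    case True
    then show ?thesis using val[of "nat x"] that by (simp add: wlong_def)
  next
    case False
    then show ?thesis using u that by (simp add: Sn_iff wlong_def)
  qed
  have W: "u \<in> Winf" using u by (simp add: Sn_iff)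
  show ?thesis
  proof
    fix x :: int
    consider "0 < x" | "x = 0" | "x < 0" by linarith
    then show "u x = wlong n x"
    proof cases
      case 3
      then have "u (- x) = wlong n (- x)" using pos by simp
      then show ?thesis using Winf_minus[OF W] Winf_minus[OF wlong_Winf] by simp
    qed (use pos Winf_zero[OF W] Winf_zero[OF wlong_Winf] in simp_all)
  qed
qed

text \<open>Multiply on the right at ascents below n until none is left. Lengths in S_n are bounded,
  so this stops, and only the longest element has a descent everywhere.\<close>

lemma climb:
  assumes "u \<in> Sn n"
  shows "\<exists>ws. set ws \<subseteq> {1..<n} \<and> u \<circ> wordprod ws = wlong n \<and> wlen (wlong n) = wlen u + length ws"
proof -
  have bound: "wlen v \<le> card ({- int n..int n} \<times> {- int n..int n})" if v: "v \<in> Sn n" for v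
  proof -
    have "inv_set v \<subseteq> {- int n..int n} \<times> {- int n..int n}"
    proof (rule subrelI)
      fix a b assume ab: "(a, b) \<in> inv_set v"
      then have 1: "- b < a" "a < b" "v b < v a" by (auto simp: inv_set_def)
      have "\<not> int n < b"
      proof
        assume b: "int n < b"
        then have vb: "v b = b" using v by (simp add: Sn_iff)
        consider "a \<le> 0" | "1 \<le> a" "a \<le> int n" | "int n < a" by linarith
        then show False
        proof cases
          case 1
          then have "v a \<le> 0" using v Winf_minus[of v a] Winf_zero[of v] by (cases "a = 0") (auto simp: Sn_iff dest: spec[of _ "- a"])
          then show False using \<open>v b < v a\<close> vb b by simp
        next
          case 2
          then show False using Sn_bounds(2)[OF v 2] 1 vb b by simp
        next
          case 3
          then show False using v 1 vb by (simp add: Sn_iff)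
        qed
      qed
      then show "(a, b) \<in> {- int n..int n} \<times> {- int n..int n}" using 1 by auto
    qed
    then have "card (inv_set v) \<le> card ({- int n..int n} \<times> {- int n..int n})"
      by (rule card_mono[rotated]) simp
    moreover have "v \<in> Winf" using v by (simp add: Sn_iff)
    ultimately show ?thesis by (simp only: wlen_eq)
  qed
  show ?thesis using assms
  proof (induction "card ({- int n..int n} \<times> {- int n..int n}) - wlen u" arbitrary: u rule: less_induct)
    case less
    show ?case
    proof (cases "\<forall>i. 1 \<le> i \<longrightarrow> i < n \<longrightarrow> u (int i + 1) < u (int i)")
      case True
      then have "u = wlong n" using all_descents_wlong[OF less.prems] by blast
      then show ?thesis by (intro exI[of _ "[]"]) simp
    next
      case False
      then obtain i where i: "1 \<le> i" "i < n" "\<not> u (int i + 1) < u (int i)" by blast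
      have W: "u \<in> Winf" using less.prems by (simp add: Sn_iff)
      have "u (int i) < u (int i + 1)" using i Winf_inj[OF W, of "int i" "int i + 1"] by simp
      then have l: "wlen (u \<circ> sgen i) = Suc (wlen u)" by (rule wlen_asc[OF W])
      have S: "u \<circ> sgen i \<in> Sn n" using Sn_comp_sgen less.prems i by blast
      obtain ws where ws: "set ws \<subseteq> {1..<n}" "(u \<circ> sgen i) \<circ> wordprod ws = wlong n"
        "wlen (wlong n) = wlen (u \<circ> sgen i) + length ws"
        using less.hyps[OF _ S] bound[OF S] l by (metis Suc_le_lessD diff_less_mono2 lessI)
      then show ?thesis using i l by (intro exI[of _ "i # ws"]) (simp add: comp_assoc)
    qed
  qed
qed

lemma Sn_longest: "v \<in> Sn n \<Longrightarrow> wlen v \<le> wlen (wlong n)"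
  using climb by fastforce

lemma longest_unique:
  assumes w: "w \<in> Sn n" "\<forall>v\<in>Sn n. wlen v \<le> wlen w"
  shows "w = wlong n"
proof (rule all_descents_wlong[OF w(1)])
  fix i assume i: "1 \<le> i" "i < n"
  have W: "w \<in> Winf" using w by (simp add: Sn_iff)
  show "w (int i + 1) < w (int i)"
  proof (rule ccontr)
    assume "\<not> w (int i + 1) < w (int i)"
    then have "w (int i) < w (int i + 1)" using Winf_inj[OF W, of "int i" "int i + 1"] by simp
    then have "wlen (w \<circ> sgen i) = Suc (wlen w)" by (rule wlen_asc[OF W])
    then show False using w(2) Sn_comp_sgen[OF w(1) i] by fastforce
  qed
qed

text \<open>If the exponent of t_i exceeds that of t_{i+1} by one, the monomial is t_i times a
  factor symmetric in t_i, t_{i+1}, and the divided difference of t_i is 1.\<close>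

lemma ddiff_monomial:
  assumes i: "1 \<le> i" and S: "finite S" "i \<in> S" "Suc i \<in> S" "\<forall>j\<in>S. 1 \<le> j" and e: "e i = Suc (e (Suc i))"
  shows "ddiff i (\<Prod>j\<in>S. Xv j ^ e j) = (\<Prod>j\<in>S. Xv j ^ (e(i := e (Suc i))) j)"
proof -
  let ?R = "S - {i} - {Suc i}"
  define r :: Zt where "r = (\<Prod>j\<in>?R. Xv j ^ e j) * (Xv i * Xv (Suc i)) ^ e (Suc i)"
  have split: "(\<Prod>j\<in>S. Xv j ^ g j) = Xv i ^ g i * (Xv (Suc i) ^ g (Suc i) * (\<Prod>j\<in>?R. Xv j ^ g j :: Zt))" for g
    using S by (subst prod.remove[of S i], simp, simp, subst prod.remove[of "S - {i}" "Suc i"]) auto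
  have "vswap i (\<Prod>j\<in>?R. Xv j ^ e j :: Zt) = (\<Prod>j\<in>?R. Xv j ^ e j)"
    unfolding rhom_prod[OF rhom_vswap] rhom_power[OF rhom_vswap]
    by (rule prod.cong) (use S i in \<open>auto simp: vswap_Xv_other\<close>)
  then have sym: "vswap i r = r"
    unfolding r_def by (simp add: vswap_mult rhom_power[OF rhom_vswap] vswap_Xv_left[OF i] vswap_Xv_right[OF i] mult.commute)
  have "ddiff i (Xv i) = 1"
    by (rule ddiff_eqI[OF i]) (simp add: vswap_Xv_left[OF i])
  then have "ddiff i (r * Xv i) = r" using ddiff_mult_symmetric[OF i sym, of "Xv i"] by simp
  moreover have "(\<Prod>j\<in>S. Xv j ^ e j) = r * Xv i"
    unfolding split[of e] e r_def by (simp add: power_mult_distrib algebra_simps)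
  moreover have "(\<Prod>j\<in>?R. Xv j ^ (e(i := e (Suc i))) j) = (\<Prod>j\<in>?R. Xv j ^ e j :: Zt)"
    by (rule prod.cong) auto
  then have "(\<Prod>j\<in>S. Xv j ^ (e(i := e (Suc i))) j) = r"
    unfolding split[of "e(i := e (Suc i))"] r_def by (simp add: power_mult_distrib algebra_simps)
  ultimately show ?thesis by simp
qed

lemma stair_cong: "stair n = (\<Prod>j=1..m. Xv j ^ (n - j))" if "n \<le> Suc m"
  unfolding stair_def by (rule prod.mono_neutral_left) (use that in auto)

text \<open>Applying the divided differences for 1, 2, ..., n in this order lowers the exponents of
  t_1, ..., t_n by one each. This is the stability of Schubert polynomials under the inclusion of
  S_n in S_{n+1}.\<close>

lemma dword_stair: "dword (rev [1..<Suc n]) (stair (Suc n)) = stair n"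
proof -
  \<comment> \<open>The exponents after m steps: the first m variables are already lowered. Each
    step then meets a variable whose exponent exceeds the next one by exactly one.\<close>
  define e where "e m j = (if j \<le> m then n - j else Suc n - j)" for m j
  have "dword (rev [1..<Suc m]) (stair (Suc n)) = (\<Prod>j=1..Suc n. Xv j ^ e m j)" if "m \<le> n" for m
    using that
  proof (induction m)
    case 0
    have "stair (Suc n) = (\<Prod>j=1..Suc n. Xv j ^ (Suc n - j))" by (rule stair_cong) simp
    also have "\<dots> = (\<Prod>j=1..Suc n. Xv j ^ e 0 j)" by (rule prod.cong) (auto simp: e_def)
    finally show ?case by simp
  next
    case (Suc m)
    have "dword (rev [1..<Suc (Suc m)]) (stair (Suc n)) = ddiff (Suc m) (dword (rev [1..<Suc m]) (stair (Suc n)))"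
      by simp
    also have "\<dots> = ddiff (Suc m) (\<Prod>j=1..Suc n. Xv j ^ e m j)" using Suc by simp
    also have "\<dots> = (\<Prod>j=1..Suc n. Xv j ^ ((e m)(Suc m := e m (Suc (Suc m)))) j)"
      by (rule ddiff_monomial) (use Suc.prems in \<open>auto simp: e_def\<close>)
    also have "\<dots> = (\<Prod>j=1..Suc n. Xv j ^ e (Suc m) j)"
      by (rule prod.cong) (auto simp: e_def)
    finally show ?case .
  qed
  from this[of n] have "dword (rev [1..<Suc n]) (stair (Suc n)) = (\<Prod>j=1..Suc n. Xv j ^ e n j)" by simp
  also have "\<dots> = (\<Prod>j=1..Suc n. Xv j ^ (n - j))" by (rule prod.cong) (auto simp: e_def)
  also have "\<dots> = stair n" by (rule stair_cong[symmetric]) simp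
  finally show ?thesis .
qed

lemma wlong_Suc: "wlong (Suc n) = wlong n \<circ> wordprod (rev [1..<Suc n])"
proof -
  have cyc: "wordprod (rev [1..<Suc m]) x = (if x = 1 then int m + 1 else if 2 \<le> x \<and> x \<le> int m + 1 then x - 1 else x)"
    if "1 \<le> x" for m x
  proof (induction m)
    case (Suc m)
    have "wordprod (rev [1..<Suc (Suc m)]) x = sgen (Suc m) (wordprod (rev [1..<Suc m]) x)" by simp
    then show ?case unfolding Suc using that by (simp add: sgen_apply)
  qed (use that in simp)
  have pos: "wlong (Suc n) x = (wlong n \<circ> wordprod (rev [1..<Suc n])) x" if "1 \<le> x" for x
    using cyc[OF that, of n] that by (simp add: wlong_def del: upt_Suc)
  have W: "wlong n \<circ> wordprod (rev [1..<Suc n]) \<in> Winf" by simp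
  show ?thesis
  proof
    fix x :: int
    consider "1 \<le> x" | "x = 0" | "1 \<le> - x" by linarith
    then show "wlong (Suc n) x = (wlong n \<circ> wordprod (rev [1..<Suc n])) x"
    proof cases
      case 3
      then show ?thesis using pos[OF 3] Winf_minus[OF W, of x] Winf_minus[OF wlong_Winf, of "Suc n" x] by (simp del: upt_Suc)
    qed (use pos Winf_zero[OF W] Winf_zero[OF wlong_Winf] in \<open>simp_all del: upt_Suc\<close>)
  qed
qed

text \<open>A length-additive path from u up to the longest element of S_n. Read downwards it is a
  chain of the defining recursion, with result \<open>dword ws (stair n)\<close>.\<close>

definition sch_word :: "(int \<Rightarrow> int) \<Rightarrow> nat \<Rightarrow> nat list \<Rightarrow> bool" where
  "sch_word u n ws \<longleftrightarrow> set ws \<subseteq> {1..} \<and> u \<circ> wordprod ws = wlong n \<and> wlen (wlong n) = wlen u + length ws"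

lemma sch_word_reduced:
  assumes "u \<in> Winf" "sch_word u n ws"
  shows "reduced ws" "wordprod ws = inv u \<circ> wlong n"
proof -
  have "wlen (wlong n) \<le> wlen u + wlen (wordprod ws)"
    using assms wlen_comp_le[of u "wordprod ws"] by (simp add: sch_word_def)
  then show "reduced ws" using assms wlen_wordprod_le[of ws] by (simp add: sch_word_def reduced_def)
  have "inv u \<circ> (u \<circ> wordprod ws) = wordprod ws" using assms(1) by (simp add: comp_assoc[symmetric])
  then show "wordprod ws = inv u \<circ> wlong n" using assms(2) by (simp add: sch_word_def)
qed

lemma sch_word_lift:
  assumes "sch_word u n ws"
  shows "\<exists>vs. sch_word u (n + d) vs \<and> dword vs (stair (n + d)) = dword ws (stair n)"
proof (induction d)
  case 0 then show ?case using assms by auto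
next
  case (Suc d)
  then obtain vs where vs: "sch_word u (n + d) vs" "dword vs (stair (n + d)) = dword ws (stair n)" by blast
  let ?zs = "rev [1..<Suc (n + d)]"
  have "u \<circ> wordprod (vs @ ?zs) = wlong (Suc (n + d))"
    using vs(1) unfolding wlong_Suc by (simp add: sch_word_def wordprod_append comp_assoc[symmetric] del: upt_Suc)
  then have "sch_word u (n + Suc d) (vs @ ?zs)"
    using vs(1) wlen_wlong_Suc[of "n + d"] unfolding sch_word_def by (auto simp del: upt_Suc)
  moreover have "dword (vs @ ?zs) (stair (n + Suc d)) = dword ws (stair n)"
    using vs(2) dword_stair[of "n + d"] by (simp del: upt_Suc)
  ultimately show ?case by blast
qed

text \<open>Both paths are lifted to the common group S_{m+n}. There their words are reduced words
  of the same element, and \<open>dword_eq\<close> applies.\<close>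

lemma sch_word_unique:
  assumes "u \<in> Winf" "sch_word u m ws" "sch_word u n vs"
  shows "dword ws (stair m) = dword vs (stair n)"
proof -
  obtain xs where xs: "sch_word u (m + n) xs" "dword xs (stair (m + n)) = dword ws (stair m)"
    using sch_word_lift[OF assms(2), of n] by blast
  obtain ys where ys: "sch_word u (n + m) ys" "dword ys (stair (n + m)) = dword vs (stair n)"
    using sch_word_lift[OF assms(3), of m] by blast
  have "dword xs (stair (m + n)) = dword ys (stair (m + n))"
    using sch_word_reduced[OF assms(1) xs(1)] sch_word_reduced[OF assms(1) ys(1)]
    by (intro dword_eq) (simp_all add: add.commute)
  then show ?thesis using xs ys by (simp add: add.commute)
qed

text \<open>Every derivation, whatever its n and its order of descents, is recorded by a word.
  Uniqueness of the Schubert polynomial thereby becomes independence of that word.\<close>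

lemma is_schubert_sch_word:
  "is_schubert u f \<Longrightarrow> u \<in> Sinf \<and> (\<exists>n ws. sch_word u n ws \<and> f = dword ws (stair n))"
proof (induction rule: is_schubert.induct)
  case (longest n w)
  then have "w = wlong n" using longest_unique by blast
  then show ?case by (auto simp: sch_word_def stair_def intro!: exI[of _ n] exI[of _ "[]"])
next
  case (divdiff u f i g)
  then obtain n ws where nw: "sch_word u n ws" "f = dword ws (stair n)" by blast
  have "ddiff i f = g" using divdiff by (intro ddiff_eqI) (simp_all add: tswap_eq)
  moreover have "sch_word (u \<circ> sgen i) n (i # ws)"
    using nw(1) divdiff.hyps by (simp add: sch_word_def comp_assoc)
  ultimately show "u \<circ> sgen i \<in> Sinf \<and> (\<exists>n ws. sch_word (u \<circ> sgen i) n ws \<and> g = dword ws (stair n))"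
    using nw(2) divdiff by (intro conjI Sinf_comp_sgen exI[of _ n] exI[of _ "i # ws"]) auto
qed

lemma is_schubert_unique: "is_schubert u f \<Longrightarrow> is_schubert u g \<Longrightarrow> f = g"
  using is_schubert_sch_word sch_word_unique Sinf_Winf by metis

lemma is_schubert_wlong: "1 \<le> n \<Longrightarrow> is_schubert (wlong n) (stair n)"
  unfolding stair_def by (rule is_schubert.longest) (use Sn_longest in auto)

lemma is_schubert_ddiff:
  assumes "is_schubert u f" "1 \<le> i" "u (int i + 1) < u (int i)"
  shows "is_schubert (u \<circ> sgen i) (ddiff i f)"
proof (rule is_schubert.divdiff[OF assms(1,2)])
  have "u \<in> Winf" using is_schubert_sch_word[OF assms(1)] Sinf_Winf by blast
  then show "wlen u = wlen (u \<circ> sgen i) + 1" using wlen_desc assms(3) by simp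
  show "ddiff i f * (Xv i - Xv (Suc i)) = f - tswap i f" using ddiff assms(2) by (simp add: tswap_eq)
qed

lemma ex_is_schubert: "u \<in> Sinf \<Longrightarrow> \<exists>f. is_schubert u f"
proof -
  assume "u \<in> Sinf"
  then obtain n where n: "1 \<le> n" "u \<in> Sn n" by (rule Sinf_Sn)
  obtain ws where ws: "set ws \<subseteq> {1..<n}" "u \<circ> wordprod ws = wlong n" "wlen (wlong n) = wlen u + length ws"
    using climb[OF n(2)] by blast
  have "set ws \<subseteq> {1..}" using ws(1) by auto
  from ws(2,3) this \<open>u \<in> Sinf\<close> show ?thesis
  proof (induction ws arbitrary: u)
    case Nil
    then show ?case using is_schubert_wlong[OF n(1)] by auto
  next
    case (Cons i ws)
    let ?v = "u \<circ> sgen i"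
    have i: "1 \<le> i" using Cons.prems by simp
    have W: "u \<in> Winf" "?v \<in> Winf" using Cons.prems Sinf_Winf by auto
    have "u \<circ> wordprod (i # ws) = wlong n" by (rule Cons.prems(1))
    then have e: "?v \<circ> wordprod ws = wlong n" by (simp only: wordprod_Cons comp_assoc)
    have "wlen (wlong n) \<le> wlen ?v + length ws"
      using wlen_comp_le[OF W(2) wordprod_Winf[of ws]] wlen_wordprod_le[of ws] unfolding e by simp
    then have "wlen u < wlen ?v" using Cons.prems(2) by simp
    then have "\<not> u (int i + 1) < u (int i)" using wlen_desc[OF W(1), of i] by auto
    then have asc: "u (int i) < u (int i + 1)" using Winf_inj[OF W(1), of "int i" "int i + 1"] by simp
    then have l: "wlen ?v = Suc (wlen u)" by (rule wlen_asc[OF W(1)])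
    have "wlen (wlong n) = wlen ?v + length ws" using Cons.prems(2) l by simp
    moreover have "set ws \<subseteq> {1..}" using Cons.prems(3) by simp
    ultimately obtain f where f: "is_schubert ?v f"
      using Cons.IH[OF e _ _ Sinf_comp_sgen[OF Cons.prems(4) i]] by blast
    have "?v (int i + 1) < ?v (int i)" using asc i by (simp add: sgen_apply)
    from is_schubert_ddiff[OF f i this] have "is_schubert u (ddiff i f)" by (simp only: sgen_comp_sgen)
    then show ?case by blast
  qed
qed

lemma is_schubert_schubert: "u \<in> Sinf \<Longrightarrow> is_schubert u (schubert u)"
  unfolding schubert_def using ex_is_schubert is_schubert_unique by (metis theI')

lemma ddiff_schubert_desc:
  assumes "u \<in> Sinf" "1 \<le> i" "u (int i + 1) < u (int i)"
  shows "ddiff i (schubert u) = schubert (u \<circ> sgen i)"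
  using is_schubert_ddiff[OF is_schubert_schubert[OF assms(1)] assms(2,3)]
    is_schubert_schubert[OF Sinf_comp_sgen[OF assms(1,2)]] is_schubert_unique by blast

text \<open>At an ascent the Schubert polynomial of u is itself a divided difference for the same i,
  and divided differences square to zero.\<close>

lemma ddiff_schubert_asc:
  assumes "u \<in> Sinf" "1 \<le> i" "u (int i) < u (int i + 1)"
  shows "ddiff i (schubert u) = 0"
proof -
  let ?v = "u \<circ> sgen i"
  have "ddiff i (schubert ?v) = schubert (?v \<circ> sgen i)"
    by (rule ddiff_schubert_desc) (use assms in \<open>simp_all add: Sinf_comp_sgen sgen_apply\<close>)
  then have "schubert u = ddiff i (schubert ?v)" by simp
  then show ?thesis using ddiff_ddiff[OF assms(2)] by simp
qed

lemma schubert_id: "schubert id = 1"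
proof -
  have "is_schubert id (stair 1)" using is_schubert_wlong[of 1] wlong_0 by simp
  then have "schubert id = stair 1"
    using is_schubert_schubert[of id] is_schubert_unique is_schubert_sch_word by blast
  then show ?thesis by (simp add: stair_def)
qed

text \<open>Homogeneity in the form \<open>f(2t) = 2\<^sup>d f(t)\<close>, which suffices for the constant term to vanish.\<close>

lemma scale_stair: "peval (stair n) (\<lambda>i. 2 * Xv i) = 2 ^ wlen (wlong n) * stair n"
proof (induction n)
  case 0
  have "stair 0 = 1" "wlen (wlong 0) = 0" by (simp_all add: stair_def wlong_0(1))
  then show "peval (stair 0) (\<lambda>i. 2 * Xv i) = 2 ^ wlen (wlong 0) * stair 0"
    using rhom_1[OF rhom_peval] by simp
next
  case (Suc n)
  have st: "stair (Suc n) = stair n * (\<Prod>j=1..n. Xv j)"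
  proof -
    have "stair (Suc n) = (\<Prod>j=1..n. Xv j ^ (Suc n - j))" by (rule stair_cong) simp
    also have "\<dots> = (\<Prod>j=1..n. Xv j ^ (n - j) * Xv j)"
      by (rule prod.cong) (auto simp: Suc_diff_le mult.commute)
    also have "\<dots> = (\<Prod>j=1..n. Xv j ^ (n - j)) * (\<Prod>j=1..n. Xv j)" by (rule prod.distrib)
    also have "(\<Prod>j=1..n. Xv j ^ (n - j)) = stair n" by (rule stair_cong[symmetric]) simp
    finally show ?thesis .
  qed
  have "peval (\<Prod>j=1..n. Xv j) (\<lambda>i. 2 * Xv i :: Zt) = (\<Prod>j=1..n. 2 * Xv j)"
    unfolding rhom_prod[OF rhom_peval] by (rule prod.cong) (auto simp: peval_Xv)
  also have "\<dots> = 2 ^ n * (\<Prod>j=1..n. Xv j)" by (simp add: prod.distrib)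
  finally show ?case using Suc by (simp add: st peval_mult wlen_wlong_Suc power_add algebra_simps)
qed

lemma scale_vswap: "1 \<le> i \<Longrightarrow> peval (vswap i f) (\<lambda>j. 2 * Xv j) = vswap i (peval f (\<lambda>j. 2 * Xv j :: Zt))"
proof -
  assume i: "1 \<le> i"
  have two: "vswap i (2::Zt) = 2" using rhom_of_nat[OF rhom_vswap, of i 2] by simp
  have "peval (vswap i f) (\<lambda>j. 2 * Xv j) = peval f (\<lambda>j. peval (vswap i (Xv j)) (\<lambda>j. 2 * Xv j :: Zt))"
    by (rule rhom_eq_peval[of "\<lambda>f. peval (vswap i f) (\<lambda>j. 2 * Xv j)"]) (rule rhom_comp[OF rhom_peval rhom_vswap])
  also have "\<dots> = peval f (\<lambda>j. vswap i (2 * Xv j))"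
  proof (rule peval_cong)
    fix j :: nat assume j: "1 \<le> j"
    have "1 \<le> transpose i (Suc i) j" using i j by (auto simp: transpose_def)
    then show "peval (vswap i (Xv j)) (\<lambda>j. 2 * Xv j) = vswap i (2 * Xv j :: Zt)"
      using i j by (simp add: vswap_Xv peval_Xv vswap_mult two)
  qed
  also have "\<dots> = vswap i (peval f (\<lambda>j. 2 * Xv j))" by (rule rhom_peval_apply[OF rhom_vswap, symmetric])
  finally show ?thesis .
qed

lemma scale_is_schubert: "is_schubert u f \<Longrightarrow> peval f (\<lambda>i. 2 * Xv i) = 2 ^ wlen u * f"
proof (induction rule: is_schubert.induct)
  case (longest n w)
  then have "w = wlong n" using longest_unique by blast
  then show ?case using scale_stair[of n] by (simp add: stair_def)
next
  case (divdiff u f i g)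
  let ?sc = "\<lambda>f. peval f (\<lambda>j. 2 * Xv j :: Zt)" and ?d = "Xv i - Xv (Suc i) :: Zt"
  have two: "vswap i (2::Zt) = 2" using rhom_of_nat[OF rhom_vswap, of i 2] by simp
  have g: "g * ?d = f - vswap i f" using divdiff by (simp add: tswap_eq)
  have "?sc g * (2 * ?d) = ?sc (g * ?d)"
    using divdiff.hyps(2) by (simp add: peval_mult rhom_diff[OF rhom_peval] peval_Xv right_diff_distrib)
  also have "\<dots> = 2 ^ wlen u * f - vswap i (2 ^ wlen u * f)"
    using divdiff.hyps(2) by (simp add: g rhom_diff[OF rhom_peval] scale_vswap divdiff.IH)
  also have "\<dots> = 2 ^ wlen u * (f - vswap i f)"
    by (simp add: vswap_mult rhom_power[OF rhom_vswap] two right_diff_distrib)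
  also have "\<dots> = 2 ^ wlen u * (g * ?d)" by (simp only: g)
  also have "\<dots> = 2 ^ wlen (u \<circ> sgen i) * g * (2 * ?d)"
    unfolding divdiff.hyps(3) by (simp add: algebra_simps)
  finally show "?sc g = 2 ^ wlen (u \<circ> sgen i) * g"
    using Xv_diff_neq0[of i "Suc i"] divdiff.hyps(2) by simp
qed

lemma lookup_schubert_0:
  assumes "u \<in> Sinf" "u \<noteq> id"
  shows "Poly_Mapping.lookup (schubert u) 0 = 0"
proof -
  let ?f = "schubert u"
  have W: "u \<in> Winf" using assms Sinf_Winf by blast
  have "peval (peval ?f (\<lambda>i. 2 * Xv i :: Zt)) (\<lambda>_. 0::int) = peval ?f (\<lambda>i. peval (2 * Xv i) (\<lambda>_. 0))"
    by (rule rhom_peval_apply[OF rhom_peval])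
  also have "\<dots> = peval ?f (\<lambda>_. 0)" by (rule peval_cong) (simp add: peval_mult peval_Xv)
  finally have "peval (2 ^ wlen u * ?f) (\<lambda>_. 0::int) = peval ?f (\<lambda>_. 0)"
    using scale_is_schubert[OF is_schubert_schubert[OF assms(1)]] by simp
  then have "2 ^ wlen u * peval ?f (\<lambda>_. 0::int) = peval ?f (\<lambda>_. 0)"
    using rhom_of_nat[OF rhom_peval, of 2 "\<lambda>_. 0::int"] by (simp add: peval_mult rhom_power[OF rhom_peval])
  then have "2 ^ wlen u * Poly_Mapping.lookup ?f 0 = Poly_Mapping.lookup ?f 0" by (simp add: peval_zero)
  moreover have "(2::int) ^ wlen u \<noteq> 1" using assms(2) wlen_eq_0_iff[OF W] by simp
  ultimately show ?thesis by simp
qed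

section \<open>Raising operators\<close>

text \<open>Raising operators act on functions of integer sequences. A power series in \<open>R\<^sub>p\<close> may be
  applied to functions that vanish as soon as some tail sum of their argument is negative:
  unlike nonnegativity of the entries, this condition is preserved by raising operators.\<close>

definition shift :: "nat \<times> nat \<Rightarrow> nat \<Rightarrow> (nat \<Rightarrow> int) \<Rightarrow> nat \<Rightarrow> int" where
  "shift p s \<alpha> i = \<alpha> i + int s * (of_bool (fst p = i) - of_bool (snd p = i))"

definition tail :: "nat \<Rightarrow> nat \<Rightarrow> (nat \<Rightarrow> int) \<Rightarrow> int" where
  "tail L m \<alpha> = (\<Sum>i=m..L. \<alpha> i)"

definition vanishing :: "nat set \<Rightarrow> nat \<Rightarrow> ((nat \<Rightarrow> int) \<Rightarrow> 'a::zero) \<Rightarrow> bool" where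
  "vanishing M L F \<longleftrightarrow> (\<forall>\<alpha>. (\<exists>m\<in>M. tail L m \<alpha> < 0) \<longrightarrow> F \<alpha> = 0)"

text \<open>The power series \<phi> in the operator R_p, applied to F. \<open>Sum_any\<close>
  returns 0 for infinite support, so the algebraic laws are proved only where
  \<open>vanishing\<close> and \<open>rpairs\<close> force finiteness.\<close>

definition rop :: "nat \<times> nat \<Rightarrow> int fps \<Rightarrow> ((nat \<Rightarrow> int) \<Rightarrow> 'a::comm_ring_1) \<Rightarrow> (nat \<Rightarrow> int) \<Rightarrow> 'a" where
  "rop p \<phi> F \<alpha> = Sum_any (\<lambda>s. of_int (fps_nth \<phi> s) * F (shift p s \<alpha>))"

text \<open>R_{ab} lowers exactly the tails that start in a+1, ..., b. The pairs listed lower some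
  tail under control, so their series terminate on functions vanishing for M. The set M is a
  parameter because the exchange of entries j and j+1 does not respect the tail starting at
  j+1.\<close>

definition rpairs :: "nat set \<Rightarrow> nat \<Rightarrow> (nat \<times> nat) set" where
  "rpairs M L = {(a, b). 1 \<le> a \<and> a < b \<and> b \<le> L \<and> (\<exists>m\<in>M. a < m \<and> m \<le> b)}"

lemma shift_0 [simp]: "shift p 0 \<alpha> = \<alpha>"
  by (simp add: shift_def fun_eq_iff)

lemma shift_shift: "shift p s (shift p r \<alpha>) = shift p (s + r) \<alpha>"
  by (simp add: shift_def fun_eq_iff algebra_simps)

lemma shift_commute: "shift p s (shift q r \<alpha>) = shift q r (shift p s \<alpha>)"
  by (simp add: shift_def fun_eq_iff)

lemma tail_shift:
  assumes "a < b" "b \<le> L"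
  shows "tail L m (shift (a, b) s \<alpha>) = tail L m \<alpha> - (if a < m \<and> m \<le> b then int s else 0)"
proof -
  have "tail L m (shift (a, b) s \<alpha>) = tail L m \<alpha> + int s * ((\<Sum>i=m..L. of_bool (a = i)) - (\<Sum>i=m..L. of_bool (b = i)))"
    by (simp add: tail_def shift_def sum.distrib sum_subtractf sum_distrib_left right_diff_distrib)
  also have "(\<Sum>i=m..L. of_bool (a = i)) = (of_bool (m \<le> a) :: int)"
    using assms by (simp add: of_bool_def)
  also have "(\<Sum>i=m..L. of_bool (b = i)) = (of_bool (m \<le> b) :: int)"
    using assms by (simp add: of_bool_def)
  finally show ?thesis using assms by auto
qed

lemma tail_shift_le: "a < b \<Longrightarrow> b \<le> L \<Longrightarrow> tail L m (shift (a, b) s \<alpha>) \<le> tail L m \<alpha>"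
  by (simp add: tail_shift)

lemma vanishingD: "vanishing M L F \<Longrightarrow> m \<in> M \<Longrightarrow> tail L m \<alpha> < 0 \<Longrightarrow> F \<alpha> = 0"
  by (auto simp: vanishing_def)

lemma vanishing_subset: "vanishing M L F \<Longrightarrow> N \<subseteq> M \<Longrightarrow> vanishing N L F"
  by (auto simp: vanishing_def)

lemma rop_eq_sum:
  assumes F: "vanishing M L F" and m: "m \<in> M" "a < m" "m \<le> b" "b \<le> L" and S: "tail L m \<alpha> \<le> int S"
  shows "rop (a, b) \<phi> F \<alpha> = (\<Sum>s\<le>S. of_int (fps_nth \<phi> s) * F (shift (a, b) s \<alpha>))"
  unfolding rop_def
proof (rule Sum_any.expand_superset)
  show "{s. of_int (fps_nth \<phi> s) * F (shift (a, b) s \<alpha>) \<noteq> 0} \<subseteq> {..S}"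
  proof (clarsimp, rule ccontr)
    fix s assume h: "of_int (fps_nth \<phi> s) * F (shift (a, b) s \<alpha>) \<noteq> 0" "\<not> s \<le> S"
    have "tail L m (shift (a, b) s \<alpha>) < 0" using tail_shift[of a b L m s \<alpha>] m S h(2) by simp
    then show False using vanishingD[OF F m(1)] h(1) by simp
  qed
qed simp

lemma rpairsE:
  assumes "p \<in> rpairs M L"
  obtains a b m where "p = (a, b)" "1 \<le> a" "a < b" "b \<le> L" "m \<in> M" "a < m" "m \<le> b"
  using assms by (auto simp: rpairs_def)

lemma vanishing_rop:
  assumes F: "vanishing M L F" and p: "fst p < snd p" "snd p \<le> L"
  shows "vanishing M L (rop p \<phi> F)"
  unfolding vanishing_def
proof (intro allI impI)
  fix \<alpha> assume "\<exists>m\<in>M. tail L m \<alpha> < 0"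
  then obtain m where m: "m \<in> M" "tail L m \<alpha> < 0" by blast
  have "F (shift p s \<alpha>) = 0" for s
    using tail_shift_le[OF p, of m s \<alpha>] m by (intro vanishingD[OF F m(1)]) simp
  then show "rop p \<phi> F \<alpha> = 0" by (simp add: rop_def)
qed

text \<open>Both orders are cut off by the same two bounds, since no raising operator increases a
  tail; the rest is an exchange of finite sums.\<close>

lemma rop_commute:
  assumes F: "vanishing M L F" and p: "p \<in> rpairs M L" and q: "q \<in> rpairs M L"
  shows "rop p \<phi> (rop q \<psi> F) = rop q \<psi> (rop p \<phi> F)"
proof
  fix \<alpha>
  obtain a b m where pa: "p = (a, b)" and pm: "a < b" "m \<in> M" "a < m" "m \<le> b" "b \<le> L" using p by (rule rpairsE)
  obtain c d n where qa: "q = (c, d)" and qm: "c < d" "n \<in> M" "c < n" "n \<le> d" "d \<le> L" using q by (rule rpairsE)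
  define S where "S = nat (tail L m \<alpha>)"
  define R where "R = nat (tail L n \<alpha>)"
  have 1: "rop p \<phi> (rop q \<psi> F) \<alpha> = (\<Sum>s\<le>S. of_int (fps_nth \<phi> s) * (\<Sum>r\<le>R. of_int (fps_nth \<psi> r) * F (shift q r (shift p s \<alpha>))))"
  proof -
    have "rop q \<psi> F (shift p s \<alpha>) = (\<Sum>r\<le>R. of_int (fps_nth \<psi> r) * F (shift q r (shift p s \<alpha>)))" for s
      unfolding qa by (rule rop_eq_sum[OF F qm(2-)]) (use tail_shift_le[OF pm(1,5), of n s \<alpha>] in \<open>simp add: pa R_def\<close>)
    moreover have "vanishing M L (rop q \<psi> F)" by (rule vanishing_rop[OF F]) (use qm qa in auto)
    then have "rop p \<phi> (rop q \<psi> F) \<alpha> = (\<Sum>s\<le>S. of_int (fps_nth \<phi> s) * rop q \<psi> F (shift p s \<alpha>))"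
      unfolding pa by (rule rop_eq_sum[OF _ pm(2-)]) (simp add: S_def)
    ultimately show ?thesis by simp
  qed
  have 2: "rop q \<psi> (rop p \<phi> F) \<alpha> = (\<Sum>r\<le>R. of_int (fps_nth \<psi> r) * (\<Sum>s\<le>S. of_int (fps_nth \<phi> s) * F (shift p s (shift q r \<alpha>))))"
  proof -
    have "rop p \<phi> F (shift q r \<alpha>) = (\<Sum>s\<le>S. of_int (fps_nth \<phi> s) * F (shift p s (shift q r \<alpha>)))" for r
      unfolding pa by (rule rop_eq_sum[OF F pm(2-)]) (use tail_shift_le[OF qm(1,5), of m r \<alpha>] in \<open>simp add: qa S_def\<close>)
    moreover have "vanishing M L (rop p \<phi> F)" by (rule vanishing_rop[OF F]) (use pm pa in auto)
    then have "rop q \<psi> (rop p \<phi> F) \<alpha> = (\<Sum>r\<le>R. of_int (fps_nth \<psi> r) * rop p \<phi> F (shift q r \<alpha>))"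
      unfolding qa by (rule rop_eq_sum[OF _ qm(2-)]) (simp add: R_def)
    ultimately show ?thesis by simp
  qed
  have "rop p \<phi> (rop q \<psi> F) \<alpha> = (\<Sum>s\<le>S. \<Sum>r\<le>R. of_int (fps_nth \<phi> s) * of_int (fps_nth \<psi> r) * F (shift q r (shift p s \<alpha>)))"
    unfolding 1 by (simp add: sum_distrib_left mult.assoc)
  also have "\<dots> = (\<Sum>r\<le>R. \<Sum>s\<le>S. of_int (fps_nth \<phi> s) * of_int (fps_nth \<psi> r) * F (shift q r (shift p s \<alpha>)))"
    by (rule sum.swap)
  also have "\<dots> = rop q \<psi> (rop p \<phi> F) \<alpha>"
    unfolding 2 by (simp add: sum_distrib_left mult.assoc mult.left_commute shift_commute[of p])
  finally show "rop p \<phi> (rop q \<psi> F) \<alpha> = rop q \<psi> (rop p \<phi> F) \<alpha>" .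
qed

text \<open>Composition is the Cauchy product: beyond total exponent S the tail is negative, so the
  square of summation may be reduced to a triangle.\<close>

lemma rop_rop:
  assumes F: "vanishing M L F" and p: "p \<in> rpairs M L"
  shows "rop p \<phi> (rop p \<psi> F) = rop p (\<phi> * \<psi>) F"
proof
  fix \<alpha>
  obtain a b m where pa: "p = (a, b)" and pm: "a < b" "m \<in> M" "a < m" "m \<le> b" "b \<le> L" using p by (rule rpairsE)
  define S where "S = nat (tail L m \<alpha>)"
  let ?f = "\<lambda>s r. of_int (fps_nth \<phi> s) * of_int (fps_nth \<psi> r) * F (shift p (s + r) \<alpha>)"
  have z: "F (shift p n \<alpha>) = 0" if "S < n" for n
  proof (rule vanishingD[OF F pm(2)])
    show "tail L m (shift p n \<alpha>) < 0" using tail_shift[OF pm(1,5), of m n \<alpha>] pm that by (simp add: pa S_def)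
  qed
  have "rop p \<phi> (rop p \<psi> F) \<alpha> = (\<Sum>s\<le>S. of_int (fps_nth \<phi> s) * rop p \<psi> F (shift p s \<alpha>))"
    unfolding pa by (rule rop_eq_sum[OF vanishing_rop[OF F] pm(2-)]) (use pm in \<open>simp_all add: S_def\<close>)
  also have "\<dots> = (\<Sum>s\<le>S. of_int (fps_nth \<phi> s) * (\<Sum>r\<le>S. of_int (fps_nth \<psi> r) * F (shift p r (shift p s \<alpha>))))"
  proof (rule sum.cong[OF refl])
    fix s
    have "rop p \<psi> F (shift p s \<alpha>) = (\<Sum>r\<le>S. of_int (fps_nth \<psi> r) * F (shift p r (shift p s \<alpha>)))"
      unfolding pa by (rule rop_eq_sum[OF F pm(2-)]) (use tail_shift_le[OF pm(1,5), of m s \<alpha>] in \<open>simp add: S_def\<close>)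
    then show "of_int (fps_nth \<phi> s) * rop p \<psi> F (shift p s \<alpha>) =
      of_int (fps_nth \<phi> s) * (\<Sum>r\<le>S. of_int (fps_nth \<psi> r) * F (shift p r (shift p s \<alpha>)))" by simp
  qed
  also have "\<dots> = (\<Sum>s\<le>S. \<Sum>r\<le>S. ?f s r)"
    by (simp add: sum_distrib_left mult.assoc shift_shift add.commute)
  also have "\<dots> = (\<Sum>(s, r)\<in>{..S} \<times> {..S}. ?f s r)" by (simp add: sum.cartesian_product)
  also have "\<dots> = (\<Sum>(s, r)\<in>{(s, r). s + r \<le> S}. ?f s r)"
  proof (rule sum.mono_neutral_right)
    show "\<forall>p\<in>{..S} \<times> {..S} - {(s, r). s + r \<le> S}. (case p of (s, r) \<Rightarrow> ?f s r) = 0"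
    proof (clarify, goal_cases)
      case (1 s r)
      then show ?case using z[of "s + r"] by (cases "S < s + r") auto
    qed
  qed auto
  also have "\<dots> = (\<Sum>n\<le>S. \<Sum>s\<le>n. ?f s (n - s))" by (rule sum.triangle_reindex_eq)
  also have "\<dots> = (\<Sum>n\<le>S. of_int (fps_nth (\<phi> * \<psi>) n) * F (shift p n \<alpha>))"
  proof (rule sum.cong[OF refl])
    fix n
    have "(\<Sum>s\<le>n. ?f s (n - s)) = (\<Sum>s\<le>n. of_int (fps_nth \<phi> s * fps_nth \<psi> (n - s)) * F (shift p n \<alpha>))"
      by (rule sum.cong) auto
    also have "\<dots> = of_int (fps_nth (\<phi> * \<psi>) n) * F (shift p n \<alpha>)"
      by (simp only: fps_mult_nth of_int_sum sum_distrib_right atMost_atLeast0)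
    finally show "(\<Sum>s\<le>n. ?f s (n - s)) = of_int (fps_nth (\<phi> * \<psi>) n) * F (shift p n \<alpha>)" .
  qed
  also have "\<dots> = rop p (\<phi> * \<psi>) F \<alpha>"
    unfolding pa by (rule rop_eq_sum[OF F pm(2-), symmetric]) (simp add: S_def)
  finally show "rop p \<phi> (rop p \<psi> F) \<alpha> = rop p (\<phi> * \<psi>) F \<alpha>" .
qed

lemma rop_one: "rop p 1 F = F"
proof
  fix \<alpha>
  have "rop p 1 F \<alpha> = (\<Sum>s\<in>{0}. of_int (fps_nth 1 s) * F (shift p s \<alpha>))"
    unfolding rop_def by (rule Sum_any.expand_superset) auto
  then show "rop p 1 F \<alpha> = F \<alpha>" by simp
qed

lemma rop_linear_poly: "rop p (fps_const u + fps_const v * fps_X) F \<alpha> = of_int u * F \<alpha> + of_int v * F (shift p 1 \<alpha>)"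
proof -
  have "rop p (fps_const u + fps_const v * fps_X) F \<alpha> =
      (\<Sum>s\<in>{0, 1}. of_int (fps_nth (fps_const u + fps_const v * fps_X) s) * F (shift p s \<alpha>))"
    unfolding rop_def by (rule Sum_any.expand_superset) (auto split: if_splits)
  then show ?thesis by simp
qed

lemma rop_rhom:
  assumes "vanishing M L F" "p \<in> rpairs M L" "rhom h"
  shows "h (rop p \<phi> F \<alpha>) = rop p \<phi> (\<lambda>\<alpha>. h (F \<alpha>)) \<alpha>"
proof -
  obtain a b m where pa: "p = (a, b)" and pm: "m \<in> M" "a < m" "m \<le> b" "b \<le> L" using assms(2) by (rule rpairsE)
  have hF: "vanishing M L (\<lambda>\<alpha>. h (F \<alpha>))" using assms(1) rhom_0[OF assms(3)] by (auto simp: vanishing_def)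
  have S: "tail L m \<alpha> \<le> int (nat (tail L m \<alpha>))" by simp
  show ?thesis
    unfolding pa rop_eq_sum[OF assms(1) pm S] rop_eq_sum[OF hF pm S]
    by (simp add: rhom_sum[OF assms(3)] rhom_mult[OF assms(3)] rhom_of_int[OF assms(3)])
qed

lemma vanishing_lincomb: "vanishing M L F \<Longrightarrow> vanishing M L G \<Longrightarrow> vanishing M L (\<lambda>\<alpha>. x * F \<alpha> + y * G \<alpha>)"
  for F :: "(nat \<Rightarrow> int) \<Rightarrow> 'a::comm_ring_1"
  by (auto simp: vanishing_def)

lemma rop_lincomb:
  assumes "vanishing M L F" "vanishing M L G" "p \<in> rpairs M L"
  shows "rop p \<phi> (\<lambda>\<alpha>. x * F \<alpha> + y * G \<alpha>) \<alpha> = x * rop p \<phi> F \<alpha> + y * rop p \<phi> G \<alpha>"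
proof -
  obtain a b m where pa: "p = (a, b)" and pm: "m \<in> M" "a < m" "m \<le> b" "b \<le> L" using assms(3) by (rule rpairsE)
  have S: "tail L m \<alpha> \<le> int (nat (tail L m \<alpha>))" by simp
  show ?thesis
    unfolding pa rop_eq_sum[OF assms(1) pm S] rop_eq_sum[OF assms(2) pm S]
      rop_eq_sum[OF vanishing_lincomb[OF assms(1,2)] pm S]
    by (simp add: sum_distrib_left sum.distrib algebra_simps)
qed

definition rops :: "(nat \<times> nat \<Rightarrow> int fps) \<Rightarrow> (nat \<times> nat) list \<Rightarrow> ((nat \<Rightarrow> int) \<Rightarrow> 'a::comm_ring_1) \<Rightarrow> (nat \<Rightarrow> int) \<Rightarrow> 'a" where
  "rops \<phi> ps F = foldr (\<lambda>p. rop p (\<phi> p)) ps F"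

lemma rops_simps [simp]: "rops \<phi> [] F = F" "rops \<phi> (p # ps) F = rop p (\<phi> p) (rops \<phi> ps F)"
  "rops \<phi> (ps @ qs) F = rops \<phi> ps (rops \<phi> qs F)"
  by (simp_all add: rops_def)

lemma vanishing_rops:
  "vanishing M L F \<Longrightarrow> set ps \<subseteq> rpairs M L \<Longrightarrow> vanishing M L (rops \<phi> ps F)"
  by (induction ps) (auto intro!: vanishing_rop simp: rpairs_def)

lemma rops_front:
  assumes "vanishing M L F" "set ps \<subseteq> rpairs M L" "p \<in> set ps"
  shows "rops \<phi> ps F = rop p (\<phi> p) (rops \<phi> (remove1 p ps) F)"
  using assms(2,3)
proof (induction ps)
  case (Cons q ps)
  show ?case
  proof (cases "p = q")
    case False
    then have "rops \<phi> (q # ps) F = rop q (\<phi> q) (rop p (\<phi> p) (rops \<phi> (remove1 p ps) F))"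
      using Cons by simp
    also have "\<dots> = rop p (\<phi> p) (rop q (\<phi> q) (rops \<phi> (remove1 p ps) F))"
      by (rule rop_commute[OF vanishing_rops[OF assms(1)]])
        (use Cons.prems False set_remove1_subset[of p ps] in auto)
    finally show ?thesis using False by simp
  qed simp
qed simp

lemma rops_perm:
  assumes "vanishing M L F" "set ps \<subseteq> rpairs M L" "mset ps = mset qs"
  shows "rops \<phi> ps F = rops \<phi> qs F"
  using assms(2,3)
proof (induction ps arbitrary: qs)
  case (Cons p ps)
  have p: "p \<in> set qs" and set: "set qs \<subseteq> rpairs M L"
    using Cons.prems by (metis list.set_intros(1) mset_eq_setD, metis mset_eq_setD)
  have "mset ps = mset (remove1 p qs)" using Cons.prems(2) by (metis mset.simps(2) mset_remove1 add_mset_remove_trivial)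
  then have "rops \<phi> ps F = rops \<phi> (remove1 p qs) F" using Cons by simp
  then show ?case using rops_front[OF assms(1) set p, of \<phi>] by simp
qed simp

lemma rops_cong: "(\<And>p. p \<in> set ps \<Longrightarrow> \<phi> p = \<psi> p) \<Longrightarrow> rops \<phi> ps F = rops \<psi> ps F"
  by (induction ps) auto

lemma rops_rhom:
  assumes "vanishing M L F" "set ps \<subseteq> rpairs M L" "rhom h"
  shows "h (rops \<phi> ps F \<alpha>) = rops \<phi> ps (\<lambda>\<alpha>. h (F \<alpha>)) \<alpha>"
  using assms(2)
proof (induction ps arbitrary: \<alpha>)
  case (Cons p ps)
  have "h (rops \<phi> (p # ps) F \<alpha>) = rop p (\<phi> p) (\<lambda>\<alpha>. h (rops \<phi> ps F \<alpha>)) \<alpha>"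
    unfolding rops_simps by (rule rop_rhom[OF vanishing_rops[OF assms(1)]]) (use Cons.prems assms(3) in auto)
  then show ?case using Cons by simp
qed simp

lemma rops_lincomb:
  assumes "vanishing M L F" "vanishing M L G" "set ps \<subseteq> rpairs M L"
  shows "rops \<phi> ps (\<lambda>\<alpha>. x * F \<alpha> + y * G \<alpha>) = (\<lambda>\<alpha>. x * rops \<phi> ps F \<alpha> + y * rops \<phi> ps G \<alpha>)"
  using assms(3)
proof (induction ps)
  case (Cons p ps)
  then show ?case
    using rop_lincomb[OF vanishing_rops[OF assms(1)] vanishing_rops[OF assms(2)], of ps ps p]
    by auto
qed simp

lemma rop_translate: "rop p \<phi> (\<lambda>\<alpha>. F (\<lambda>i. \<alpha> i - \<delta> i)) \<alpha> = rop p \<phi> F (\<lambda>i. \<alpha> i - \<delta> i)"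
proof -
  have "shift p s (\<lambda>i. \<alpha> i - \<delta> i) = (\<lambda>i. shift p s \<alpha> i - \<delta> i)" for s by (auto simp: shift_def)
  then show ?thesis by (simp add: rop_def)
qed

lemma rops_translate: "rops \<phi> ps (\<lambda>\<alpha>. F (\<lambda>i. \<alpha> i - \<delta> i)) = (\<lambda>\<alpha>. rops \<phi> ps F (\<lambda>i. \<alpha> i - \<delta> i))"
proof (induction ps)
  case (Cons p ps)
  show ?case unfolding rops_simps Cons.IH by (rule ext) (rule rop_translate)
qed simp

text \<open>An operator already standing inside F is merged into the factor of its pair. This is the
  way in which 1 + R_{jl} cancels its inverse.\<close>

lemma rops_absorb:
  assumes F: "vanishing M L F" and ps: "set ps \<subseteq> rpairs M L" "distinct ps" and p: "p \<in> set ps"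
  shows "rops \<phi> ps (rop p \<psi> F) = rops (\<phi>(p := \<phi> p * \<psi>)) ps F"
proof -
  let ?qs = "remove1 p ps"
  have perm: "mset ps = mset (?qs @ [p])" using p by simp
  have pq: "p \<notin> set ?qs" using ps by simp
  have pr: "p \<in> rpairs M L" using p ps by blast
  have vG: "vanishing M L (rop p \<psi> F)" by (rule vanishing_rop[OF F]) (use pr in \<open>auto simp: rpairs_def\<close>)
  have pqs: "rops (\<phi>(p := \<phi> p * \<psi>)) ?qs G = rops \<phi> ?qs G" for G :: "(nat \<Rightarrow> int) \<Rightarrow> 'a"
    by (rule rops_cong) (use pq in auto)
  have "rops \<phi> ps (rop p \<psi> F) = rops \<phi> (?qs @ [p]) (rop p \<psi> F)"
    by (rule rops_perm[OF vG ps(1) perm])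
  also have "\<dots> = rops \<phi> ?qs (rop p (\<phi> p * \<psi>) F)" using rop_rop[OF F pr] by simp
  also have "\<dots> = rops (\<phi>(p := \<phi> p * \<psi>)) (?qs @ [p]) F"
    using pqs by simp
  also have "\<dots> = rops (\<phi>(p := \<phi> p * \<psi>)) ps F"
    by (rule rops_perm[OF F ps(1) perm, symmetric])
  finally show ?thesis .
qed

lemma rop_closed:
  assumes J: "0 \<in> J" "\<And>x y. x \<in> J \<Longrightarrow> y \<in> J \<Longrightarrow> x + y \<in> J" "\<And>n x. x \<in> J \<Longrightarrow> of_int n * x \<in> J"
    and F: "\<And>s. F (shift p s \<alpha>) \<in> J"
  shows "rop p \<phi> F \<alpha> \<in> J"
proof -
  \<comment> \<open>Infinite index sets are included: the sum over them is 0, which lies in J. Hence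
    no finiteness assumption appears.\<close>
  have "(\<Sum>s\<in>A. of_int (fps_nth \<phi> s) * F (shift p s \<alpha>)) \<in> J" for A
    by (induction A rule: infinite_finite_induct) (use J F in auto)
  then show ?thesis by (simp add: rop_def Sum_any.expand_set)
qed

lemma rops_closed:
  assumes J: "0 \<in> J" "\<And>x y. x \<in> J \<Longrightarrow> y \<in> J \<Longrightarrow> x + y \<in> J" "\<And>n x. x \<in> J \<Longrightarrow> of_int n * x \<in> J"
    and F: "\<And>\<alpha>. P \<alpha> \<Longrightarrow> F \<alpha> \<in> J" and P: "\<And>p s \<alpha>. p \<in> set ps \<Longrightarrow> P \<alpha> \<Longrightarrow> P (shift p s \<alpha>)" and \<alpha>: "P \<alpha>"
  shows "rops \<phi> ps F \<alpha> \<in> J"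
  using P \<alpha>
proof (induction ps arbitrary: \<alpha>)
  case (Cons p ps)
  show ?case unfolding rops_simps
    by (rule rop_closed[OF J]) (use Cons in auto)
qed (use F in simp)

text \<open>Conjugating R_p by the exchange of entries j and j+1. The pair (j, j+1) goes to (j+1,
  j), which is not a raising operator, and therefore gets separate treatment in the exchange
  arguments.\<close>

definition swap_pair :: "nat \<Rightarrow> nat \<times> nat \<Rightarrow> nat \<times> nat" where
  "swap_pair j p = (transpose j (Suc j) (fst p), transpose j (Suc j) (snd p))"

lemma shift_swap: "shift p s (\<alpha> \<circ> transpose j (Suc j)) = shift (swap_pair j p) s \<alpha> \<circ> transpose j (Suc j)"
proof -
  have eq: "transpose j (Suc j) x = transpose j (Suc j) y \<longleftrightarrow> x = y" for x y
    by (metis transpose_involutory)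
  show ?thesis by (rule ext) (simp add: shift_def swap_pair_def eq)
qed

lemma swap_pair_swap_pair [simp]: "swap_pair j (swap_pair j p) = p"
  by (simp add: swap_pair_def)

lemma rop_swap: "rop p \<phi> F (\<alpha> \<circ> transpose j (Suc j)) = rop (swap_pair j p) \<phi> (\<lambda>\<alpha>. F (\<alpha> \<circ> transpose j (Suc j))) \<alpha>"
  by (simp add: rop_def shift_swap)

lemma rops_swap: "rops \<phi> ps F (\<alpha> \<circ> transpose j (Suc j)) =
  rops (\<lambda>p. \<phi> (swap_pair j p)) (map (swap_pair j) ps) (\<lambda>\<alpha>. F (\<alpha> \<circ> transpose j (Suc j))) \<alpha>"
  by (induction ps arbitrary: \<alpha>) (simp_all add: rop_swap)

definition factor_prod :: "nat \<Rightarrow> (nat \<Rightarrow> 'a::comm_ring_1) \<Rightarrow> (nat \<Rightarrow> 'a) \<Rightarrow> (nat \<Rightarrow> int) \<Rightarrow> (nat \<Rightarrow> int) \<Rightarrow> 'a" where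
  "factor_prod L c t \<beta> \<alpha> = (\<Prod>i=1..L. cup c t (\<beta> i) (\<alpha> i))"

definition all_pairs :: "nat \<Rightarrow> (nat \<times> nat) list" where
  "all_pairs L = filter (\<lambda>(a, b). a < b) (List.product [1..<Suc L] [1..<Suc L])"

lemma set_all_pairs: "set (all_pairs L) = {(a, b). 1 \<le> a \<and> a < b \<and> b \<le> L}"
  by (auto simp: all_pairs_def simp del: upt_Suc)

lemma distinct_all_pairs: "distinct (all_pairs L)"
  unfolding all_pairs_def by (intro distinct_filter distinct_product) auto

lemma rpairs_all: "rpairs {1..L} L = {(a, b). 1 \<le> a \<and> a < b \<and> b \<le> L}"
  by (auto simp: rpairs_def)

lemma all_pairs_rpairs: "set (all_pairs L) \<subseteq> rpairs {1..L} L"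
  unfolding set_all_pairs rpairs_all by simp

lemma esym_0: "esym r 0 x = 1"
proof -
  have "{S. S \<subseteq> {1..r} \<and> card S = 0} = {{}}" by (auto dest: finite_subset)
  then show ?thesis by (simp add: esym_def)
qed

lemma hgen_0: "hgen r 0 x = 1"
  by (simp add: hgen_def esym_0 hsym_def)

lemma cup_neg: "p < 0 \<Longrightarrow> cup c t r p = 0"
  by (simp add: cup_def)

lemma cup_0: "cup c t r 0 = 1"
  by (simp add: cup_def hgen_0 cext_def)

lemma vanishing_factor_prod: "vanishing {1..L} L (factor_prod L c t \<beta>)"
  unfolding vanishing_def
proof (intro allI impI)
  fix \<alpha> assume "\<exists>m\<in>{1..L}. tail L m \<alpha> < 0"
  then obtain m where m: "1 \<le> m" "tail L m \<alpha> < 0" by auto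
  have "\<exists>i\<in>{m..L}. \<alpha> i < 0"
  proof (rule ccontr)
    assume "\<not> (\<exists>i\<in>{m..L}. \<alpha> i < 0)"
    then have "0 \<le> tail L m \<alpha>" unfolding tail_def by (intro sum_nonneg) (auto simp: not_less)
    then show False using m by simp
  qed
  then obtain i where i: "m \<le> i" "i \<le> L" "\<alpha> i < 0" by auto
  show "factor_prod L c t \<beta> \<alpha> = 0"
    unfolding factor_prod_def by (rule prod_zero) (use i m in \<open>auto intro!: bexI[of _ i] simp: cup_neg\<close>)
qed

section \<open>Theta polynomials as finite compositions of raising operators\<close>

definition box :: "(nat \<times> nat) list \<Rightarrow> nat \<Rightarrow> raising set" where
  "box ps B = {n. Poly_Mapping.keys n \<subseteq> set ps \<and> (\<forall>p. Poly_Mapping.lookup n p \<le> B)}"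

lemma raise_seq_superset:
  assumes "finite S" "Poly_Mapping.keys n \<subseteq> S"
  shows "raise_seq n \<alpha> i = \<alpha> i + (\<Sum>p\<in>S. int (Poly_Mapping.lookup n p) * (of_bool (fst p = i) - of_bool (snd p = i)))"
  unfolding raise_seq_def case_prod_beta' prod.collapse
  by (intro arg_cong2[of _ _ _ _ "(+)"] refl sum.mono_neutral_left[OF assms]) (auto simp: in_keys_iff)

lemma raise_seq_add_single: "raise_seq (n + Poly_Mapping.single p s) \<alpha> = raise_seq n (shift p s \<alpha>)"
proof
  fix i :: nat
  let ?S = "insert p (Poly_Mapping.keys n)"
  let ?e = "\<lambda>p. of_bool (fst p = i) - of_bool (snd p = i) :: int"
  have "Poly_Mapping.keys (n + Poly_Mapping.single p s) \<subseteq> ?S"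
    using keys_add[of n "Poly_Mapping.single p s"] by (auto split: if_splits)
  then have "raise_seq (n + Poly_Mapping.single p s) \<alpha> i =
    \<alpha> i + (\<Sum>q\<in>?S. int (Poly_Mapping.lookup (n + Poly_Mapping.single p s) q) * ?e q)"
    by (intro raise_seq_superset) auto
  also have "(\<Sum>q\<in>?S. int (Poly_Mapping.lookup (n + Poly_Mapping.single p s) q) * ?e q) =
    (\<Sum>q\<in>?S. int (Poly_Mapping.lookup n q) * ?e q) + (\<Sum>q\<in>?S. if q = p then int s * ?e q else 0)"
    unfolding sum.distrib[symmetric] by (rule sum.cong) (auto simp: lookup_add lookup_single when_def algebra_simps)
  also have "(\<Sum>q\<in>?S. if q = p then int s * ?e q else 0) = int s * ?e p"
    by (subst sum.delta) auto
  finally show "raise_seq (n + Poly_Mapping.single p s) \<alpha> i = raise_seq n (shift p s \<alpha>) i"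
    using raise_seq_superset[of ?S n "shift p s \<alpha>" i] by (simp add: shift_def subset_insertI)
qed

lemma box_Cons:
  assumes "p \<notin> set ps"
  shows "bij_betw (\<lambda>(s, n). n + Poly_Mapping.single p s) ({..B} \<times> box ps B) (box (p # ps) B)"
proof (rule bij_betwI[where g = "\<lambda>n. (Poly_Mapping.lookup n p, n - Poly_Mapping.single p (Poly_Mapping.lookup n p))"])
  have lp: "Poly_Mapping.lookup n p = 0" if "n \<in> box ps B" for n
    using that assms by (auto simp: box_def in_keys_iff)
  show "(\<lambda>(s, n). n + Poly_Mapping.single p s) \<in> {..B} \<times> box ps B \<rightarrow> box (p # ps) B"
  proof (clarsimp simp: Pi_iff)
    fix s n assume s: "s \<le> B" and n: "n \<in> box ps B"
    have "Poly_Mapping.keys (n + Poly_Mapping.single p s) \<subseteq> set (p # ps)"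
      using keys_add[of n "Poly_Mapping.single p s"] n by (auto simp: box_def split: if_splits)
    moreover have nB: "Poly_Mapping.lookup n q \<le> B" for q using n unfolding box_def by blast
    have "Poly_Mapping.lookup (n + Poly_Mapping.single p s) q \<le> B" for q
      using s nB[of q] lp[OF n] by (cases "q = p") (auto simp: lookup_add lookup_single)
    ultimately show "n + Poly_Mapping.single p s \<in> box (p # ps) B" by (simp only: box_def) blast
  qed
  show "(\<lambda>n. (Poly_Mapping.lookup n p, n - Poly_Mapping.single p (Poly_Mapping.lookup n p))) \<in> box (p # ps) B \<rightarrow> {..B} \<times> box ps B"
  proof (clarsimp simp: Pi_iff)
    fix n assume n: "n \<in> box (p # ps) B"
    let ?n = "n - Poly_Mapping.single p (Poly_Mapping.lookup n p)"
    have l: "Poly_Mapping.lookup ?n q = (if q = p then 0 else Poly_Mapping.lookup n q)" for q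
      by (simp add: lookup_minus lookup_single)
    have "q \<in> set ps" if "q \<in> Poly_Mapping.keys ?n" for q
    proof -
      have "q \<noteq> p" "q \<in> Poly_Mapping.keys n" using that l[of q] by (auto simp: in_keys_iff split: if_splits)
      then show ?thesis using n by (auto simp: box_def)
    qed
    moreover have nB: "Poly_Mapping.lookup n q \<le> B" for q using n unfolding box_def by blast
    have "Poly_Mapping.lookup ?n q \<le> B" for q using nB[of q] l[of q] by simp
    ultimately have "?n \<in> box ps B" unfolding box_def by blast
    then show "Poly_Mapping.lookup n p \<le> B \<and> ?n \<in> box ps B" using nB[of p] by blast
  qed
  fix x assume "x \<in> {..B} \<times> box ps B"
  then obtain s n where x: "x = (s, n)" "n \<in> box ps B" by auto
  show "(\<lambda>n. (Poly_Mapping.lookup n p, n - Poly_Mapping.single p (Poly_Mapping.lookup n p))) (case x of (s, n) \<Rightarrow> n + Poly_Mapping.single p s) = x"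
    using x lp[OF x(2)] by (simp add: lookup_add)
next
  fix n assume "n \<in> box (p # ps) B"
  show "(case (Poly_Mapping.lookup n p, n - Poly_Mapping.single p (Poly_Mapping.lookup n p)) of (s, n) \<Rightarrow> n + Poly_Mapping.single p s) = n"
    by (rule poly_mapping_eqI) (simp add: lookup_add lookup_minus lookup_single when_def)
qed

lemma box_Nil: "box [] B = {0}"
  by (auto simp: box_def)

lemma finite_box: "distinct ps \<Longrightarrow> finite (box ps B)"
proof (induction ps)
  case (Cons p ps)
  then have "p \<notin> set ps" by simp
  from bij_betw_finite[OF box_Cons[OF this, of B]] show ?case using Cons by simp
qed (simp add: box_Nil)

text \<open>Expanding the product of the series gives one term per exponent vector. A single bound B
  for all tails serves every pair, as tails only decrease under the operators.\<close>

lemma rops_box: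
  assumes F: "vanishing {1..L} L F" and ps: "distinct ps" "set ps \<subseteq> rpairs {1..L} L"
    and B: "\<And>m. m \<in> {1..L} \<Longrightarrow> tail L m \<alpha> \<le> int B"
  shows "rops \<phi> ps F \<alpha> = (\<Sum>n\<in>box ps B. of_int (\<Prod>p\<in>set ps. fps_nth (\<phi> p) (Poly_Mapping.lookup n p)) * F (raise_seq n \<alpha>))"
  using ps B
proof (induction ps arbitrary: \<alpha>)
  case Nil
  have "raise_seq 0 \<alpha> = \<alpha>" by (simp add: raise_seq_def fun_eq_iff)
  then show ?case by (simp add: box_Nil)
next
  case (Cons p ps)
  obtain a b where p: "p = (a, b)" "1 \<le> a" "a < b" "b \<le> L"
    using Cons.prems(2) unfolding rpairs_all by (cases p) auto
  have np: "p \<notin> set ps" and sub: "set ps \<subseteq> rpairs {1..L} L" using Cons.prems by auto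
  let ?c = "\<lambda>n. \<Prod>q\<in>set ps. fps_nth (\<phi> q) (Poly_Mapping.lookup n q)"
  have "rops \<phi> (p # ps) F \<alpha> = (\<Sum>s\<le>B. of_int (fps_nth (\<phi> p) s) * rops \<phi> ps F (shift p s \<alpha>))"
    unfolding rops_simps p(1)
    by (rule rop_eq_sum[OF vanishing_rops[OF F sub], of b]) (use p Cons.prems(3) in auto)
  also have "\<dots> = (\<Sum>s\<le>B. of_int (fps_nth (\<phi> p) s) * (\<Sum>n\<in>box ps B. of_int (?c n) * F (raise_seq n (shift p s \<alpha>))))"
  proof (rule sum.cong[OF refl])
    fix s
    have "tail L m (shift p s \<alpha>) \<le> int B" if "m \<in> {1..L}" for m
      using tail_shift_le[OF p(3,4), of m s \<alpha>] Cons.prems(3)[OF that] p(1) by simp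
    then have "rops \<phi> ps F (shift p s \<alpha>) = (\<Sum>n\<in>box ps B. of_int (?c n) * F (raise_seq n (shift p s \<alpha>)))"
      using Cons.prems(1) sub by (intro Cons.IH) auto
    then show "of_int (fps_nth (\<phi> p) s) * rops \<phi> ps F (shift p s \<alpha>) = of_int (fps_nth (\<phi> p) s) *
      (\<Sum>n\<in>box ps B. of_int (?c n) * F (raise_seq n (shift p s \<alpha>)))" by simp
  qed
  also have "\<dots> = (\<Sum>(s, n)\<in>{..B} \<times> box ps B. of_int (fps_nth (\<phi> p) s * ?c n) * F (raise_seq n (shift p s \<alpha>)))"
    by (simp add: sum_distrib_left sum.cartesian_product mult.assoc)
  also have "\<dots> = (\<Sum>x\<in>{..B} \<times> box ps B. (\<lambda>n. of_int (\<Prod>q\<in>set (p # ps). fps_nth (\<phi> q) (Poly_Mapping.lookup n q)) * F (raise_seq n \<alpha>))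
      ((\<lambda>(s, n). n + Poly_Mapping.single p s) x))"
  proof (rule sum.cong[OF refl], clarify)
    fix s n assume n: "n \<in> box ps B"
    have l0: "Poly_Mapping.lookup n p = 0" using n np by (auto simp: box_def in_keys_iff)
    have "(\<Prod>q\<in>set ps. fps_nth (\<phi> q) (Poly_Mapping.lookup (n + Poly_Mapping.single p s) q)) = ?c n"
      by (rule prod.cong) (use np in \<open>auto simp: lookup_add lookup_single when_def\<close>)
    then have "(\<Prod>q\<in>set (p # ps). fps_nth (\<phi> q) (Poly_Mapping.lookup (n + Poly_Mapping.single p s) q)) = fps_nth (\<phi> p) s * ?c n"
      using np l0 by (simp add: lookup_add)
    then show "of_int (fps_nth (\<phi> p) s * ?c n) * F (raise_seq n (shift p s \<alpha>)) =
      of_int (\<Prod>q\<in>set (p # ps). fps_nth (\<phi> q) (Poly_Mapping.lookup (n + Poly_Mapping.single p s) q)) *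
      F (raise_seq (n + Poly_Mapping.single p s) \<alpha>)"
      by (simp only: raise_seq_add_single)
  qed
  also have "\<dots> = (\<Sum>n\<in>box (p # ps) B. of_int (\<Prod>q\<in>set (p # ps). fps_nth (\<phi> q) (Poly_Mapping.lookup n q)) * F (raise_seq n \<alpha>))"
    by (rule sum.reindex_bij_betw[OF box_Cons[OF np]])
  finally show ?case .
qed

lemma tail_raise_seq:
  assumes "Poly_Mapping.keys n \<subseteq> set (all_pairs L)"
  shows "tail L m (raise_seq n \<alpha>) = tail L m \<alpha> -
    (\<Sum>p\<in>Poly_Mapping.keys n. int (Poly_Mapping.lookup n p) * of_bool (fst p < m \<and> m \<le> snd p))"
proof -
  let ?K = "Poly_Mapping.keys n"
  have "tail L m (raise_seq n \<alpha>) = tail L m \<alpha> + (\<Sum>i=m..L. \<Sum>p\<in>?K. int (Poly_Mapping.lookup n p) * (of_bool (fst p = i) - of_bool (snd p = i)))"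
    unfolding tail_def by (simp add: raise_seq_superset[of ?K] sum.distrib)
  also have "(\<Sum>i=m..L. \<Sum>p\<in>?K. int (Poly_Mapping.lookup n p) * (of_bool (fst p = i) - of_bool (snd p = i))) =
    (\<Sum>p\<in>?K. \<Sum>i=m..L. int (Poly_Mapping.lookup n p) * (of_bool (fst p = i) - of_bool (snd p = i)))"
    by (rule sum.swap)
  also have "\<dots> = (\<Sum>p\<in>?K. - (int (Poly_Mapping.lookup n p) * of_bool (fst p < m \<and> m \<le> snd p)))"
  proof (rule sum.cong[OF refl])
    fix p assume "p \<in> ?K"
    then have p: "fst p < snd p" "snd p \<le> L" using assms unfolding set_all_pairs by auto
    have "(\<Sum>i=m..L. of_bool (fst p = i)) = (of_bool (m \<le> fst p) :: int)"
      "(\<Sum>i=m..L. of_bool (snd p = i)) = (of_bool (m \<le> snd p) :: int)"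
      using p by (simp_all add: of_bool_def)
    then have "(\<Sum>i=m..L. (of_bool (fst p = i) - of_bool (snd p = i))) = - (of_bool (fst p < m \<and> m \<le> snd p) :: int)"
      using p by (auto simp: sum_subtractf)
    then show "(\<Sum>i=m..L. int (Poly_Mapping.lookup n p) * (of_bool (fst p = i) - of_bool (snd p = i))) =
      - (int (Poly_Mapping.lookup n p) * of_bool (fst p < m \<and> m \<le> snd p))"
      by (simp flip: sum_distrib_left)
  qed
  finally show ?thesis by (simp add: sum_negf)
qed

text \<open>The defining sum over all monomials is supported in a finite box. A monomial reaching
  past L makes the entry at its largest index negative; otherwise each exponent is at most a tail of
  \<lambda>, since it lowers that tail. Any L beyond the length is allowed, so that empty rows can
  be included.\<close>

lemma theta_rops:
  assumes L: "length lam \<le> L"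
  shows "theta k lam c t = rops (rfactor k lam) (all_pairs L) (factor_prod L c t (betaseq k lam)) (\<lambda>i. int (part lam i))"
proof -
  let ?\<phi> = "rfactor k lam" and ?\<beta> = "betaseq k lam" and ?\<alpha> = "\<lambda>i. int (part lam i)"
  define B where "B = (\<Sum>i=1..L. part lam i)"
  have a0: "?\<alpha> i = 0" if "L < i" for i using L that by (simp add: part_def)
  have tailB: "tail L m ?\<alpha> \<le> int B" if "m \<in> {1..L}" for m
    unfolding tail_def B_def of_nat_sum using that by (intro sum_mono2) auto
  have phi0: "fps_nth (?\<phi> p) 0 = 1" for p by (cases p) (simp add: rfactor_def)
  have coeff: "Rcoeff k lam n = (\<Prod>p\<in>S. fps_nth (?\<phi> p) (Poly_Mapping.lookup n p))"
    if "finite S" "Poly_Mapping.keys n \<subseteq> S" for n S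
    unfolding Rcoeff_def
  proof (rule Prod_any.expand_superset[OF that(1)], rule subsetI, rule ccontr)
    fix p assume p: "p \<in> {p. fps_nth (?\<phi> p) (Poly_Mapping.lookup n p) \<noteq> 1}" "p \<notin> S"
    then have "Poly_Mapping.lookup n p = 0" using that(2) by (meson in_keys_iff subsetD)
    then show False using p(1) phi0[of p] by simp
  qed
  have fin_prod: "finite {i. (if 1 \<le> i then cup c t (?\<beta> i) (raise_seq n ?\<alpha> i) else 1) \<noteq> 1}" for n
  proof (rule finite_subset)
    show "{i. (if 1 \<le> i then cup c t (?\<beta> i) (raise_seq n ?\<alpha> i) else 1) \<noteq> 1} \<subseteq>
      {..L} \<union> fst ` Poly_Mapping.keys n \<union> snd ` Poly_Mapping.keys n"
    proof (rule subsetI, rule ccontr)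
      fix i assume i: "i \<in> {i. (if 1 \<le> i then cup c t (?\<beta> i) (raise_seq n ?\<alpha> i) else 1) \<noteq> 1}"
        "i \<notin> {..L} \<union> fst ` Poly_Mapping.keys n \<union> snd ` Poly_Mapping.keys n"
      have "raise_seq n ?\<alpha> i = ?\<alpha> i + (\<Sum>p\<in>Poly_Mapping.keys n. int (Poly_Mapping.lookup n p) * (of_bool (fst p = i) - of_bool (snd p = i)))"
        by (rule raise_seq_superset) auto
      also have "(\<Sum>p\<in>Poly_Mapping.keys n. int (Poly_Mapping.lookup n p) * (of_bool (fst p = i) - of_bool (snd p = i))) = 0"
        by (rule sum.neutral) (use i(2) in force)
      finally have "raise_seq n ?\<alpha> i = 0" using a0 i(2) by simp
      then show False using i(1) by (simp add: cup_0 split: if_splits)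
    qed
  qed simp
  have cprod_nonneg: "0 \<le> raise_seq n ?\<alpha> i" if "cprod c t ?\<beta> (raise_seq n ?\<alpha>) \<noteq> 0" "1 \<le> i" for n i
  proof (rule ccontr)
    assume h: "\<not> 0 \<le> raise_seq n ?\<alpha> i"
    let ?g = "\<lambda>i. if 1 \<le> i then cup c t (?\<beta> i) (raise_seq n ?\<alpha> i) else 1"
    have z: "?g i = 0" using h that(2) by (simp add: cup_neg)
    have "cprod c t ?\<beta> (raise_seq n ?\<alpha>) = prod ?g {i. ?g i \<noteq> 1}"
      unfolding cprod_def by (rule Prod_any.expand_set)
    also have "\<dots> = 0"
    proof (rule prod_zero[OF fin_prod])
      show "\<exists>a\<in>{i. ?g i \<noteq> 1}. ?g a = 0"
        using z by (intro bexI[of _ i]) auto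
    qed
    finally show False using that(1) by simp
  qed
  have inbox: "n \<in> box (all_pairs L) B"
    if n: "of_int (Rcoeff k lam n) * cprod c t ?\<beta> (raise_seq n ?\<alpha>) \<noteq> 0" for n
  proof -
    let ?K = "Poly_Mapping.keys n"
    have R: "Rcoeff k lam n \<noteq> 0" and C: "cprod c t ?\<beta> (raise_seq n ?\<alpha>) \<noteq> 0" using n by auto
    have valid: "1 \<le> a \<and> a < b" if "(a, b) \<in> ?K" for a b
    proof (rule ccontr)
      assume "\<not> (1 \<le> a \<and> a < b)"
      then have "?\<phi> (a, b) = 1" by (auto simp: rfactor_def)
      then have "fps_nth (?\<phi> (a, b)) (Poly_Mapping.lookup n (a, b)) = 0" using that by (simp add: in_keys_iff)
      then have "Rcoeff k lam n = 0" unfolding coeff[OF finite_keys subset_refl] using that by (intro prod_zero) auto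
      then show False using R by simp
    qed
    have bL: "b \<le> L" if ab: "(a, b) \<in> ?K" for a b
    proof (rule ccontr)
      assume "\<not> b \<le> L"
      \<comment> \<open>At the largest index m some operator lowers the entry and none raises it; as
        \<lambda>_m = 0, the entry becomes negative and its factor vanishes.\<close>
      define m where "m = Max (snd ` ?K)"
      have ne: "snd ` ?K \<noteq> {}" using ab by auto
      have max: "snd p \<le> m" if "p \<in> ?K" for p unfolding m_def by (rule Max_ge) (use that in auto)
      have "b \<le> m" using max[OF ab] by simp
      then have mL: "L < m" using \<open>\<not> b \<le> L\<close> by simp
      have "m \<in> snd ` ?K" unfolding m_def by (rule Max_in) (use ne in auto)
      then obtain p where p: "p \<in> ?K" "snd p = m" by auto
      have nf: "fst q \<noteq> m" if "q \<in> ?K" for q using max[OF that] valid[of "fst q" "snd q"] that by auto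
      have "raise_seq n ?\<alpha> m = ?\<alpha> m + (\<Sum>q\<in>?K. int (Poly_Mapping.lookup n q) * (of_bool (fst q = m) - of_bool (snd q = m)))"
        by (rule raise_seq_superset) auto
      also have "(\<Sum>q\<in>?K. int (Poly_Mapping.lookup n q) * (of_bool (fst q = m) - of_bool (snd q = m))) < 0"
      proof -
        have "(\<Sum>q\<in>?K. int (Poly_Mapping.lookup n q) * (of_bool (fst q = m) - of_bool (snd q = m))) < (\<Sum>q\<in>?K. 0)"
        proof (rule sum_strict_mono_ex1)
          show "\<forall>q\<in>?K. int (Poly_Mapping.lookup n q) * (of_bool (fst q = m) - of_bool (snd q = m)) \<le> 0"
            using nf by auto
          show "\<exists>q\<in>?K. int (Poly_Mapping.lookup n q) * (of_bool (fst q = m) - of_bool (snd q = m)) < 0"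
            using p nf by (intro bexI[of _ p]) (auto simp: in_keys_iff)
        qed simp
        then show ?thesis by simp
      qed
      finally have "raise_seq n ?\<alpha> m < 0" using a0[OF mL] by simp
      then show False using cprod_nonneg[OF C, of m] mL by simp
    qed
    have keys: "?K \<subseteq> set (all_pairs L)" using valid bL by (auto simp: set_all_pairs)
    have "Poly_Mapping.lookup n p \<le> B" if p: "p \<in> ?K" for p
    proof -
      obtain a b where ab: "p = (a, b)" "1 \<le> a" "a < b" "b \<le> L" using valid bL p by (cases p) auto
      have "0 \<le> tail L b (raise_seq n ?\<alpha>)" unfolding tail_def
        by (rule sum_nonneg) (use cprod_nonneg[OF C] ab in auto)
      moreover have "int (Poly_Mapping.lookup n p) \<le> (\<Sum>p\<in>?K. int (Poly_Mapping.lookup n p) * of_bool (fst p < b \<and> b \<le> snd p))"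
        using member_le_sum[of p ?K "\<lambda>p. int (Poly_Mapping.lookup n p) * of_bool (fst p < b \<and> b \<le> snd p)"] p ab by simp
      moreover have "tail L b ?\<alpha> \<le> int B" using tailB ab by simp
      ultimately show ?thesis using tail_raise_seq[OF keys, of b ?\<alpha>] by linarith
    qed
    then have "\<forall>p. Poly_Mapping.lookup n p \<le> B" by (metis in_keys_iff le0)
    then show ?thesis using keys by (simp add: box_def)
  qed
  have "theta k lam c t = (\<Sum>n\<in>box (all_pairs L) B. of_int (Rcoeff k lam n) * cprod c t ?\<beta> (raise_seq n ?\<alpha>))"
    unfolding theta_def by (rule Sum_any.expand_superset) (use inbox finite_box[OF distinct_all_pairs] in auto)
  also have "\<dots> = (\<Sum>n\<in>box (all_pairs L) B. of_int (\<Prod>p\<in>set (all_pairs L). fps_nth (?\<phi> p) (Poly_Mapping.lookup n p)) *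
      factor_prod L c t ?\<beta> (raise_seq n ?\<alpha>))"
  proof (rule sum.cong[OF refl])
    fix n assume n: "n \<in> box (all_pairs L) B"
    have K: "Poly_Mapping.keys n \<subseteq> set (all_pairs L)" using n by (simp add: box_def)
    have "raise_seq n ?\<alpha> i = 0" if "L < i" for i
    proof -
      have "raise_seq n ?\<alpha> i = ?\<alpha> i + (\<Sum>p\<in>Poly_Mapping.keys n. int (Poly_Mapping.lookup n p) * (of_bool (fst p = i) - of_bool (snd p = i)))"
        by (rule raise_seq_superset) auto
      also have "(\<Sum>p\<in>Poly_Mapping.keys n. int (Poly_Mapping.lookup n p) * (of_bool (fst p = i) - of_bool (snd p = i))) = 0"
        by (rule sum.neutral) (use K that in \<open>auto simp: set_all_pairs\<close>)
      finally show ?thesis using a0[OF that] by simp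
    qed
    then have "cprod c t ?\<beta> (raise_seq n ?\<alpha>) = (\<Prod>i\<in>{1..L}. if 1 \<le> i then cup c t (?\<beta> i) (raise_seq n ?\<alpha> i) else 1)"
      unfolding cprod_def by (intro Prod_any.expand_superset) (auto simp: cup_0 split: if_splits intro: ccontr)
    then have "cprod c t ?\<beta> (raise_seq n ?\<alpha>) = factor_prod L c t ?\<beta> (raise_seq n ?\<alpha>)"
      by (simp add: factor_prod_def)
    then show "of_int (Rcoeff k lam n) * cprod c t ?\<beta> (raise_seq n ?\<alpha>) =
      of_int (\<Prod>p\<in>set (all_pairs L). fps_nth (?\<phi> p) (Poly_Mapping.lookup n p)) * factor_prod L c t ?\<beta> (raise_seq n ?\<alpha>)"
      by (simp add: coeff[OF _ K])
  qed
  also have "\<dots> = rops ?\<phi> (all_pairs L) (factor_prod L c t ?\<beta>) ?\<alpha>"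
    by (rule rops_box[OF vanishing_factor_prod distinct_all_pairs all_pairs_rpairs tailB, symmetric])
  finally show ?thesis .
qed

section \<open>Generating functions of the elements $c^r_p$\<close>

lemma esym_Suc: "esym (Suc n) (Suc j) x = esym n (Suc j) x + x (Suc n) * esym n j x"
proof -
  let ?A = "\<lambda>(n::nat) j. {S. S \<subseteq> {1..n} \<and> card S = j}"
  have fin: "finite (?A n j)" for n j by (rule finite_subset[of _ "Pow {1..n}"]) auto
  have eq: "?A (Suc n) (Suc j) = ?A n (Suc j) \<union> insert (Suc n) ` ?A n j"
  proof (intro equalityI subsetI)
    fix S assume S: "S \<in> ?A (Suc n) (Suc j)"
    then have fS: "finite S" by (auto dest: finite_subset)
    show "S \<in> ?A n (Suc j) \<union> insert (Suc n) ` ?A n j"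
    proof (cases "Suc n \<in> S")
      case True
      have "S - {Suc n} \<subseteq> {1..n}" using S by (auto simp: atLeastAtMostSuc_conv)
      then have "S - {Suc n} \<in> ?A n j" using S True fS by (auto simp: card_Diff_singleton)
      moreover have "S = insert (Suc n) (S - {Suc n})" using True by auto
      ultimately show ?thesis by blast
    next
      case False
      then have "S \<subseteq> {1..n}" using S by (auto simp: atLeastAtMostSuc_conv)
      then show ?thesis using S by auto
    qed
  next
    fix S assume "S \<in> ?A n (Suc j) \<union> insert (Suc n) ` ?A n j"
    then show "S \<in> ?A (Suc n) (Suc j)"
    proof
      assume "S \<in> insert (Suc n) ` ?A n j"
      then obtain T where T: "S = insert (Suc n) T" "T \<subseteq> {1..n}" "card T = j" by auto
      have "finite T" "Suc n \<notin> T" using T(2) by (auto dest: finite_subset)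
      then show ?thesis using T by auto
    qed auto
  qed
  have inj: "inj_on (insert (Suc n)) (?A n j)"
  proof (rule inj_onI)
    fix S T assume "S \<in> ?A n j" "T \<in> ?A n j" "insert (Suc n) S = insert (Suc n) T"
    moreover from this have "Suc n \<notin> S" "Suc n \<notin> T" by auto
    ultimately show "S = T" by (metis insert_ident)
  qed
  have "esym (Suc n) (Suc j) x = (\<Sum>S\<in>?A n (Suc j). \<Prod>i\<in>S. x i) + (\<Sum>S\<in>insert (Suc n) ` ?A n j. \<Prod>i\<in>S. x i)"
    unfolding esym_def eq by (rule sum.union_disjoint) (use fin in auto)
  also have "(\<Sum>S\<in>insert (Suc n) ` ?A n j. \<Prod>i\<in>S. x i) = (\<Sum>S\<in>?A n j. x (Suc n) * (\<Prod>i\<in>S. x i))"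
  proof (subst sum.reindex[OF inj], rule sum.cong[OF refl])
    fix S assume "S \<in> ?A n j"
    then have "finite S" "Suc n \<notin> S" by (auto dest: finite_subset)
    then show "((\<lambda>S. \<Prod>i\<in>S. x i) \<circ> insert (Suc n)) S = x (Suc n) * (\<Prod>i\<in>S. x i)" by simp
  qed
  finally show ?thesis by (simp add: esym_def sum_distrib_left)
qed

lemma esym_0_Suc: "esym 0 (Suc j) x = 0"
proof -
  have "{S. S \<subseteq> {1..0::nat} \<and> card S = Suc j} = {}" by auto
  then show ?thesis unfolding esym_def by (simp only: sum.empty)
qed

lemma hsym_0: "hsym r 0 x = 1"
  by (simp add: hsym_def)

lemma hsym_0_Suc: "hsym 0 (Suc j) x = 0"
  by (simp add: hsym_def)

lemma hsym_Suc: "hsym (Suc n) (Suc j) x = hsym n (Suc j) x + x (Suc n) * hsym (Suc n) j x"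
proof -
  let ?A = "\<lambda>(n::nat) j. multisets_of_size {1..n} j"
  have fin: "finite (?A n j)" for n j by (rule finite_multisets_of_size) simp
  have eq: "?A (Suc n) (Suc j) = ?A n (Suc j) \<union> add_mset (Suc n) ` ?A (Suc n) j"
  proof (intro equalityI subsetI)
    fix M assume M: "M \<in> ?A (Suc n) (Suc j)"
    show "M \<in> ?A n (Suc j) \<union> add_mset (Suc n) ` ?A (Suc n) j"
    proof (cases "Suc n \<in># M")
      case True
      then obtain N where "M = add_mset (Suc n) N" by (metis insert_DiffM)
      then show ?thesis using M by (auto simp: multisets_of_size_def)
    next
      case False
      then show ?thesis using M by (auto simp: multisets_of_size_def atLeastAtMostSuc_conv)
    qed
  qed (auto simp: multisets_of_size_def)
  have inj: "inj_on (add_mset (Suc n)) (?A (Suc n) j)" by (rule inj_onI) simp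
  have "hsym (Suc n) (Suc j) x = (\<Sum>M\<in>?A n (Suc j). \<Prod>i\<in>#M. x i) + (\<Sum>M\<in>add_mset (Suc n) ` ?A (Suc n) j. \<Prod>i\<in>#M. x i)"
    unfolding hsym_def eq by (rule sum.union_disjoint) (use fin in \<open>auto simp: multisets_of_size_def\<close>)
  also have "(\<Sum>M\<in>add_mset (Suc n) ` ?A (Suc n) j. \<Prod>i\<in>#M. x i) = (\<Sum>M\<in>?A (Suc n) j. x (Suc n) * (\<Prod>i\<in>#M. x i))"
    by (subst sum.reindex[OF inj]) simp
  finally show ?thesis by (simp add: hsym_def sum_distrib_left)
qed

text \<open>The generating function of h^r_j, uniform in the sign of r: passing from r to r-1
  multiplies it by 1 - x_r X if r > 0 and by 1 + x_{1-r} X if r \<le> 0. All recursions for c^r_p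
  come from these linear factors.\<close>

definition hfps :: "int \<Rightarrow> (nat \<Rightarrow> 'a::comm_ring_1) \<Rightarrow> 'a fps" where
  "hfps r x = Abs_fps (\<lambda>j. hgen r j x)"

lemma fps_mult_linear_nth: "fps_nth (f * (1 + fps_const a * fps_X)) n = fps_nth f n + a * (if n = 0 then 0 else fps_nth f (n - 1))"
  for f :: "'a::comm_ring_1 fps"
proof -
  have "f * (1 + fps_const a * fps_X) = f + fps_const a * (f * fps_X)" by (simp add: algebra_simps)
  then show ?thesis by simp
qed

lemma hfps_0: "hfps 0 x = 1"
proof (rule fps_ext)
  fix n show "fps_nth (hfps 0 x) n = fps_nth 1 n"
    by (cases n) (simp_all add: hfps_def hgen_def hsym_0 hsym_0_Suc)
qed

lemma hfps_pos: "hfps (int n) x = hfps (int (Suc n)) x * (1 + fps_const (- x (Suc n)) * fps_X)"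
proof (rule fps_ext)
  fix j show "fps_nth (hfps (int n) x) j = fps_nth (hfps (int (Suc n)) x * (1 + fps_const (- x (Suc n)) * fps_X)) j"
    unfolding fps_mult_linear_nth
    by (cases j) (simp_all add: hfps_def hgen_def hsym_0 hsym_Suc nat_add_distrib del: of_nat_Suc)
qed

lemma hfps_neg: "hfps (- int (Suc n)) x = hfps (- int n) x * (1 + fps_const (x (Suc n)) * fps_X)"
proof -
  have e: "hgen (- int m) j x = esym m j x" for m j
    by (cases "m = 0"; cases j) (simp_all add: hgen_def hsym_0 hsym_0_Suc esym_0 esym_0_Suc)
  show ?thesis
  proof (rule fps_ext)
    fix j show "fps_nth (hfps (- int (Suc n)) x) j = fps_nth (hfps (- int n) x * (1 + fps_const (x (Suc n)) * fps_X)) j"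
      unfolding fps_mult_linear_nth hfps_def fps_nth_Abs_fps e
      by (cases j) (simp_all add: esym_0 esym_Suc)
  qed
qed

definition cfps :: "(nat \<Rightarrow> 'a::comm_ring_1) \<Rightarrow> (nat \<Rightarrow> 'a) \<Rightarrow> int \<Rightarrow> 'a fps" where
  "cfps c t r = Abs_fps (\<lambda>p. cup c t r (int p))"

lemma cfps_eq: "cfps c t r = hfps r (\<lambda>i. - t i) * Abs_fps (\<lambda>p. cext c (int p))"
proof (rule fps_ext)
  fix n
  have "cup c t r (int n) = (\<Sum>j=0..n. cext c (int n - int j) * hgen r j (\<lambda>i. - t i))"
    by (simp add: cup_def)
  also have "\<dots> = (\<Sum>j=0..n. hgen r j (\<lambda>i. - t i) * cext c (int (n - j)))"
    by (rule sum.cong) (auto simp: of_nat_diff mult.commute)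
  finally show "fps_nth (cfps c t r) n = fps_nth (hfps r (\<lambda>i. - t i) * Abs_fps (\<lambda>p. cext c (int p))) n"
    by (simp add: cfps_def hfps_def fps_mult_nth)
qed

lemma cfps_0: "cfps c t 0 = Abs_fps (\<lambda>p. cext c (int p))"
  by (simp add: cfps_eq hfps_0)

lemma cfps_pos: "cfps c t (int n) = cfps c t (int (Suc n)) * (1 + fps_const (t (Suc n)) * fps_X)"
  unfolding cfps_eq hfps_pos[of n] by simp

lemma cfps_neg: "cfps c t (- int (Suc n)) = cfps c t (- int n) * (1 + fps_const (- t (Suc n)) * fps_X)"
  unfolding cfps_eq hfps_neg[of n] by simp

lemma cup_from_cfps:
  assumes "cfps c t r = cfps c' t' q * (1 + fps_const a * fps_X)"
  shows "cup c t r p = cup c' t' q p + a * cup c' t' q (p - 1)"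
proof (cases "p < 0")
  case False
  then obtain n where n: "p = int n" by (metis nonneg_int_cases not_less)
  have "fps_nth (cfps c t r) n = fps_nth (cfps c' t' q * (1 + fps_const a * fps_X)) n" using assms by simp
  then have "cup c t r (int n) = cup c' t' q (int n) + a * (if n = 0 then 0 else cup c' t' q (int (n - 1)))"
    unfolding fps_mult_linear_nth by (simp add: cfps_def)
  then show ?thesis using n by (cases n) (simp_all add: cup_neg)
qed (simp add: cup_neg)

lemma cup_pos: "cup c t (int n) p = cup c t (int n + 1) p + t (Suc n) * cup c t (int n + 1) (p - 1)"
  using cup_from_cfps[OF cfps_pos[of c t n], of p] by (simp add: add.commute)

lemma cup_neg_index: "cup c t (- int n - 1) p = cup c t (- int n) p - t (Suc n) * cup c t (- int n) (p - 1)"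
proof -
  have e: "- int (Suc n) = - int n - 1" by simp
  show ?thesis using cup_from_cfps[OF cfps_neg[of c t n], of p] unfolding e by simp
qed

lemma rhom_prod_mset: "rhom h \<Longrightarrow> h (\<Prod>i\<in>#M. f i) = (\<Prod>i\<in>#M. h (f i))"
  by (induction M) (auto simp: rhom_1 rhom_mult)

lemma rhom_hgen: "rhom h \<Longrightarrow> h (hgen r j x) = hgen r j (\<lambda>i. h (x i))"
  by (simp add: hgen_def esym_def hsym_def rhom_sum rhom_prod rhom_prod_mset)

lemma rhom_cext: "rhom h \<Longrightarrow> h (cext c p) = cext (\<lambda>i. h (c i)) p"
  by (simp add: cext_def rhom_0 rhom_1)

lemma rhom_cup: "rhom h \<Longrightarrow> h (cup c t r p) = cup (\<lambda>i. h (c i)) (\<lambda>i. h (t i)) r p"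
  by (simp add: cup_def rhom_0 rhom_sum rhom_mult rhom_hgen rhom_cext rhom_uminus)

lemma cfps_pos_prod: "cfps c t (int n) * (\<Prod>j=1..n. 1 + fps_const (t j) * fps_X) = Abs_fps (\<lambda>p. cext c (int p))"
proof (induction n)
  case 0 then show ?case by (simp add: cfps_0)
next
  case (Suc n)
  then show ?case by (subst (asm) cfps_pos) (simp add: mult_ac)
qed

lemma cfps_neg_prod: "cfps c t (- int n) = Abs_fps (\<lambda>p. cext c (int p)) * (\<Prod>j=1..n. 1 + fps_const (- t j) * fps_X)"
proof (induction n)
  case 0 then show ?case by (simp add: cfps_0)
next
  case (Suc n)
  then show ?case by (subst cfps_neg) (simp add: mult_ac)
qed

definition dbl :: "int \<Rightarrow> int \<Rightarrow> Zct" where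
  "dbl r p = cup (\<lambda>i. const (Xv i)) Xv r p"

text \<open>c^r_p is symmetric in t_1, ..., t_n with n = |r|, and s_i permutes these or fixes them
  all unless n = i. For r \<ge> 0 the product of the factors 1 + t_j X stands in the denominator and
  is cancelled in a domain.\<close>

lemma vswap_dbl:
  assumes i: "1 \<le> i" and r: "r \<noteq> int i" "r \<noteq> - int i"
  shows "vswap i (dbl r p) = dbl r p"
proof -
  let ?c = "\<lambda>j. const (Xv j) :: Zct" and ?t' = "\<lambda>j. vswap i (Xv j) :: Zct"
  let ?C = "Abs_fps (\<lambda>p. cext ?c (int p))"
  have v: "vswap i (dbl r p) = cup ?c ?t' r p"
    unfolding dbl_def rhom_cup[OF rhom_vswap] by simp
  have perm: "transpose i (Suc i) permutes {1..n} \<or> (\<forall>j\<in>{1..n}. transpose i (Suc i) j = j)" if "n \<noteq> i" for n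
  proof (cases "n < i")
    case True then show ?thesis by (auto simp: transpose_def)
  next
    case False then show ?thesis using i that by (intro disjI1 permutes_swap_id) auto
  qed
  have pr: "(\<Prod>j=1..n. f (?t' j)) = (\<Prod>j=1..n. f (Xv j))" if "n \<noteq> i" for n and f :: "Zct \<Rightarrow> Zct fps"
  proof -
    have "(\<Prod>j=1..n. f (?t' j)) = (\<Prod>j=1..n. f (Xv (transpose i (Suc i) j)))"
      by (rule prod.cong) (use i in \<open>auto simp: vswap_Xv\<close>)
    also have "\<dots> = (\<Prod>j=1..n. f (Xv j))"
      using perm[OF that]
    proof
      assume "transpose i (Suc i) permutes {1..n}"
      from prod.permute[OF this, of "\<lambda>j. f (Xv j)"] show ?thesis by (simp add: comp_def)
    qed simp
    finally show ?thesis .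
  qed
  have "cfps ?c ?t' r = cfps ?c Xv r"
  proof (cases "r \<ge> 0")
    case True
    define n where "n = nat r"
    have n: "r = int n" "n \<noteq> i" using True r by (auto simp: n_def)
    let ?D = "\<Prod>j=1..n. 1 + fps_const (Xv j :: Zct) * fps_X"
    have "fps_nth ?D 0 = 1" by (induction n) (simp_all add: fps_mult_nth)
    then have D: "?D \<noteq> 0" by (metis fps_zero_nth zero_neq_one)
    have "cfps ?c ?t' r * ?D = cfps ?c Xv r * ?D"
      using cfps_pos_prod[of ?c ?t' n] cfps_pos_prod[of ?c Xv n] pr[OF n(2), of "\<lambda>x. 1 + fps_const x * fps_X"] n(1) by simp
    then show ?thesis using mult_right_cancel[OF D] by blast
  next
    case False
    define n where "n = nat (- r)"
    have n: "r = - int n" "n \<noteq> i" using False r by (auto simp: n_def)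
    show ?thesis unfolding n(1) cfps_neg_prod using pr[OF n(2), of "\<lambda>x. 1 + fps_const (- x) * fps_X"] by simp
  qed
  then have "cfps ?c ?t' r = cfps ?c Xv r * (1 + fps_const 0 * fps_X)" by simp
  from cup_from_cfps[OF this, of p] show ?thesis unfolding v by (simp add: dbl_def)
qed

lemma dbl_pos: "1 \<le> i \<Longrightarrow> dbl (int i) p = dbl (int i + 1) p + Xv (Suc i) * dbl (int i + 1) (p - 1)"
  unfolding dbl_def by (rule cup_pos)

lemma vswap_dbl_pos:
  assumes "1 \<le> i"
  shows "vswap i (dbl (int i) p) = dbl (int i + 1) p + Xv i * dbl (int i + 1) (p - 1)"
  using assms by (simp add: dbl_pos vswap_add vswap_mult vswap_dbl vswap_Xv_right)

lemma dbl_neg: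
  assumes "1 \<le> i"
  shows "dbl (- int i) p = dbl (- int i + 1) p - Xv i * dbl (- int i + 1) (p - 1)"
proof -
  obtain n where n: "i = Suc n" using assms by (cases i) auto
  have e: "- int i + 1 = - int n" "- int i = - int n - 1" using n by simp_all
  show ?thesis unfolding e(1) unfolding e(2) unfolding dbl_def unfolding n by (rule cup_neg_index)
qed

lemma vswap_dbl_neg:
  assumes "1 \<le> i"
  shows "vswap i (dbl (- int i) p) = dbl (- int i + 1) p - Xv (Suc i) * dbl (- int i + 1) (p - 1)"
  using assms by (simp add: dbl_neg rhom_diff[OF rhom_vswap] vswap_mult vswap_dbl vswap_Xv_left)

section \<open>The relations\<close>

lemma Iideal_0: "0 \<in> Iideal k"
  unfolding Iideal_def by (rule module.span_zero[OF module_times])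

lemma Iideal_add: "a \<in> Iideal k \<Longrightarrow> b \<in> Iideal k \<Longrightarrow> a + b \<in> Iideal k"
  unfolding Iideal_def by (rule module.span_add[OF module_times])

lemma Iideal_mult: "a \<in> Iideal k \<Longrightarrow> x * a \<in> Iideal k"
  unfolding Iideal_def by (rule module.span_scale[OF module_times])

lemma Iideal_Irel: "k < p \<Longrightarrow> Irel p \<in> Iideal k"
  unfolding Iideal_def by (rule module.span_base[OF module_times]) blast

text \<open>The kernel of Z[c][t] \<rightarrow> C^{(k)}[t], described by coefficients.
  \<open>Jideal_mult\<close> shows that it absorbs multiplication by elements of Z[c][t].\<close>

definition Jideal :: "nat \<Rightarrow> Zct set" where
  "Jideal k = {f. \<forall>m. Poly_Mapping.lookup f m \<in> Iideal k}"

lemma eq_in_Ckt_iff: "eq_in_Ckt k f g \<longleftrightarrow> f - g \<in> Jideal k"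
  by (simp add: eq_in_Ckt_def Jideal_def lookup_minus)

lemma Jideal_0: "0 \<in> Jideal k"
  by (simp add: Jideal_def Iideal_0)

lemma Jideal_add: "f \<in> Jideal k \<Longrightarrow> g \<in> Jideal k \<Longrightarrow> f + g \<in> Jideal k"
  by (simp add: Jideal_def lookup_add Iideal_add)

lemma Jideal_single: "a \<in> Iideal k \<Longrightarrow> Poly_Mapping.single m a \<in> Jideal k"
  by (simp add: Jideal_def lookup_single when_def Iideal_0)

lemma Jideal_mult:
  assumes f: "f \<in> Jideal k"
  shows "g * f \<in> Jideal k"
proof (induction g rule: poly_mapping_single_induct)
  case (single n b)
  have "Poly_Mapping.single n b * f = (\<Sum>m\<in>Poly_Mapping.keys f. Poly_Mapping.single n b * Poly_Mapping.single m (Poly_Mapping.lookup f m))"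
    by (subst (1) sum_singles[of f]) (simp add: sum_distrib_left)
  also have "\<dots> \<in> Jideal k"
  proof -
    have "b * Poly_Mapping.lookup f m \<in> Iideal k" for m using f by (simp add: Jideal_def Iideal_mult)
    then have sm: "Poly_Mapping.single n b * Poly_Mapping.single m (Poly_Mapping.lookup f m) \<in> Jideal k" for m
      unfolding mult_single by (rule Jideal_single)
    have "(\<Sum>m\<in>A. Poly_Mapping.single n b * Poly_Mapping.single m (Poly_Mapping.lookup f m)) \<in> Jideal k" for A
    proof (induction A rule: infinite_finite_induct)
      case (insert x A)
      then show ?case using Jideal_add[OF sm[of x] insert.IH] by simp
    qed (simp_all only: sum.infinite sum.empty Jideal_0 not_False_eq_True)
    then show ?thesis by blast
  qed
  finally show ?case .
qed (simp add: distrib_right Jideal_add)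

lemma Jideal_uminus: "f \<in> Jideal k \<Longrightarrow> - f \<in> Jideal k"
  using Jideal_mult[of f k "- 1"] by simp

lemma Jideal_diff: "f \<in> Jideal k \<Longrightarrow> g \<in> Jideal k \<Longrightarrow> f - g \<in> Jideal k"
  using Jideal_add[of f k "- g"] Jideal_uminus[of g k] by simp

lemma Jideal_const: "a \<in> Iideal k \<Longrightarrow> const a \<in> Jideal k"
  unfolding const_def by (rule Jideal_single)

text \<open>For a series C(X) this reads off the coefficient of degree 2N in C(X) C(-X); the terms
  N+s and N-s occur twice with equal sign. Up to (-1)^N it is the defining relation.\<close>

lemma alternating_square_nth:
  fixes x :: "nat \<Rightarrow> 'a::comm_ring_1"
  shows "fps_nth (Abs_fps x * Abs_fps (\<lambda>p. (- 1) ^ p * x p)) (2 * N) =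
    (- 1) ^ N * (x N * x N + 2 * (\<Sum>s=1..N. (- 1) ^ s * x (N + s) * x (N - s)))"
proof -
  let ?f = "\<lambda>i. x i * ((- 1) ^ (N + N - i) * x (N + N - i))"
  let ?g = "\<lambda>s. (- 1) ^ (N + s) * (x (N + s) * x (N - s))"
  have g: "sum ?g {1..N} = (- 1) ^ N * (\<Sum>s=1..N. (- 1) ^ s * x (N + s) * x (N - s))"
    by (simp add: sum_distrib_left power_add mult.assoc)
  have "fps_nth (Abs_fps x * Abs_fps (\<lambda>p. (- 1) ^ p * x p)) (N + N) = (\<Sum>i=0..N+N. ?f i)"
    by (simp add: fps_mult_nth)
  also have "{0..N+N} = {0..<N} \<union> ({N} \<union> {N+1..N+N})" by auto
  also have "sum ?f \<dots> = sum ?f {0..<N} + (?f N + sum ?f {N+1..N+N})"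
    by (subst sum.union_disjoint, simp, simp, force, subst sum.union_disjoint) auto
  also have "sum ?f {0..<N} = sum ?g {1..N}"
  proof (rule sum.reindex_bij_witness[of _ "\<lambda>s. N - s" "\<lambda>i. N - i"])
    fix i assume i: "i \<in> {0..<N}"
    then have "N + (N - i) = N + N - i" "N - (N - i) = i" by auto
    then show "?g (N - i) = ?f i" by (simp only: mult.left_commute mult.commute)
  qed auto
  also have "sum ?f {N+1..N+N} = sum ?g {1..N}"
  proof (rule sum.reindex_bij_witness[of _ "\<lambda>s. N + s" "\<lambda>i. i - N"])
    fix i assume i: "i \<in> {N+1..N+N}"
    then have e: "N + (i - N) = i" "N - (i - N) = N + N - i" by auto
    have "(- 1) ^ (N + N - i) = ((- 1) ^ i :: 'a)" using i by (simp add: minus_one_power_iff)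
    then show "?g (i - N) = ?f i" unfolding e by (simp only: mult.left_commute)
  qed auto
  also have "?f N = (- 1) ^ N * (x N * x N)" by (simp add: mult.left_commute)
  finally show ?thesis unfolding g mult_2 by (simp add: distrib_left algebra_simps)
qed

definition quad :: "int \<Rightarrow> nat \<Rightarrow> Zct" where
  "quad r N = dbl r (int N) * dbl r (int N) +
     2 * (\<Sum>s=1..N. (- 1) ^ s * dbl r (int (N + s)) * dbl r (int (N - s)))"

text \<open>The series of c^{-m} is that of c times the factors 1 - t_j X for j \<le> m. Multiplied
  by its value at -X it acquires the factors 1 - t_j^2 X^2, so the relation for c^{-m} at N combines
  those for c at N, N-1, ..., N-m. The hypothesis keeps all of these above k.\<close>

lemma quad_in_Jideal:
  assumes "k + m < N"
  shows "quad (- int m) N \<in> Jideal k"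
proof -
  define G :: "nat \<Rightarrow> Zct fps" where "G m = cfps (\<lambda>i. const (Xv i)) Xv (- int m)" for m
  define H :: "nat \<Rightarrow> Zct fps" where "H m = Abs_fps (\<lambda>p. (- 1) ^ p * dbl (- int m) (int p))" for m
  have G: "G m = Abs_fps (\<lambda>p. dbl (- int m) (int p))" for m by (simp add: G_def cfps_def dbl_def)
  have quad: "fps_nth (G m * H m) (2 * N) = (- 1) ^ N * quad (- int m) N" for m N
    unfolding G H_def quad_def by (rule alternating_square_nth)
  have GS: "G (Suc m) = G m * (1 + fps_const (- Xv (Suc m)) * fps_X)" for m
    unfolding G_def by (rule cfps_neg)
  have HS: "H (Suc m) = H m * (1 + fps_const (Xv (Suc m)) * fps_X)" for m
  proof (rule fps_ext)
    fix p
    have "fps_nth (G (Suc m)) p = fps_nth (G m * (1 + fps_const (- Xv (Suc m)) * fps_X)) p" by (simp only: GS)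
    then have e: "dbl (- int (Suc m)) (int p) = dbl (- int m) (int p) +
        - Xv (Suc m) * (if p = 0 then 0 else dbl (- int m) (int (p - 1)))"
      unfolding fps_mult_linear_nth G fps_nth_Abs_fps .
    show "fps_nth (H (Suc m)) p = fps_nth (H m * (1 + fps_const (Xv (Suc m)) * fps_X)) p"
      unfolding fps_mult_linear_nth H_def fps_nth_Abs_fps e by (cases p) (simp_all add: algebra_simps)
  qed
  have GH: "fps_nth (G (Suc m) * H (Suc m)) (Suc (Suc n)) = fps_nth (G m * H m) (Suc (Suc n)) - Xv (Suc m) * (Xv (Suc m) * fps_nth (G m * H m) n)" for m n
  proof -
    have "G (Suc m) * H (Suc m) = (G m * H m * (1 + fps_const (- Xv (Suc m)) * fps_X)) * (1 + fps_const (Xv (Suc m)) * fps_X)"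
      unfolding GS HS by (simp add: mult_ac)
    then show ?thesis by (simp only: fps_mult_linear_nth) (simp add: algebra_simps)
  qed
  have "fps_nth (G m * H m) (2 * N) \<in> Jideal k" using assms
  proof (induction m arbitrary: N)
    case 0
    have "quad 0 N = const (Irel N)"
    proof -
      have d: "dbl 0 p = const (cext Xv p)" for p
      proof (cases "p < 0")
        case True then show ?thesis by (simp add: dbl_def cup_neg cext_def)
      next
        case False
        then obtain n where n: "p = int n" by (metis nonneg_int_cases not_less)
        have "dbl 0 (int n) = fps_nth (cfps (\<lambda>i. const (Xv i)) Xv 0) n" by (simp add: dbl_def cfps_def)
        then show ?thesis by (simp add: n cfps_0 rhom_cext[OF rhom_const])
      qed
      have "const (2::Zc) = 2" "const (- 1 :: Zc) = - 1" using rhom_of_nat[OF rhom_const, of 2] by (simp_all add: const_uminus)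
      then show ?thesis
        by (simp add: quad_def Irel_def d const_add const_mult rhom_sum[OF rhom_const] rhom_power[OF rhom_const] of_nat_diff)
    qed
    then show ?case using quad[of 0 N] 0 Iideal_Irel by (simp add: Jideal_mult Jideal_const)
  next
    case (Suc m)
    obtain n where n: "N = Suc n" using Suc.prems by (cases N) auto
    have "2 * N = Suc (Suc (2 * n))" using n by simp
    then have "fps_nth (G (Suc m) * H (Suc m)) (2 * N) = fps_nth (G m * H m) (2 * N) - Xv (Suc m) * (Xv (Suc m) * fps_nth (G m * H m) (2 * n))"
      using GH[of m "2 * n"] by simp
    moreover have "fps_nth (G m * H m) (2 * N) \<in> Jideal k" "fps_nth (G m * H m) (2 * n) \<in> Jideal k"
      by (rule Suc.IH, use Suc.prems n in simp)+
    ultimately show ?case by (simp add: Jideal_diff Jideal_mult)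
  qed
  then have "(- 1) ^ N * ((- 1) ^ N * quad (- int m) N) \<in> Jideal k"
    unfolding quad by (rule Jideal_mult)
  moreover have "(- 1) ^ N * ((- 1) ^ N * quad (- int m) N) = quad (- int m) N"
    by (cases "even N") simp_all
  ultimately show ?thesis by (simp only:)
qed

section \<open>Divided differences of double theta polynomials\<close>

definition alt_fps :: "int fps" where
  "alt_fps = Abs_fps (\<lambda>s. (- 1) ^ s)"

lemma alt_fps_inverse: "alt_fps * (1 + fps_X) = 1"
proof (rule fps_ext)
  fix n show "fps_nth (alt_fps * (1 + fps_X)) n = fps_nth 1 n"
    using fps_mult_linear_nth[of alt_fps 1 n] by (cases n) (simp_all add: alt_fps_def)
qed

text \<open>The factor of R^\<lambda> for a pair of rows, in terms of w: membership in C(\<lambda>)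
  is the sign of the sum of the two values. \<open>wbeta\<close> does the same for
  \<beta>(\<lambda>).\<close>

definition wfac :: "nat \<Rightarrow> (int \<Rightarrow> int) \<Rightarrow> nat \<times> nat \<Rightarrow> int fps" where
  "wfac k w p = (1 - fps_X) * (if w (int (k + fst p)) + w (int (k + snd p)) < 0 then alt_fps else 1)"

definition wbeta :: "nat \<Rightarrow> (int \<Rightarrow> int) \<Rightarrow> nat \<Rightarrow> int" where
  "wbeta k w j = (if w (int (k + j)) < 0 then w (int (k + j)) + 1 else w (int (k + j)))"

definition dprod :: "nat \<Rightarrow> (nat \<Rightarrow> int) \<Rightarrow> (nat \<Rightarrow> int) \<Rightarrow> Zct" where
  "dprod L \<beta> \<alpha> = (\<Prod>r=1..L. dbl (\<beta> r) (\<alpha> r))"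

definition unit_seq :: "nat \<Rightarrow> nat \<Rightarrow> int" where
  "unit_seq j i = of_bool (i = j)"

lemma vanishing_dprod: "vanishing {1..L} L (dprod L \<beta>)"
  using vanishing_factor_prod[of L "\<lambda>i. const (Xv i)" "Xv :: nat \<Rightarrow> Zct" \<beta>]
  by (simp add: vanishing_def dprod_def factor_prod_def dbl_def)

lemma vanishing_dprod_shift: "vanishing {1..L} L (\<lambda>\<alpha>. dprod L \<beta> (\<lambda>i. \<alpha> i - unit_seq j i))"
  unfolding vanishing_def
proof (intro allI impI)
  fix \<alpha> assume "\<exists>m\<in>{1..L}. tail L m \<alpha> < 0"
  then obtain m where m: "m \<in> {1..L}" "tail L m \<alpha> < 0" by blast
  have "tail L m (\<lambda>i. \<alpha> i - unit_seq j i) \<le> tail L m \<alpha>"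
    unfolding tail_def by (rule sum_mono) (simp add: unit_seq_def)
  then have "tail L m (\<lambda>i. \<alpha> i - unit_seq j i) < 0" using m(2) by simp
  then show "dprod L \<beta> (\<lambda>i. \<alpha> i - unit_seq j i) = 0"
    by (rule vanishingD[OF vanishing_dprod m(1)])
qed

lemma theta_double_rops:
  assumes lam: "kstrict k lam" and L: "length lam \<le> L" and w: "w = welt k lam"
  shows "theta_double k lam = rops (wfac k w) (all_pairs L) (dprod L (wbeta k w)) (\<lambda>i. int (part lam i))"
proof -
  note g = welt[OF lam, folded w]
  have "theta_double k lam = rops (rfactor k lam) (all_pairs L)
      (factor_prod L (\<lambda>i. const (Xv i)) Xv (betaseq k lam)) (\<lambda>i. int (part lam i))"
    unfolding theta_double_def by (rule theta_rops[OF L])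
  also have "factor_prod L (\<lambda>i. const (Xv i)) Xv (betaseq k lam) = dprod L (wbeta k w)"
  proof
    fix \<alpha>
    have "betaseq k lam r = wbeta k w r" if "r \<in> {1..L}" for r
      unfolding wbeta_def by (rule betaseq_grass[OF g(1)]) (use g(2) that in auto)
    then show "factor_prod L (\<lambda>i. const (Xv i)) Xv (betaseq k lam) \<alpha> = dprod L (wbeta k w) \<alpha>"
      by (simp add: factor_prod_def dprod_def dbl_def)
  qed
  also have "rops (rfactor k lam) (all_pairs L) (dprod L (wbeta k w)) = rops (wfac k w) (all_pairs L) (dprod L (wbeta k w))"
  proof (rule rops_cong)
    fix p assume "p \<in> set (all_pairs L)"
    then obtain a b where p: "p = (a, b)" "1 \<le> a" "a < b" by (auto simp: set_all_pairs)
    have "(a, b) \<in> Cset k lam \<longleftrightarrow> w (int (k + a)) + w (int (k + b)) < 0"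
      using Cset_grass[OF g(1), of lam a b] g(2) p by blast
    then show "rfactor k lam p = wfac k w p" using p by (simp add: rfactor_def wfac_def alt_fps_def del: of_nat_add)
  qed
  finally show ?thesis .
qed

text \<open>The basic divided difference: for r = i and r = -i it raises the upper index and lowers
  the degree by one. Both signs follow by moving one linear factor of the generating function aside,
  which leaves an expression invariant under s_i.\<close>

lemma vswap_dbl_diff:
  assumes "1 \<le> i" "r = int i \<or> r = - int i"
  shows "vswap i (dbl r p) = dbl r p + (Xv i - Xv (Suc i)) * dbl (r + 1) (p - 1)"
  using assms(2)
proof
  assume "r = int i"
  then show ?thesis using vswap_dbl_pos[OF assms(1), of p] dbl_pos[OF assms(1), of p] by (simp add: algebra_simps)
next
  assume r: "r = - int i"
  show ?thesis unfolding r unfolding vswap_dbl_neg[OF assms(1)] unfolding dbl_neg[OF assms(1)]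
    by (simp add: algebra_simps)
qed

text \<open>Raising operators have integer coefficients and act on subscripts only, so they commute
  with s_i. It suffices to know the effect of s_i on the product of the factors.\<close>

lemma vswap_rops_dprod:
  assumes "\<And>\<alpha>. vswap i (dprod L \<beta> \<alpha>) = dprod L \<beta> \<alpha> + (Xv i - Xv (Suc i)) * H \<alpha>" and H: "vanishing {1..L} L H"
  shows "vswap i (rops \<phi> (all_pairs L) (dprod L \<beta>) \<alpha>) = rops \<phi> (all_pairs L) (dprod L \<beta>) \<alpha> +
    (Xv i - Xv (Suc i)) * rops \<phi> (all_pairs L) H \<alpha>"
proof -
  have "vswap i (rops \<phi> (all_pairs L) (dprod L \<beta>) \<alpha>) = rops \<phi> (all_pairs L) (\<lambda>\<alpha>. vswap i (dprod L \<beta> \<alpha>)) \<alpha>"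
    by (rule rops_rhom[OF vanishing_dprod all_pairs_rpairs rhom_vswap])
  also have "(\<lambda>\<alpha>. vswap i (dprod L \<beta> \<alpha>)) = (\<lambda>\<alpha>. 1 * dprod L \<beta> \<alpha> + (Xv i - Xv (Suc i)) * H \<alpha>)"
    using assms(1) by simp
  finally show ?thesis
    unfolding rops_lincomb[OF vanishing_dprod H all_pairs_rpairs] by simp
qed

lemma vswap_dprod_single:
  assumes i: "1 \<le> i" and j: "1 \<le> j" "j \<le> L" and b: "\<beta> j = int i \<or> \<beta> j = - int i"
    and nb: "\<And>r. r \<in> {1..L} \<Longrightarrow> r \<noteq> j \<Longrightarrow> \<beta> r \<noteq> int i \<and> \<beta> r \<noteq> - int i"
  shows "vswap i (dprod L \<beta> \<alpha>) = dprod L \<beta> \<alpha> +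
    (Xv i - Xv (Suc i)) * dprod L (\<beta>(j := \<beta> j + 1)) (\<lambda>r. \<alpha> r - unit_seq j r)"
proof -
  have jm: "j \<in> {1..L}" using j by simp
  let ?R = "\<Prod>r\<in>{1..L} - {j}. dbl (\<beta> r) (\<alpha> r)"
  have R: "vswap i ?R = ?R"
    unfolding rhom_prod[OF rhom_vswap] by (rule prod.cong) (use nb vswap_dbl[OF i] in auto)
  have 1: "dprod L \<beta> \<alpha> = dbl (\<beta> j) (\<alpha> j) * ?R" unfolding dprod_def by (rule prod.remove[OF _ jm]) simp
  have "dprod L (\<beta>(j := \<beta> j + 1)) (\<lambda>r. \<alpha> r - unit_seq j r) = dbl (\<beta> j + 1) (\<alpha> j - 1) *
      (\<Prod>r\<in>{1..L} - {j}. dbl ((\<beta>(j := \<beta> j + 1)) r) (\<alpha> r - unit_seq j r))"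
    unfolding dprod_def by (subst prod.remove[OF _ jm]) (simp_all add: unit_seq_def)
  also have "(\<Prod>r\<in>{1..L} - {j}. dbl ((\<beta>(j := \<beta> j + 1)) r) (\<alpha> r - unit_seq j r)) = ?R"
    by (rule prod.cong) (auto simp: unit_seq_def)
  finally have 2: "dprod L (\<beta>(j := \<beta> j + 1)) (\<lambda>r. \<alpha> r - unit_seq j r) = dbl (\<beta> j + 1) (\<alpha> j - 1) * ?R" .
  show ?thesis unfolding 1 2 vswap_mult R vswap_dbl_diff[OF i b] by (simp only: distrib_right mult.assoc)
qed

text \<open>With rows c - x c' and d + y d' and x, y interchanged by s_i, the difference of the
  products is (x - y)(c'd + cd'): the terms with xy cancel. Each summand carries both raised upper
  indices and lowers a single degree.\<close>

lemma vswap_dprod_double: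
  assumes i: "1 \<le> i" and jl: "1 \<le> j" "j < l" "l \<le> L" and b: "\<beta> j = - int i" "\<beta> l = int i"
    and nb: "\<And>r. r \<in> {1..L} \<Longrightarrow> r \<noteq> j \<Longrightarrow> r \<noteq> l \<Longrightarrow> \<beta> r \<noteq> int i \<and> \<beta> r \<noteq> - int i"
    and b': "\<beta>' = \<beta>(j := - int i + 1, l := int i + 1)"
  shows "vswap i (dprod L \<beta> \<alpha>) = dprod L \<beta> \<alpha> + (Xv i - Xv (Suc i)) *
    (dprod L \<beta>' (\<lambda>r. \<alpha> r - unit_seq j r) + dprod L \<beta>' (\<lambda>r. \<alpha> r - unit_seq l r))"
proof -
  let ?R = "\<Prod>r\<in>{1..L} - {j} - {l}. dbl (\<beta> r) (\<alpha> r)"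
  have R: "vswap i ?R = ?R"
    unfolding rhom_prod[OF rhom_vswap] by (rule prod.cong) (use nb vswap_dbl[OF i] in auto)
  have split: "dprod L \<gamma> \<delta> = dbl (\<gamma> j) (\<delta> j) * (dbl (\<gamma> l) (\<delta> l) * (\<Prod>r\<in>{1..L} - {j} - {l}. dbl (\<gamma> r) (\<delta> r)))" for \<gamma> \<delta>
    unfolding dprod_def using jl by (subst prod.remove[of _ j], simp, simp, subst prod.remove[of _ l]) auto
  have R': "(\<Prod>r\<in>{1..L} - {j} - {l}. dbl (\<beta>' r) (\<alpha> r - unit_seq m r)) = ?R" if "m = j \<or> m = l" for m
    by (rule prod.cong) (use that in \<open>auto simp: unit_seq_def b'\<close>)
  have v: "\<beta>' j = - int i + 1" "\<beta>' l = int i + 1" "unit_seq j j = 1" "unit_seq l l = 1" "unit_seq j l = 0" "unit_seq l j = 0"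
    using jl by (auto simp: b' unit_seq_def)
  define x y where "x = (Xv i :: Zct)" and "y = (Xv (Suc i) :: Zct)"
  define c d where "c = dbl (- int i + 1)" and "d = dbl (int i + 1)"
  have e: "vswap i (dbl (- int i) (\<alpha> j)) = c (\<alpha> j) - y * c (\<alpha> j - 1)" "dbl (- int i) (\<alpha> j) = c (\<alpha> j) - x * c (\<alpha> j - 1)"
    "vswap i (dbl (int i) (\<alpha> l)) = d (\<alpha> l) + x * d (\<alpha> l - 1)" "dbl (int i) (\<alpha> l) = d (\<alpha> l) + y * d (\<alpha> l - 1)"
    unfolding c_def d_def x_def y_def
    by (rule vswap_dbl_neg[OF i] dbl_neg[OF i] vswap_dbl_pos[OF i] dbl_pos[OF i])+
  have 1: "dprod L \<beta> \<alpha> = dbl (- int i) (\<alpha> j) * (dbl (int i) (\<alpha> l) * ?R)" unfolding split[of \<beta> \<alpha>] b ..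
  have 2: "dprod L \<beta>' (\<lambda>r. \<alpha> r - unit_seq j r) = c (\<alpha> j - 1) * (d (\<alpha> l) * ?R)"
    "dprod L \<beta>' (\<lambda>r. \<alpha> r - unit_seq l r) = c (\<alpha> j) * (d (\<alpha> l - 1) * ?R)"
    unfolding split v c_def d_def using R' by simp_all
  have 3: "vswap i (dprod L \<beta> \<alpha>) = (c (\<alpha> j) - y * c (\<alpha> j - 1)) * ((d (\<alpha> l) + x * d (\<alpha> l - 1)) * ?R)"
    unfolding 1 vswap_mult R e(1,3) ..
  show ?thesis unfolding 3 unfolding 2 1 e(2,4) x_def[symmetric] y_def[symmetric]
    by (simp add: algebra_simps)
qed

lemma sgen_sum_neg_iff:
  assumes i: "1 \<le> i" and ne: "\<not> (u = int i \<and> v = - int i - 1)" "\<not> (v = int i \<and> u = - int i - 1)"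
    "\<not> (u = - int i \<and> v = int i + 1)" "\<not> (v = - int i \<and> u = int i + 1)"
  shows "sgen i u + sgen i v < 0 \<longleftrightarrow> u + v < 0"
proof -
  have lt: "sgen i x < sgen i y" if "x < y" "(x = u \<and> y = - v) \<or> (x = - v \<and> y = u)" for x y
    by (rule sgen_less[OF that(1)]) (use that(2) i ne in auto)
  consider "u < - v" | "u = - v" | "- v < u" by linarith
  then show ?thesis
  proof cases
    case 1
    then have "sgen i u < sgen i (- v)" by (rule lt) simp
    then show ?thesis using 1 by simp
  next
    case 2
    then show ?thesis by simp
  next
    case 3
    then have "sgen i (- v) < sgen i u" by (rule lt) simp
    then show ?thesis using 3 by simp
  qed
qed

text \<open>If only row j is moved by s_i, its box is removed and all pairs keep their factors. If
  row j has value -i-1 and row l has value i, then the pair (j,l) has sum -1 before and 1 after, so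
  it loses the factor (1 + R_{jl})^{-1}; the two summands of the divided difference supply 1 +
  R_{jl} and account for the change.\<close>

lemma theta_lowers:
  assumes lam: "kstrict k lam" and mu: "kstrict k mu" and i: "1 \<le> i"
    and w: "w = welt k lam" and low: "lowers k w i j" and v: "welt k mu = sgen i \<circ> w"
  shows "vswap i (theta_double k lam) = theta_double k lam + (Xv i - Xv (Suc i)) * theta_double k mu"
proof -
  have g: "grassmannian k w" and pl: "\<And>r. 1 \<le> r \<Longrightarrow> part lam r = grass_part k w r"
    using welt[OF lam] w by auto
  have W: "w \<in> Winf" using g by (rule grassmannian_Winf)
  have j: "1 \<le> j" using low by (simp add: lowers_def)
  have same: "p = q" if "1 \<le> p" "1 \<le> q" "\<bar>w (int p)\<bar> = \<bar>w (int q)\<bar>" for p q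
    using Winf_inj_abs[OF W that] .
  have part_mu: "(\<lambda>r. int (part mu r)) = (\<lambda>r. int (part lam r) - unit_seq j r)"
  proof
    fix r
    show "int (part mu r) = int (part lam r) - unit_seq j r"
    proof (cases "r = 0")
      case True then show ?thesis using j by (simp add: part_def unit_seq_def)
    next
      case False
      then have "part mu r = grass_part k (sgen i \<circ> w) r" "part lam r = grass_part k w r"
        using welt(2)[OF mu, of r] v pl by auto
      then show ?thesis using lowers_part[OF g low] False by (cases "r = j") (auto simp: unit_seq_def)
    qed
  qed
  let ?u = "\<lambda>r. w (int (k + r))"
  have nz: "?u r \<noteq> 0" if "1 \<le> r" for r using Winf_nonzero[OF W, of "k + r"] that by simp
  have beta_i: "wbeta k w r = int i \<longleftrightarrow> ?u r = int i" "wbeta k w r = - int i \<longleftrightarrow> ?u r = - int i - 1" if "1 \<le> r" for r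
    using nz[OF that] i by (auto simp: wbeta_def simp del: of_nat_add)
  have beta_v: "wbeta k (sgen i \<circ> w) r = (if ?u r = int i then int i + 1 else if ?u r = - int i - 1 then - int i + 1 else wbeta k w r)"
    if h: "1 \<le> r" "\<bar>?u r\<bar> \<noteq> int i + 1 \<or> ?u r = - int i - 1" "\<bar>?u r\<bar> \<noteq> int i \<or> ?u r = int i" for r
  proof -
    consider "?u r = int i" | "?u r = - int i - 1" | "\<bar>?u r\<bar> \<noteq> int i" "\<bar>?u r\<bar> \<noteq> int i + 1" using h by blast
    then show ?thesis
    proof cases
      case 3
      then show ?thesis using sgen_fix[OF 3] by (auto simp: wbeta_def simp del: of_nat_add)
    qed (use i in \<open>auto simp: wbeta_def sgen_apply simp del: of_nat_add\<close>)
  qed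
  have jval: "?u j = int i \<or> ?u j = - int i - 1" using low by (auto simp: lowers_def)
  consider (single) "\<And>r. 1 \<le> r \<Longrightarrow> r \<noteq> j \<Longrightarrow> \<bar>?u r\<bar> \<noteq> int i \<and> \<bar>?u r\<bar> \<noteq> int i + 1"
    | (double) l where "1 \<le> l" "?u j = - int i - 1" "?u l = int i"
  proof -
    show thesis
    proof (cases "?u j = int i")
      case True
      then obtain p where p: "1 \<le> p" "p \<le> k" "w (int p) = int i + 1"
        using low i by (auto simp: lowers_def simp del: of_nat_add)
      show thesis
      proof (rule single)
        fix r :: nat assume r: "1 \<le> r" "r \<noteq> j"
        show "\<bar>?u r\<bar> \<noteq> int i \<and> \<bar>?u r\<bar> \<noteq> int i + 1"
          using same[of "k + r" "k + j"] same[of "k + r" p] r j p True by auto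
      qed
    next
      case False
      then have jv: "?u j = - int i - 1" and no: "\<And>m. 1 \<le> m \<Longrightarrow> ?u m \<noteq> - int i"
        using jval low i unfolding lowers_def by auto
      show thesis
      proof (cases "\<exists>l\<ge>1. ?u l = int i")
        case True
        then show thesis using double jv by blast
      next
        case no2: False
        show thesis
        proof (rule single)
          fix r :: nat assume r: "1 \<le> r" "r \<noteq> j"
          have "\<bar>?u r\<bar> \<noteq> int i + 1" using same[of "k + r" "k + j"] r j jv by auto
          moreover have "\<bar>?u r\<bar> \<noteq> int i" using no[OF r(1)] no2 r(1) by (auto simp: abs_if simp del: of_nat_add split: if_splits)
          ultimately show "\<bar>?u r\<bar> \<noteq> int i \<and> \<bar>?u r\<bar> \<noteq> int i + 1" by blast
        qed
      qed
    qed
  qed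
  then show ?thesis
  proof cases
    case single
    define L where "L = length lam + length mu + j"
    have L: "length lam \<le> L" "length mu \<le> L" "j \<le> L" by (auto simp: L_def)
    let ?b = "wbeta k w"
    let ?H = "\<lambda>\<alpha>. dprod L (?b(j := ?b j + 1)) (\<lambda>r. \<alpha> r - unit_seq j r)"
    have bj: "?b j = int i \<or> ?b j = - int i" using jval beta_i[OF j] by blast
    have nb: "?b r \<noteq> int i \<and> ?b r \<noteq> - int i" if "r \<in> {1..L}" "r \<noteq> j" for r
    proof -
      have "1 \<le> r" using that by simp
      then show ?thesis using single[of r] that(2) beta_i[of r] by auto
    qed
    have "vswap i (theta_double k lam) = theta_double k lam + (Xv i - Xv (Suc i)) *
        rops (wfac k w) (all_pairs L) ?H (\<lambda>r. int (part lam r))"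
      unfolding theta_double_rops[OF lam L(1) w]
      by (rule vswap_rops_dprod[OF vswap_dprod_single[where \<beta> = ?b, OF i j L(3) bj nb] vanishing_dprod_shift])
    also have "rops (wfac k w) (all_pairs L) ?H (\<lambda>r. int (part lam r)) =
        rops (wfac k w) (all_pairs L) (dprod L (?b(j := ?b j + 1))) (\<lambda>r. int (part mu r))"
      unfolding rops_translate part_mu ..
    also have "dprod L (?b(j := ?b j + 1)) = dprod L (wbeta k (sgen i \<circ> w))"
    proof
      fix \<alpha>
      have "(?b(j := ?b j + 1)) r = wbeta k (sgen i \<circ> w) r" if "r \<in> {1..L}" for r
      proof (cases "r = j")
        case True
        then show ?thesis using beta_v[OF j] jval beta_i[OF j] by auto
      next
        case False
        have "1 \<le> r" using that by simp
        then show ?thesis using single[of r] False beta_v[of r] by auto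
      qed
      then show "dprod L (?b(j := ?b j + 1)) \<alpha> = dprod L (wbeta k (sgen i \<circ> w)) \<alpha>"
        unfolding dprod_def by (intro prod.cong) auto
    qed
    also have "rops (wfac k w) (all_pairs L) (dprod L (wbeta k (sgen i \<circ> w))) =
      rops (wfac k (sgen i \<circ> w)) (all_pairs L) (dprod L (wbeta k (sgen i \<circ> w)))"
    proof (rule rops_cong)
      fix p assume "p \<in> set (all_pairs L)"
      then obtain a b where p: "p = (a, b)" "1 \<le> a" "a < b" by (auto simp: set_all_pairs)
      have sg: "(\<bar>?u a\<bar> \<noteq> int i \<and> \<bar>?u a\<bar> \<noteq> int i + 1) \<or> (\<bar>?u b\<bar> \<noteq> int i \<and> \<bar>?u b\<bar> \<noteq> int i + 1)"
      proof (cases "a = j")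
        case True
        then show ?thesis using single[of b] p by simp
      next
        case False
        then show ?thesis using single[of a] p by simp
      qed
      have "sgen i (?u a) + sgen i (?u b) < 0 \<longleftrightarrow> ?u a + ?u b < 0"
        by (rule sgen_sum_neg_iff[OF i]) (use sg in \<open>auto simp del: of_nat_add\<close>)
      then show "wfac k w p = wfac k (sgen i \<circ> w) p" using p by (simp add: wfac_def del: of_nat_add)
    qed
    finally show ?thesis unfolding theta_double_rops[OF mu L(2) v[symmetric]] .
  next
    case double
    \<comment> \<open>Row l may be empty, so the length of \<lambda> alone would not do.\<close>
    define L where "L = length lam + length mu + j + l"
    have L: "length lam \<le> L" "length mu \<le> L" "j \<le> L" "l \<le> L" by (auto simp: L_def)
    have jl: "j < l" using grassmannian_last_less_iff[OF g j double(1)] double(2,3) i by simp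
    let ?b = "wbeta k w"
    let ?b' = "?b(j := - int i + 1, l := int i + 1)"
    let ?H = "\<lambda>\<alpha>. dprod L ?b' (\<lambda>r. \<alpha> r - unit_seq j r) + dprod L ?b' (\<lambda>r. \<alpha> r - unit_seq l r)"
    have other: "\<bar>?u r\<bar> \<noteq> int i \<and> \<bar>?u r\<bar> \<noteq> int i + 1" if "1 \<le> r" "r \<noteq> j" "r \<noteq> l" for r
      using same[of "k + r" "k + j"] same[of "k + r" "k + l"] that j double by auto
    have bj: "?b j = - int i" "?b l = int i" using beta_i[OF j] beta_i[OF double(1)] double by auto
    have nb: "?b r \<noteq> int i \<and> ?b r \<noteq> - int i" if "r \<in> {1..L}" "r \<noteq> j" "r \<noteq> l" for r
    proof -
      have "1 \<le> r" using that by simp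
      then show ?thesis using other[of r] that(2,3) beta_i[of r] by auto
    qed
    have vH: "vanishing {1..L} L ?H"
      using vanishing_lincomb[OF vanishing_dprod_shift[of L ?b' j] vanishing_dprod_shift[of L ?b' l], of 1 1] by simp
    \<comment> \<open>Removing a box from row l equals removing one from row j and then applying
      R_{jl}. Thus the two terms together are 1 + R_{jl} at the sequence of the smaller
      partition.\<close>
    have HR: "?H = (\<lambda>\<alpha>. rop (j, l) (1 + fps_X) (dprod L ?b') (\<lambda>r. \<alpha> r - unit_seq j r))"
    proof
      fix \<alpha> :: "nat \<Rightarrow> int"
      have sh: "shift (j, l) 1 (\<lambda>r. \<alpha> r - unit_seq j r) = (\<lambda>r. \<alpha> r - unit_seq l r)"
        using jl by (auto simp: shift_def unit_seq_def fun_eq_iff)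
      show "?H \<alpha> = rop (j, l) (1 + fps_X) (dprod L ?b') (\<lambda>r. \<alpha> r - unit_seq j r)"
        using rop_linear_poly[of "(j, l)" 1 1 "dprod L ?b'" "\<lambda>r. \<alpha> r - unit_seq j r"] unfolding sh by simp
    qed
    have "vswap i (theta_double k lam) = theta_double k lam + (Xv i - Xv (Suc i)) *
        rops (wfac k w) (all_pairs L) ?H (\<lambda>r. int (part lam r))"
      unfolding theta_double_rops[OF lam L(1) w]
      by (rule vswap_rops_dprod[OF vswap_dprod_double[where \<beta> = ?b, OF i j jl L(4) bj nb refl] vH])
    also have "rops (wfac k w) (all_pairs L) ?H (\<lambda>r. int (part lam r)) =
        rops (wfac k w) (all_pairs L) (rop (j, l) (1 + fps_X) (dprod L ?b')) (\<lambda>r. int (part mu r))"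
      unfolding HR rops_translate part_mu ..
    also have "rops (wfac k w) (all_pairs L) (rop (j, l) (1 + fps_X) (dprod L ?b')) =
        rops ((wfac k w)((j, l) := wfac k w (j, l) * (1 + fps_X))) (all_pairs L) (dprod L ?b')"
      by (rule rops_absorb[OF vanishing_dprod all_pairs_rpairs distinct_all_pairs]) (use j jl L in \<open>simp add: set_all_pairs\<close>)
    also have "dprod L ?b' = dprod L (wbeta k (sgen i \<circ> w))"
    proof
      fix \<alpha>
      have "?b' r = wbeta k (sgen i \<circ> w) r" if "r \<in> {1..L}" for r
      proof (cases "r = j \<or> r = l")
        case True
        then show ?thesis using beta_v[OF j] beta_v[OF double(1)] double jl i by auto
      next
        case False
        have "1 \<le> r" using that by simp
        then show ?thesis using other[of r] False beta_v[of r] by auto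
      qed
      then show "dprod L ?b' \<alpha> = dprod L (wbeta k (sgen i \<circ> w)) \<alpha>"
        unfolding dprod_def by (intro prod.cong) auto
    qed
    also have "rops ((wfac k w)((j, l) := wfac k w (j, l) * (1 + fps_X))) (all_pairs L) (dprod L (wbeta k (sgen i \<circ> w))) =
      rops (wfac k (sgen i \<circ> w)) (all_pairs L) (dprod L (wbeta k (sgen i \<circ> w)))"
    proof (rule rops_cong)
      fix p assume "p \<in> set (all_pairs L)"
      then obtain a b where p: "p = (a, b)" "1 \<le> a" "a < b" by (auto simp: set_all_pairs)
      show "((wfac k w)((j, l) := wfac k w (j, l) * (1 + fps_X))) p = wfac k (sgen i \<circ> w) p"
      proof (cases "p = (j, l)")
        case True
        have "sgen i (?u j) + sgen i (?u l) = 1" using double i by (simp add: sgen_apply)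
        then show ?thesis using True double by (simp add: wfac_def alt_fps_inverse mult.assoc del: of_nat_add)
      next
        case False
        have "sgen i (?u a) + sgen i (?u b) < 0 \<longleftrightarrow> ?u a + ?u b < 0"
        proof (rule sgen_sum_neg_iff[OF i])
          show "\<not> (?u a = int i \<and> ?u b = - int i - 1)" "\<not> (?u b = int i \<and> ?u a = - int i - 1)"
            "\<not> (?u a = - int i \<and> ?u b = int i + 1)" "\<not> (?u b = - int i \<and> ?u a = int i + 1)"
            using other[of a] other[of b] p False double i jl
            by (cases "a = j"; cases "a = l"; cases "b = j"; cases "b = l"; force simp del: of_nat_add)+
        qed
        then have "wfac k w (a, b) = wfac k (sgen i \<circ> w) (a, b)" by (simp add: wfac_def del: of_nat_add)
        then show ?thesis using False unfolding p by (simp only: fun_upd_apply if_False)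
      qed
    qed
    finally show ?thesis unfolding theta_double_rops[OF mu L(2) v[symmetric]] .
  qed
qed

section \<open>Left ascents: exchange of two adjacent rows\<close>

lemma rops_swap_invariant:
  assumes F: "vanishing M L (\<lambda>\<alpha>. F (\<alpha> \<circ> transpose j (Suc j)))" and qs: "set qs \<subseteq> rpairs M L"
    and perm: "mset (map (swap_pair j) qs) = mset qs" and \<phi>: "\<And>p. p \<in> set qs \<Longrightarrow> \<phi> (swap_pair j p) = \<phi> p"
  shows "rops \<phi> qs F (\<alpha> \<circ> transpose j (Suc j)) = rops \<phi> qs (\<lambda>\<alpha>. F (\<alpha> \<circ> transpose j (Suc j))) \<alpha>"
proof -
  let ?G = "\<lambda>\<alpha>. F (\<alpha> \<circ> transpose j (Suc j))"
  have "rops \<phi> qs F (\<alpha> \<circ> transpose j (Suc j)) = rops (\<lambda>p. \<phi> (swap_pair j p)) (map (swap_pair j) qs) ?G \<alpha>"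
    by (rule rops_swap)
  also have "rops (\<lambda>p. \<phi> (swap_pair j p)) (map (swap_pair j) qs) ?G = rops \<phi> (map (swap_pair j) qs) ?G"
    by (rule rops_cong) (use \<phi> in auto)
  also have "\<dots> = rops \<phi> qs ?G"
    by (rule rops_perm[OF F qs perm[symmetric], symmetric])
  finally show ?thesis .
qed

lemma dprod_swap:
  assumes j: "1 \<le> j" "Suc j \<le> L" and b: "\<beta> j = \<beta> (Suc j)"
  shows "dprod L \<beta> (\<alpha> \<circ> transpose j (Suc j)) = dprod L \<beta> \<alpha>"
proof -
  have p: "transpose j (Suc j) permutes {1..L}" by (rule permutes_swap_id) (use j in auto)
  have "dprod L \<beta> \<alpha> = (\<Prod>r=1..L. dbl (\<beta> (transpose j (Suc j) r)) (\<alpha> (transpose j (Suc j) r)))"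
    unfolding dprod_def using prod.permute[OF p, of "\<lambda>r. dbl (\<beta> r) (\<alpha> r)"] by (simp add: comp_def)
  also have "\<dots> = dprod L \<beta> (\<alpha> \<circ> transpose j (Suc j))"
    unfolding dprod_def by (rule prod.cong) (use b in \<open>auto simp: transpose_def\<close>)
  finally show ?thesis by simp
qed

definition other_pairs :: "nat \<Rightarrow> nat \<Rightarrow> (nat \<times> nat) list" where
  "other_pairs L j = remove1 (j, Suc j) (all_pairs L)"

lemma set_other_pairs: "set (other_pairs L j) = {(a, b). 1 \<le> a \<and> a < b \<and> b \<le> L \<and> (a, b) \<noteq> (j, Suc j)}"
  unfolding other_pairs_def by (auto simp: set_remove1_eq distinct_all_pairs set_all_pairs)

lemma distinct_other_pairs: "distinct (other_pairs L j)"
  by (simp add: other_pairs_def distinct_all_pairs)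

lemma other_pairs_rpairs: "set (other_pairs L j) \<subseteq> rpairs {1..L} L"
  unfolding set_other_pairs rpairs_all by auto

text \<open>Every pair except (j, j+1) lowers a tail that does not start at j+1: a pair (a, j+1)
  with a < j lowers the one at j. So these operators still act on functions controlled only by the
  tails that survive the exchange.\<close>

lemma other_pairs_rpairs_minus: "1 \<le> j \<Longrightarrow> set (other_pairs L j) \<subseteq> rpairs ({1..L} - {Suc j}) L"
proof
  fix p assume j: "1 \<le> j" and "p \<in> set (other_pairs L j)"
  then obtain a b where p: "p = (a, b)" "1 \<le> a" "a < b" "b \<le> L" "(a, b) \<noteq> (j, Suc j)" by (auto simp: set_other_pairs)
  have "\<exists>m\<in>{1..L} - {Suc j}. a < m \<and> m \<le> b"
  proof (cases "b = Suc j")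
    case True
    then show ?thesis using p j by (intro bexI[of _ j]) auto
  next
    case False
    then show ?thesis using p by (intro bexI[of _ b]) auto
  qed
  then show "p \<in> rpairs ({1..L} - {Suc j}) L" using p by (auto simp: rpairs_def)
qed

lemma mset_swap_other_pairs:
  assumes "1 \<le> j" "Suc j \<le> L"
  shows "mset (map (swap_pair j) (other_pairs L j)) = mset (other_pairs L j)"
proof -
  have inj: "inj_on (swap_pair j) A" for A by (metis inj_onI swap_pair_swap_pair)
  have sub: "swap_pair j p \<in> set (other_pairs L j)" if p: "p \<in> set (other_pairs L j)" for p
  proof -
    obtain a b where "p = (a, b)" by fastforce
    then show ?thesis using p assms by (auto simp: set_other_pairs swap_pair_def transpose_def)
  qed
  have "set (map (swap_pair j) (other_pairs L j)) = set (other_pairs L j)"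
  proof (intro equalityI subsetI)
    fix p assume "p \<in> set (other_pairs L j)"
    then have "swap_pair j p \<in> set (other_pairs L j)" by (rule sub)
    then show "p \<in> set (map (swap_pair j) (other_pairs L j))" by (metis image_eqI list.set_map swap_pair_swap_pair)
  qed (use sub in auto)
  then show ?thesis
    by (subst set_eq_iff_mset_eq_distinct[symmetric]) (simp_all add: distinct_map inj distinct_other_pairs)
qed

lemma mset_all_pairs: "1 \<le> j \<Longrightarrow> Suc j \<le> L \<Longrightarrow> mset (all_pairs L) = add_mset (j, Suc j) (mset (other_pairs L j))"
  by (simp add: other_pairs_def set_all_pairs)

text \<open>Exchanging rows j and j+1 amounts to applying s_i to all values, as the other rows avoid
  the absolute values i and i+1. The sign of a sum of two values could change only for values of
  opposite sign within these two rows, and here they have the same sign.\<close>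

lemma wfac_swap:
  assumes g: "grassmannian k w" and i: "1 \<le> i" and j: "1 \<le> j"
    and sw: "w (int (k + Suc j)) = sgen i (w (int (k + j)))" and v: "\<bar>w (int (k + j))\<bar> = int i \<or> \<bar>w (int (k + j))\<bar> = int i + 1"
    and s: "0 < w (int (k + j)) * w (int (k + Suc j))"
    and p: "p \<in> set (other_pairs L j)"
  shows "wfac k w (swap_pair j p) = wfac k w p"
proof -
  have W: "w \<in> Winf" using g by (rule grassmannian_Winf)
  let ?u = "\<lambda>r. w (int (k + r))"
  have same: "p = q" if "1 \<le> p" "1 \<le> q" "\<bar>w (int p)\<bar> = \<bar>w (int q)\<bar>" for p q
    using Winf_inj_abs[OF W that] .
  have vals: "(?u j = int i \<and> ?u (Suc j) = int i + 1) \<or> (?u j = - int i - 1 \<and> ?u (Suc j) = - int i) \<or>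
      (?u j = int i + 1 \<and> ?u (Suc j) = int i) \<or> (?u j = - int i \<and> ?u (Suc j) = - int i - 1)"
    using v sw i by (auto simp: sgen_apply abs_if simp del: of_nat_add of_nat_Suc split: if_splits)
  have other: "\<bar>?u r\<bar> \<noteq> int i \<and> \<bar>?u r\<bar> \<noteq> int i + 1" if "1 \<le> r" "r \<noteq> j" "r \<noteq> Suc j" for r
    using same[of "k + r" "k + j"] same[of "k + r" "k + Suc j"] that j vals by (auto simp del: of_nat_add of_nat_Suc)
  have tr: "?u (transpose j (Suc j) r) = sgen i (?u r)" if "1 \<le> r" for r
  proof -
    consider "r = j" | "r = Suc j" | "r \<noteq> j" "r \<noteq> Suc j" by blast
    then show ?thesis
    proof cases
      case 1 then show ?thesis using sw by simp
    next
      case 2 then show ?thesis using sw by simp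
    next
      case 3
      then show ?thesis using sgen_fix[of "?u r" i] other[OF that 3] by (simp del: of_nat_add)
    qed
  qed
  obtain a b where ab: "p = (a, b)" "1 \<le> a" "a < b" using p by (auto simp: set_other_pairs)
  have excl: "\<not> (?u a = x \<and> ?u b = y)" if "\<bar>x\<bar> = int i" "\<bar>y\<bar> = int i + 1" "x * y < 0" for x y
  proof
    assume h: "?u a = x \<and> ?u b = y"
    then have "a = j \<or> a = Suc j" "b = j \<or> b = Suc j" using other[of a] other[of b] ab that by auto
    then have "x * y = ?u j * ?u (Suc j)" using h ab by (auto simp: mult.commute simp del: of_nat_add of_nat_Suc)
    then show False using s that(3) by simp
  qed
  have excl': "\<not> (?u b = x \<and> ?u a = y)" if "\<bar>x\<bar> = int i" "\<bar>y\<bar> = int i + 1" "x * y < 0" for x y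
  proof
    assume h: "?u b = x \<and> ?u a = y"
    then have "a = j \<or> a = Suc j" "b = j \<or> b = Suc j" using other[of a] other[of b] ab that by auto
    then have "x * y = ?u j * ?u (Suc j)" using h ab by (auto simp: mult.commute simp del: of_nat_add of_nat_Suc)
    then show False using s that(3) by simp
  qed
  have m: "int i * (- int i - 1) < 0" "- int i * (int i + 1) < 0" using i by (simp_all add: mult_pos_neg mult_neg_pos)
  have "sgen i (?u a) + sgen i (?u b) < 0 \<longleftrightarrow> ?u a + ?u b < 0"
    by (rule sgen_sum_neg_iff[OF i]; (rule excl | rule excl'); use m in auto)
  then show ?thesis
    using tr[of a] tr[of b] ab by (simp add: wfac_def swap_pair_def del: of_nat_add)
qed

lemma one_minus_fps_X: "1 - fps_X = 1 + fps_const (- 1) * (fps_X :: int fps)"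
  by (simp flip: fps_const_neg)

text \<open>The rows have equal upper index, so everything except the factor 1 - R_{j,j+1} is
  symmetric under their exchange. Since the degrees differ by one, R_{j,j+1} is that exchange at
  \<alpha>, and the two terms cancel in Z[c,t].\<close>

lemma rops_ascent_pos:
  assumes g: "grassmannian k w" and i: "1 \<le> i" and j: "1 \<le> j" "Suc j \<le> L"
    and u: "w (int (k + j)) = int i" "w (int (k + Suc j)) = int i + 1"
    and b: "\<beta> j = \<beta> (Suc j)" and \<alpha>: "\<alpha> (Suc j) = \<alpha> j + 1"
  shows "rops (wfac k w) (all_pairs L) (dprod L \<beta>) \<alpha> = 0"
proof -
  let ?\<tau> = "transpose j (Suc j)" and ?F = "dprod L \<beta>" and ?\<phi> = "wfac k w"
  define G where "G = rops ?\<phi> (other_pairs L j) ?F"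
  have sym: "(\<lambda>\<alpha>. ?F (\<alpha> \<circ> ?\<tau>)) = ?F" using dprod_swap[OF j b] by simp
  have inv: "?\<phi> (swap_pair j p) = ?\<phi> p" if "p \<in> set (other_pairs L j)" for p
    by (rule wfac_swap[OF g i j(1) _ _ _ that]) (use u i in \<open>simp_all add: sgen_apply del: of_nat_add of_nat_Suc\<close>)
  have "G (\<alpha> \<circ> ?\<tau>) = rops ?\<phi> (other_pairs L j) (\<lambda>\<alpha>. ?F (\<alpha> \<circ> ?\<tau>)) \<alpha>"
    unfolding G_def by (rule rops_swap_invariant[where F = "dprod L \<beta>" and \<phi> = "wfac k w", OF _ other_pairs_rpairs mset_swap_other_pairs[OF j] inv])
      (use sym vanishing_dprod[of L \<beta>] in simp_all)
  then have Gsym: "G (\<alpha> \<circ> ?\<tau>) = G \<alpha>" unfolding sym G_def .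
  have "rops ?\<phi> (all_pairs L) ?F \<alpha> = rops ?\<phi> ((j, Suc j) # other_pairs L j) ?F \<alpha>"
    using rops_perm[OF vanishing_dprod all_pairs_rpairs, of L "(j, Suc j) # other_pairs L j"] mset_all_pairs[OF j] by simp
  also have "\<dots> = rop (j, Suc j) (1 - fps_X) G \<alpha>"
    using u by (simp add: G_def wfac_def del: of_nat_add of_nat_Suc)
  also have "\<dots> = G \<alpha> - G (shift (j, Suc j) 1 \<alpha>)"
    unfolding one_minus_fps_X using rop_linear_poly[of "(j, Suc j)" 1 "- 1" G \<alpha>] by simp
  also have "shift (j, Suc j) 1 \<alpha> = \<alpha> \<circ> ?\<tau>"
    using \<alpha> by (auto simp: shift_def fun_eq_iff transpose_def)
  finally show ?thesis using Gsym by (simp add: comp_def)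
qed

section \<open>The series (1 - X)/(1 + X) and its inverse, obtained by X \<rightarrow> -X\<close>

definition qfps :: "int fps" where
  "qfps = (1 - fps_X) * alt_fps"

definition qfps' :: "int fps" where
  "qfps' = (1 + fps_X) * Abs_fps (\<lambda>_. 1)"

lemma geometric_inverse: "Abs_fps (\<lambda>_. 1) * (1 - fps_X) = (1 :: int fps)"
proof (rule fps_ext)
  fix n show "fps_nth (Abs_fps (\<lambda>_. 1) * (1 - fps_X)) n = fps_nth (1 :: int fps) n"
    unfolding one_minus_fps_X fps_mult_linear_nth by (cases n) simp_all
qed

lemma qfps_qfps': "qfps * qfps' = 1"
proof -
  have "qfps * qfps' = (Abs_fps (\<lambda>_. 1) * (1 - fps_X)) * (alt_fps * (1 + fps_X))"
    unfolding qfps_def qfps'_def by (simp only: mult_ac)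
  then show ?thesis by (simp add: alt_fps_inverse geometric_inverse)
qed

lemma qfps_nth: "fps_nth qfps s = (if s = 0 then 1 else 2 * (- 1) ^ s)"
proof -
  have "qfps = alt_fps * (1 + fps_const (- 1) * fps_X)" unfolding qfps_def one_minus_fps_X by (rule mult.commute)
  then show ?thesis using fps_mult_linear_nth[of alt_fps "- 1" s] by (cases s) (simp_all add: alt_fps_def)
qed

lemma qfps'_nth: "fps_nth qfps' s = (- 1) ^ s * fps_nth qfps s"
proof -
  have "qfps' = Abs_fps (\<lambda>_. 1) * (1 + fps_const 1 * fps_X)" by (simp add: qfps'_def mult.commute)
  then show ?thesis using fps_mult_linear_nth[of "Abs_fps (\<lambda>_. 1) :: int fps" 1 s]
    by (cases s) (simp_all add: qfps_nth flip: power_mult_distrib)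
qed

lemma tail_swap:
  assumes "m \<noteq> Suc j" "Suc j \<le> L"
  shows "tail L m (\<alpha> \<circ> transpose j (Suc j)) = tail L m \<alpha>"
proof (cases "m \<le> j")
  case True
  have "transpose j (Suc j) permutes {m..L}" by (rule permutes_swap_id) (use True assms in auto)
  from sum.permute[OF this, of \<alpha>] show ?thesis by (simp add: tail_def comp_def)
next
  case False
  then have "\<alpha> (transpose j (Suc j) r) = \<alpha> r" if "r \<in> {m..L}" for r using assms that by (auto simp: transpose_def)
  then show ?thesis by (simp add: tail_def)
qed

text \<open>If \<open>S\<close> changes sign under \<open>R\<^sub>j\<^sub>,\<^sub>j\<^sub>+\<^sub>1\<close>, then on \<open>S\<close> the operator \<open>R\<^sub>h\<^sub>,\<^sub>j\<^sub>+\<^sub>1\<close> is \<open>- R\<^sub>h\<^sub>,\<^sub>j\<close>,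
  and \<open>\<phi>(X) \<phi>(- X) = 1\<close> for \<open>\<phi>(X) = (1 - X) / (1 + X)\<close>. Hence the rows above \<open>j\<close>, which would
  lower the degree to a range where the relations are not available, do not contribute.\<close>

lemma rop_alternating:
  assumes S: "vanishing M L S" and h: "1 \<le> h" "h < j" "j \<le> L" "j \<in> M"
    and alt: "\<And>\<alpha>. S (shift (j, Suc j) 1 \<alpha>) = - S \<alpha>"
  shows "rop (h, j) qfps (rop (h, Suc j) qfps S) = S"
proof -
  have alts: "S (shift (j, Suc j) s \<alpha>) = (- 1) ^ s * S \<alpha>" for s \<alpha>
  proof (induction s)
    case (Suc s)
    have "shift (j, Suc j) (Suc s) \<alpha> = shift (j, Suc j) 1 (shift (j, Suc j) s \<alpha>)" by (simp add: shift_shift)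
    then show ?case using alt Suc by simp
  qed simp
  have "rop (h, Suc j) qfps S = rop (h, j) qfps' S"
  proof
    fix \<alpha>
    have sh: "shift (h, Suc j) s \<alpha> = shift (j, Suc j) s (shift (h, j) s \<alpha>)" for s
      by (auto simp: shift_def fun_eq_iff algebra_simps)
    show "rop (h, Suc j) qfps S \<alpha> = rop (h, j) qfps' S \<alpha>"
      unfolding rop_def sh alts qfps'_nth by (simp add: mult_ac)
  qed
  moreover have "rop (h, j) qfps (rop (h, j) qfps' S) = rop (h, j) (qfps * qfps') S"
    by (rule rop_rop[OF S]) (use h in \<open>auto simp: rpairs_def\<close>)
  ultimately show ?thesis by (simp add: qfps_qfps' rop_one)
qed

definition upper_pairs :: "nat \<Rightarrow> nat list \<Rightarrow> (nat \<times> nat) list" where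
  "upper_pairs j hs = concat (map (\<lambda>h. [(h, j), (h, Suc j)]) hs)"

lemma set_upper_pairs: "set (upper_pairs j hs) = {(h, b). h \<in> set hs \<and> (b = j \<or> b = Suc j)}"
  by (auto simp: upper_pairs_def)

lemma distinct_upper_pairs: "distinct hs \<Longrightarrow> distinct (upper_pairs j hs)"
proof (induction hs)
  case (Cons h hs)
  have "upper_pairs j (h # hs) = [(h, j), (h, Suc j)] @ upper_pairs j hs" by (simp add: upper_pairs_def)
  then show ?case using Cons by (auto simp: set_upper_pairs)
qed (simp add: upper_pairs_def)

text \<open>The pairs that do not lower an entry j or j+1. Their operators never decrease the sum of
  the entries j and j+1.\<close>

definition lower_pairs :: "nat \<Rightarrow> nat \<Rightarrow> (nat \<times> nat) list" where
  "lower_pairs L j = filter (\<lambda>(a, b). b \<noteq> j \<and> b \<noteq> Suc j) (all_pairs L)"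

lemma mset_other_pairs:
  assumes "1 \<le> j" "Suc j \<le> L"
  shows "mset (other_pairs L j) = mset (lower_pairs L j @ upper_pairs j [1..<j])"
proof -
  have "distinct (lower_pairs L j @ upper_pairs j [1..<j])"
    using distinct_upper_pairs[of "[1..<j]" j] by (auto simp: lower_pairs_def distinct_all_pairs set_upper_pairs)
  moreover have "set (other_pairs L j) = set (lower_pairs L j @ upper_pairs j [1..<j])"
    using assms by (auto simp: set_other_pairs lower_pairs_def set_all_pairs set_upper_pairs)
  ultimately show ?thesis using set_eq_iff_mset_eq_distinct[OF distinct_other_pairs] by blast
qed

text \<open>The factor (1 - R)/(1 + R) of the pair (j, j+1), applied at equal degrees, produces the
  quadratic relation for c^{-(i-1)}. The remaining operators disturb the degrees, so this is
  propagated through the symmetrisation \<open>S\<close>, which is determined up to sign by its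
  values at equal degrees.\<close>

lemma rops_ascent_neg:
  assumes g: "grassmannian k w" and i: "1 \<le> i" and j: "1 \<le> j" "Suc j \<le> L"
    and u: "w (int (k + j)) = - int i - 1" "w (int (k + Suc j)) = - int i"
    and b: "\<beta> j = - int i + 1" "\<beta> (Suc j) = - int i + 1"
    and \<alpha>: "\<alpha> j = int k + int i" "\<alpha> (Suc j) = int k + int i"
  shows "rops (wfac k w) (all_pairs L) (dprod L \<beta>) \<alpha> \<in> Jideal k"
proof -
  let ?\<tau> = "transpose j (Suc j)" and ?F = "dprod L \<beta>" and ?\<phi> = "wfac k w" and ?p = "(j, Suc j)"
  let ?M = "{1..L} - {Suc j}" and ?qs = "other_pairs L j"
  let ?u = "\<lambda>r. w (int (k + r))"
  define Q where "Q = rop ?p qfps ?F"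
  \<comment> \<open>\<open>Q\<close> itself is not symmetric, because the operator of the pair (j,
    j+1) is not. The sum with its exchange is symmetric and, as shown in \<open>alt\<close>, changes
    sign under R_{j,j+1}.\<close>
  define S where "S \<alpha> = Q \<alpha> + Q (\<alpha> \<circ> ?\<tau>)" for \<alpha>
  have bb: "\<beta> j = \<beta> (Suc j)" using b by simp
  have Fsym: "?F (\<alpha> \<circ> ?\<tau>) = ?F \<alpha>" for \<alpha> by (rule dprod_swap[OF j bb])
  have pr: "?p \<in> rpairs {1..L} L" unfolding rpairs_all using j by simp
  have vQ1: "vanishing {1..L} L Q" unfolding Q_def by (rule vanishing_rop[OF vanishing_dprod]) (use j in auto)
  have vQ: "vanishing ?M L Q" by (rule vanishing_subset[OF vQ1]) auto
  \<comment> \<open>The exchange preserves every tail except the one starting at j+1, hence the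
    smaller set \<open>?M\<close>.\<close>
  have vQt: "vanishing ?M L (\<lambda>\<alpha>. Q (\<alpha> \<circ> ?\<tau>))"
    unfolding vanishing_def
  proof (intro allI impI)
    fix \<alpha> assume "\<exists>m\<in>?M. tail L m \<alpha> < 0"
    then obtain m where m: "m \<in> ?M" "tail L m \<alpha> < 0" by blast
    then have "tail L m (\<alpha> \<circ> ?\<tau>) < 0" using tail_swap[of m j L \<alpha>] j by simp
    then show "Q (\<alpha> \<circ> ?\<tau>) = 0" using vanishingD[OF vQ m(1)] by blast
  qed
  have S_eq: "S = (\<lambda>\<alpha>. 1 * Q \<alpha> + 1 * Q (\<alpha> \<circ> ?\<tau>))" by (simp add: S_def fun_eq_iff)
  have vS: "vanishing ?M L S" unfolding S_eq by (rule vanishing_lincomb[OF vQ vQt])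
  have phi_p: "?\<phi> ?p = qfps" using u by (simp add: wfac_def qfps_def del: of_nat_add of_nat_Suc)
  have Q_rec: "Q \<gamma> + Q (shift ?p 1 \<gamma>) = ?F \<gamma> - ?F (shift ?p 1 \<gamma>)" for \<gamma>
  proof -
    have "rop ?p (1 + fps_X) Q = rop ?p ((1 + fps_X) * qfps) ?F" unfolding Q_def by (rule rop_rop[OF vanishing_dprod pr])
    also have "(1 + fps_X) * qfps = 1 - fps_X"
      unfolding qfps_def using alt_fps_inverse by (simp add: mult_ac)
    finally have "rop ?p (1 + fps_X) Q \<gamma> = rop ?p (1 + fps_const (- 1) * fps_X) ?F \<gamma>" unfolding one_minus_fps_X by simp
    then show ?thesis
      using rop_linear_poly[of ?p 1 1 Q \<gamma>] rop_linear_poly[of ?p 1 "- 1" ?F \<gamma>] by simp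
  qed
  \<comment> \<open>\<open>Q_rec\<close> expresses (1 + R) Q = (1 - R) F. It is added at \<gamma>
    and at the exchange of R \<gamma>; the right-hand sides cancel because F is symmetric.\<close>
  have alt: "S (shift ?p 1 \<gamma>) = - S \<gamma>" for \<gamma>
  proof -
    have sw: "shift ?p 1 (shift ?p 1 \<gamma> \<circ> ?\<tau>) = \<gamma> \<circ> ?\<tau>"
      by (auto simp: shift_def fun_eq_iff transpose_def)
    have e: "Q (shift ?p 1 \<gamma> \<circ> ?\<tau>) + Q (\<gamma> \<circ> ?\<tau>) = ?F (shift ?p 1 \<gamma>) - ?F \<gamma>"
      using Q_rec[of "shift ?p 1 \<gamma> \<circ> ?\<tau>"] unfolding sw Fsym .
    have "(Q \<gamma> + Q (shift ?p 1 \<gamma>)) + (Q (shift ?p 1 \<gamma> \<circ> ?\<tau>) + Q (\<gamma> \<circ> ?\<tau>)) = 0"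
      unfolding e Q_rec by simp
    then show ?thesis unfolding S_def eq_neg_iff_add_eq_0 by (simp only: add_ac)
  qed
  have alts: "S (shift ?p s \<gamma>) = (- 1) ^ s * S \<gamma>" for s \<gamma>
  proof (induction s)
    case (Suc s)
    have "shift ?p (Suc s) \<gamma> = shift ?p 1 (shift ?p s \<gamma>)" by (simp add: shift_shift)
    then show ?case using alt Suc by simp
  qed simp
  have S_sym: "S (\<gamma> \<circ> ?\<tau>) = S \<gamma>" for \<gamma> by (simp add: S_def comp_assoc add.commute)
  \<comment> \<open>Here (1 - X)/(1 + X) = 1 + 2 \<Sum> (-1)^s X^s meets two rows with the same
    upper index 1-i and the same degree n. The bound k + i \<le> n is the condition k + (i-1) < n of
    \<open>quad_in_Jideal\<close>.\<close>
  have QJ: "Q \<gamma> \<in> Jideal k" if \<gamma>: "\<gamma> j = int n" "\<gamma> (Suc j) = int n" "k + i \<le> n" for \<gamma> n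
  proof -
    define R where "R = (\<Prod>r\<in>{1..L} - {j} - {Suc j}. dbl (\<beta> r) (\<gamma> r))"
    let ?d = "dbl (- int i + 1)"
    have Fs: "?F (shift ?p s \<gamma>) = ?d (int n + int s) * ?d (int n - int s) * R" for s
    proof -
      have "?F (shift ?p s \<gamma>) = dbl (\<beta> j) (shift ?p s \<gamma> j) * (dbl (\<beta> (Suc j)) (shift ?p s \<gamma> (Suc j)) *
          (\<Prod>r\<in>{1..L} - {j} - {Suc j}. dbl (\<beta> r) (shift ?p s \<gamma> r)))"
        unfolding dprod_def using j by (subst prod.remove[of _ j], simp, simp, subst prod.remove[of _ "Suc j"]) auto
      also have "(\<Prod>r\<in>{1..L} - {j} - {Suc j}. dbl (\<beta> r) (shift ?p s \<gamma> r)) = R"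
        unfolding R_def by (rule prod.cong) (auto simp: shift_def)
      finally have "?F (shift ?p s \<gamma>) = dbl (\<beta> j) (shift ?p s \<gamma> j) * (dbl (\<beta> (Suc j)) (shift ?p s \<gamma> (Suc j)) * R)" .
      moreover have "shift ?p s \<gamma> j = int n + int s" "shift ?p s \<gamma> (Suc j) = int n - int s"
        using \<gamma> by (simp_all add: shift_def)
      ultimately show ?thesis by (simp only: b mult.assoc)
    qed
    have "Q \<gamma> = (\<Sum>s\<in>{..n}. of_int (fps_nth qfps s) * ?F (shift ?p s \<gamma>))"
      unfolding Q_def rop_def
    proof (rule Sum_any.expand_superset)
      have "?F (shift ?p s \<gamma>) = 0" if "n < s" for s
        unfolding Fs using that by (simp add: dbl_def cup_neg)
      then show "{s. of_int (fps_nth qfps s) * ?F (shift ?p s \<gamma>) \<noteq> 0} \<subseteq> {..n}"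
        by (auto simp: not_less[symmetric])
    qed simp
    also have "{..n} = insert 0 {1..n}" by auto
    also have "(\<Sum>s\<in>insert 0 {1..n}. of_int (fps_nth qfps s) * ?F (shift ?p s \<gamma>)) =
      ?d (int n) * ?d (int n) * R + (\<Sum>s=1..n. of_int (fps_nth qfps s) * ?F (shift ?p s \<gamma>))"
      unfolding Fs by (subst sum.insert) (auto simp: qfps_nth)
    also have "(\<Sum>s=1..n. of_int (fps_nth qfps s) * ?F (shift ?p s \<gamma>)) =
      (\<Sum>s=1..n. 2 * ((- 1) ^ s * ?d (int (n + s)) * ?d (int (n - s))) * R)"
      by (rule sum.cong[OF refl]) (simp add: Fs qfps_nth of_nat_diff mult.assoc)
    also have "?d (int n) * ?d (int n) * R + \<dots> = R * quad (- int i + 1) n"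
      by (simp add: quad_def sum_distrib_left distrib_left mult_ac)
    finally have "Q \<gamma> = R * quad (- int (i - 1)) n" using i by (simp add: of_nat_diff)
    then show ?thesis using quad_in_Jideal[of k "i - 1" n] \<gamma>(3) i by (simp add: Jideal_mult)
  qed
  define reg where "reg \<gamma> \<longleftrightarrow> 2 * (int k + int i) \<le> \<gamma> j + \<gamma> (Suc j)" for \<gamma> :: "nat \<Rightarrow> int"
  \<comment> \<open>For an even sum of the degrees, S \<gamma> is up to sign the value at equal
    degrees, which is 2Q; for an odd sum, symmetry and sign change force S \<gamma> = 0. The half is
    chosen together with its membership, as the ideal is not assumed closed under halving.\<close>
  have half: "\<exists>y. S \<gamma> = 2 * y \<and> (reg \<gamma> \<longrightarrow> y \<in> Jideal k)" for \<gamma>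
  proof (cases "even (\<gamma> j + \<gamma> (Suc j))")
    case True
    define N where "N = (\<gamma> j + \<gamma> (Suc j)) div 2"
    have N: "\<gamma> (Suc j) = 2 * N - \<gamma> j" using True by (simp add: N_def)
    define \<delta> where "\<delta> = \<gamma>(j := N, Suc j := N)"
    have "\<delta> \<circ> ?\<tau> = \<delta>" by (auto simp: \<delta>_def fun_eq_iff transpose_def)
    then have S\<delta>: "S \<delta> = 2 * Q \<delta>" by (simp add: S_def)
    have Q\<delta>: "Q \<delta> \<in> Jideal k" if "reg \<gamma>"
    proof (rule QJ[of _ "nat N"])
      have "int k + int i \<le> N" using that N by (simp add: reg_def)
      then show "\<delta> j = int (nat N)" "\<delta> (Suc j) = int (nat N)" "k + i \<le> nat N" by (auto simp: \<delta>_def)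
    qed
    have "\<exists>s. S \<gamma> = (- 1) ^ s * S \<delta>"
    proof (cases "\<gamma> j \<le> N")
      case True
      then have "\<delta> = shift ?p (nat (N - \<gamma> j)) \<gamma>" using N by (auto simp: \<delta>_def shift_def fun_eq_iff)
      then have "S \<delta> = (- 1) ^ nat (N - \<gamma> j) * S \<gamma>" using alts by simp
      then have "S \<gamma> = (- 1) ^ nat (N - \<gamma> j) * S \<delta>" by (cases "even (nat (N - \<gamma> j))") simp_all
      then show ?thesis by blast
    next
      case False
      then have "\<gamma> = shift ?p (nat (\<gamma> j - N)) \<delta>" using N by (auto simp: \<delta>_def shift_def fun_eq_iff)
      then have "S \<gamma> = (- 1) ^ nat (\<gamma> j - N) * S \<delta>" using alts by metis
      then show ?thesis by blast
    qed
    then obtain s where "S \<gamma> = (- 1) ^ s * S \<delta>" by blast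
    then have "S \<gamma> = 2 * ((- 1) ^ s * Q \<delta>)" by (simp add: S\<delta>)
    then show ?thesis using Q\<delta> Jideal_mult by blast
  next
    case False
    have "S \<gamma> = - S \<gamma>"
    proof (cases "\<gamma> j \<le> \<gamma> (Suc j)")
      case True
      have "\<gamma> \<circ> ?\<tau> = shift ?p (nat (\<gamma> (Suc j) - \<gamma> j)) \<gamma>"
        using True by (auto simp: shift_def fun_eq_iff transpose_def)
      then have "S \<gamma> = (- 1) ^ nat (\<gamma> (Suc j) - \<gamma> j) * S \<gamma>" using alts S_sym by metis
      moreover have "odd (nat (\<gamma> (Suc j) - \<gamma> j))" using False True by (simp add: even_nat_iff)
      ultimately show ?thesis by simp
    next
      case le: False
      have "\<gamma> = shift ?p (nat (\<gamma> j - \<gamma> (Suc j))) (\<gamma> \<circ> ?\<tau>)"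
        using le by (auto simp: shift_def fun_eq_iff transpose_def)
      then have "S \<gamma> = (- 1) ^ nat (\<gamma> j - \<gamma> (Suc j)) * S \<gamma>" using alts S_sym by metis
      moreover have "odd (nat (\<gamma> j - \<gamma> (Suc j)))" using False le by (simp add: even_nat_iff)
      ultimately show ?thesis by simp
    qed
    then have "2 * S \<gamma> = 0" by (simp add: eq_neg_iff_add_eq_0 mult_2)
    then have "S \<gamma> = 0" by simp
    then show ?thesis using Jideal_0 by (intro exI[of _ 0]) simp
  qed
  then obtain T where T: "\<And>\<gamma>. S \<gamma> = 2 * T \<gamma>" "\<And>\<gamma>. reg \<gamma> \<Longrightarrow> T \<gamma> \<in> Jideal k" by metis
  have vT: "vanishing ?M L T" using vS T(1) by (auto simp: vanishing_def)
  have qr: "set ?qs \<subseteq> rpairs ?M L" by (rule other_pairs_rpairs_minus[OF j(1)])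
  have inv: "?\<phi> (swap_pair j p) = ?\<phi> p" if "p \<in> set ?qs" for p
  proof (rule wfac_swap[OF g i j(1) _ _ _ that])
    show "0 < w (int (k + j)) * w (int (k + Suc j))" unfolding u by (rule mult_neg_neg) (use i in auto)
  qed (use u i in \<open>simp_all add: sgen_apply del: of_nat_add of_nat_Suc\<close>)
  \<comment> \<open>The sequence \<alpha> has equal entries j and j+1, so both summands of S
    contribute the same value there.\<close>
  have "\<alpha> \<circ> ?\<tau> = \<alpha>" using \<alpha> by (auto simp: fun_eq_iff transpose_def)
  then have t1: "rops ?\<phi> ?qs Q \<alpha> = rops ?\<phi> ?qs (\<lambda>\<alpha>. Q (\<alpha> \<circ> ?\<tau>)) \<alpha>"
    using rops_swap_invariant[where F = Q and \<phi> = "wfac k w", OF vQt qr mset_swap_other_pairs[OF j] inv, of \<alpha>] by simp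
  have t2: "rops ?\<phi> ?qs S \<alpha> = rops ?\<phi> ?qs Q \<alpha> + rops ?\<phi> ?qs (\<lambda>\<alpha>. Q (\<alpha> \<circ> ?\<tau>)) \<alpha>"
    unfolding S_eq rops_lincomb[OF vQ vQt qr] by simp
  have twice: "rops ?\<phi> ?qs S \<alpha> = 2 * rops ?\<phi> ?qs Q \<alpha>" unfolding t2 t1[symmetric] by (rule mult_2[symmetric])
  have up: "rops ?\<phi> (upper_pairs j hs) S = S" if "set hs \<subseteq> {1..<j}" for hs
    using that
  proof (induction hs)
    case (Cons h hs)
    have h: "1 \<le> h" "h < j" using Cons.prems by auto
    have "?u h < ?u j" using grassmannian_last_less_iff[OF g h(1) j(1)] h(2) by blast
    then have f: "?\<phi> (h, j) = qfps" "?\<phi> (h, Suc j) = qfps"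
      using u by (simp_all add: wfac_def qfps_def del: of_nat_add of_nat_Suc)
    have "rops ?\<phi> (upper_pairs j (h # hs)) S = rop (h, j) (?\<phi> (h, j)) (rop (h, Suc j) (?\<phi> (h, Suc j)) (rops ?\<phi> (upper_pairs j hs) S))"
      by (simp add: upper_pairs_def)
    also have "\<dots> = rop (h, j) qfps (rop (h, Suc j) qfps S)" using Cons f by simp
    also have "\<dots> = S" by (rule rop_alternating[OF vS h _ _ alt]) (use j in auto)
    finally show ?case .
  qed (simp add: upper_pairs_def)
  have lr: "set (lower_pairs L j) \<subseteq> rpairs ?M L"
    using qr mset_eq_setD[OF mset_other_pairs[OF j]] by auto
  have "rops ?\<phi> ?qs S \<alpha> = rops ?\<phi> (lower_pairs L j @ upper_pairs j [1..<j]) S \<alpha>"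
    using rops_perm[OF vS qr mset_other_pairs[OF j], of ?\<phi>] by simp
  also have "\<dots> = rops ?\<phi> (lower_pairs L j) S \<alpha>" using up[of "[1..<j]"] by simp
  finally have e1: "rops ?\<phi> ?qs S \<alpha> = rops ?\<phi> (lower_pairs L j) S \<alpha>" .
  have S2: "S = (\<lambda>\<gamma>. 2 * T \<gamma> + 0 * T \<gamma>)" using T(1) by (simp add: fun_eq_iff)
  have e2: "rops ?\<phi> (lower_pairs L j) S \<alpha> = 2 * rops ?\<phi> (lower_pairs L j) T \<alpha>"
    unfolding S2 rops_lincomb[OF vT vT lr] by simp
  \<comment> \<open>The factor 2 is cancelled in Z[c,t], before anything is reduced modulo the
    ideal.\<close>
  have "2 * rops ?\<phi> ?qs Q \<alpha> = 2 * rops ?\<phi> (lower_pairs L j) T \<alpha>"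
    using twice e1 e2 by (simp only:)
  then have QT: "rops ?\<phi> ?qs Q \<alpha> = rops ?\<phi> (lower_pairs L j) T \<alpha>" by simp
  have "rops ?\<phi> (all_pairs L) ?F \<alpha> = rops ?\<phi> (?qs @ [?p]) ?F \<alpha>"
    using rops_perm[OF vanishing_dprod all_pairs_rpairs, of L "?qs @ [?p]"] mset_all_pairs[OF j] by simp
  also have "\<dots> = rops ?\<phi> ?qs Q \<alpha>" by (simp add: Q_def phi_p)
  also have "\<dots> = rops ?\<phi> (lower_pairs L j) T \<alpha>" by (rule QT)
  also have "\<dots> \<in> Jideal k"
  proof (rule rops_closed[where P = reg])
    show "of_int n * x \<in> Jideal k" if "x \<in> Jideal k" for n x using that by (rule Jideal_mult)
    show "T \<gamma> \<in> Jideal k" if "reg \<gamma>" for \<gamma> using T(2) that .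
    show "reg (shift p s \<gamma>)" if "p \<in> set (lower_pairs L j)" "reg \<gamma>" for p s \<gamma>
      using that by (auto simp: lower_pairs_def reg_def shift_def)
    show "reg \<alpha>" using \<alpha> by (simp add: reg_def)
  qed (rule Jideal_0, rule Jideal_add)
  finally show ?thesis .
qed

lemma theta_none:
  assumes lam: "kstrict k lam" and i: "1 \<le> i" and w: "w = welt k lam"
    and nv: "\<And>j. 1 \<le> j \<Longrightarrow> w (int (k + j)) \<noteq> int i" "\<And>j. 1 \<le> j \<Longrightarrow> w (int (k + j)) \<noteq> - int i - 1"
  shows "vswap i (theta_double k lam) = theta_double k lam"
proof -
  let ?L = "length lam"
  have b: "wbeta k w r \<noteq> int i \<and> wbeta k w r \<noteq> - int i" if "1 \<le> r" for r
    using nv[OF that] i by (auto simp: wbeta_def simp del: of_nat_add)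
  have vd: "vswap i (dprod ?L (wbeta k w) \<alpha>) = dprod ?L (wbeta k w) \<alpha>" for \<alpha>
    unfolding dprod_def rhom_prod[OF rhom_vswap] by (rule prod.cong) (use b vswap_dbl[OF i] in auto)
  show ?thesis
    unfolding theta_double_rops[OF lam order_refl w] rops_rhom[OF vanishing_dprod all_pairs_rpairs rhom_vswap] vd ..
qed

text \<open>Only row j is moved by s_i, and afterwards its upper index equals that of row j+1. The
  positive case then vanishes outright; in the negative case both degrees are k + i once the box is
  removed from row j.\<close>

lemma theta_adjacent:
  assumes lam: "kstrict k lam" and i: "1 \<le> i" and w: "w = welt k lam" and j: "1 \<le> j"
    and val: "(w (int (k + j)) = int i \<and> w (int (k + Suc j)) = int i + 1) \<or>
      (w (int (k + j)) = - int i - 1 \<and> w (int (k + Suc j)) = - int i)"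
  shows "vswap i (theta_double k lam) - theta_double k lam \<in> Jideal k"
proof -
  have g: "grassmannian k w" and pl: "\<And>r. 1 \<le> r \<Longrightarrow> part lam r = grass_part k w r"
    using welt[OF lam] w by auto
  have W: "w \<in> Winf" using g by (rule grassmannian_Winf)
  let ?u = "\<lambda>r. w (int (k + r))" and ?b = "wbeta k w"
  let ?b' = "?b(j := ?b j + 1)"
  define L where "L = length lam + Suc j"
  have L: "length lam \<le> L" "j \<le> L" "Suc j \<le> L" by (simp_all add: L_def)
  have other: "\<bar>?u r\<bar> \<noteq> int i \<and> \<bar>?u r\<bar> \<noteq> int i + 1" if "1 \<le> r" "r \<noteq> j" "r \<noteq> Suc j" for r
    using Winf_inj_abs[OF W, of "k + r" "k + j"] Winf_inj_abs[OF W, of "k + r" "k + Suc j"] that j val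
    by (auto simp del: of_nat_add of_nat_Suc)
  have bj: "?b j = int i \<or> ?b j = - int i" using val i by (auto simp: wbeta_def simp del: of_nat_add)
  have nb: "?b r \<noteq> int i \<and> ?b r \<noteq> - int i" if r: "r \<in> {1..L}" "r \<noteq> j" for r
  proof (cases "r = Suc j")
    case True
    then have "?b r = int i + 1 \<or> ?b r = - int i + 1"
      using val i by (auto simp: wbeta_def simp del: of_nat_add of_nat_Suc)
    \<comment> \<open>The upper index of row j+1 is i+1 or 1-i; the equation 1-i = i has no integer
      solution.\<close>
    then show ?thesis using i by presburger
  next
    case False
    have "1 \<le> r" using r by simp
    then show ?thesis using other[of r] r False by (auto simp: wbeta_def simp del: of_nat_add)
  qed
  let ?R = "rops (wfac k w) (all_pairs L) (dprod L ?b') (\<lambda>r. int (part lam r) - unit_seq j r)"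
  have "vswap i (theta_double k lam) = theta_double k lam + (Xv i - Xv (Suc i)) *
      rops (wfac k w) (all_pairs L) (\<lambda>\<alpha>. dprod L ?b' (\<lambda>r. \<alpha> r - unit_seq j r)) (\<lambda>r. int (part lam r))"
    unfolding theta_double_rops[OF lam L(1) w]
    by (rule vswap_rops_dprod[OF vswap_dprod_single[where \<beta> = ?b, OF i j L(2) bj nb] vanishing_dprod_shift])
  then have eq: "vswap i (theta_double k lam) = theta_double k lam + (Xv i - Xv (Suc i)) * ?R"
    unfolding rops_translate .
  have "?R \<in> Jideal k"
    using val
  proof
    assume u: "?u j = int i \<and> ?u (Suc j) = int i + 1"
    have b: "?b' j = ?b' (Suc j)" using u i by (simp add: wbeta_def del: of_nat_add of_nat_Suc)
    have "w (int p) \<noteq> int i + 1" if "1 \<le> p" "p \<le> k" for p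
      using Winf_inj_abs[OF W, of p "k + Suc j"] that u by (auto simp del: of_nat_add of_nat_Suc)
    then have "{p. 1 \<le> p \<and> p \<le> k \<and> w (int p) > int i} = {p. 1 \<le> p \<and> p \<le> k \<and> w (int p) > int i + 1}"
      by (force simp: less_le)
    then have "part lam (Suc j) = part lam j"
      using pl[of j] pl[of "Suc j"] j u i by (simp add: grass_part_def del: of_nat_add of_nat_Suc)
    then have \<alpha>: "int (part lam (Suc j)) - unit_seq j (Suc j) = int (part lam j) - unit_seq j j + 1"
      by (simp add: unit_seq_def)
    have "?R = 0"
      by (rule rops_ascent_pos[OF g i j L(3) conjunct1[OF u] conjunct2[OF u] b \<alpha>])
    then show ?thesis using Jideal_0 by simp
  next
    assume u: "?u j = - int i - 1 \<and> ?u (Suc j) = - int i"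
    have b: "?b' j = - int i + 1" "?b' (Suc j) = - int i + 1"
      using u i by (simp_all add: wbeta_def del: of_nat_add of_nat_Suc)
    have "int (part lam j) = int k + int i + 1"
      using pl[OF j] grass_part_neg[of w k j] u i by (simp del: of_nat_add)
    moreover have "int (part lam (Suc j)) = int k + int i"
      using pl[of "Suc j"] grass_part_neg[of w k "Suc j"] u i by (simp del: of_nat_add of_nat_Suc)
    ultimately have \<alpha>: "int (part lam j) - unit_seq j j = int k + int i"
      "int (part lam (Suc j)) - unit_seq j (Suc j) = int k + int i"
      by (simp_all add: unit_seq_def)
    show ?thesis
      by (rule rops_ascent_neg[OF g i j L(3) conjunct1[OF u] conjunct2[OF u] b \<alpha>])
  qed
  then show ?thesis unfolding eq using Jideal_mult by simp
qed

lemma theta_ascent: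
  assumes lam: "kstrict k lam" and i: "1 \<le> i" and w: "w = welt k lam"
    and asc: "wlen (sgen i \<circ> w) = Suc (wlen w)"
  shows "vswap i (theta_double k lam) - theta_double k lam \<in> Jideal k"
proof -
  have g: "grassmannian k w" using welt[OF lam] w by simp
  have "inv w (int i) < inv w (int i + 1)" using wlen_left_desc(2)[OF grassmannian_Winf[OF g]] asc by blast
  then have nd: "\<not> inv w (int i + 1) < inv w (int i)" by simp
  from g i show ?thesis
  proof (cases rule: left_reflection_cases)
    case low then show ?thesis using nd by blast
  next
    case none
    have "vswap i (theta_double k lam) = theta_double k lam" by (rule theta_none[OF lam i w none(1,2)])
    then show ?thesis using Jideal_0 by simp
  next
    case (pos j)
    show ?thesis by (rule theta_adjacent[OF lam i w pos(1)]) (use pos(2,3) in blast)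
  next
    case (neg j)
    show ?thesis by (rule theta_adjacent[OF lam i w neg(1)]) (use neg(2,3) in blast)
  qed
qed

section \<open>Reduced factorizations\<close>

lemma kstrict_lower:
  assumes lam: "kstrict k lam" and i: "1 \<le> i" and w: "w = welt k lam"
    and desc: "wlen w = Suc (wlen (sgen i \<circ> w))"
  obtains mu j where "kstrict k mu" "welt k mu = sgen i \<circ> w" "lowers k w i j"
proof -
  have g: "grassmannian k w" using welt[OF lam] w by simp
  have "inv w (int i + 1) < inv w (int i)" using wlen_left_desc(1)[OF grassmannian_Winf[OF g]] desc by blast
  then have nd: "\<not> inv w (int i) < inv w (int i + 1)" by simp
  from g i show thesis
  proof (cases rule: left_reflection_cases)
    case (low j)
    have "sgen i \<circ> w \<in> {w. grassmannian k w}" using lowers_grassmannian[OF g low(1)] by simp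
    then obtain mu where "kstrict k mu" "welt k mu = sgen i \<circ> w"
      using bij_betw_imp_surj_on[OF bij_betw_welt[of k]] by (metis (mono_tags, lifting) imageE mem_Collect_eq)
    then show thesis using low(1) by (rule that)
  qed (use nd in blast)+
qed

lemma welt_Winf: "kstrict k lam \<Longrightarrow> welt k lam \<in> Winf"
  using welt(1) grassmannian_Winf by blast

lemma reduced_factsD:
  assumes "(u, \<nu>) \<in> reduced_facts k lam"
  shows "u \<in> Sinf" "u \<in> Winf" "kstrict k \<nu>" "u \<circ> welt k \<nu> = welt k lam" "wlen (welt k lam) = wlen u + wlen (welt k \<nu>)"
  using assms Sinf_Winf by (auto simp: reduced_facts_def)

lemma id_Sinf: "id \<in> Sinf"
  by (simp add: Sinf_iff)

lemma id_reduced_facts: "kstrict k lam \<Longrightarrow> (id, lam) \<in> reduced_facts k lam"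
  by (simp add: reduced_facts_def id_Sinf)

lemma reduced_facts_id:
  assumes "kstrict k lam" "(id, \<nu>) \<in> reduced_facts k lam"
  shows "\<nu> = lam"
proof -
  have "kstrict k \<nu>" "welt k \<nu> = welt k lam" using reduced_factsD[OF assms(2)] by simp_all
  then show ?thesis using bij_betw_imp_inj_on[OF bij_betw_welt[of k]] assms(1) by (simp add: inj_on_def)
qed

text \<open>If u could be shortened on the left by s_i, so could w_\<lambda>, because lengths are
  subadditive and the factorization is reduced.\<close>

lemma reduced_facts_ascent:
  assumes asc: "wlen (sgen i \<circ> welt k lam) = Suc (wlen (welt k lam))" and f: "(u, \<nu>) \<in> reduced_facts k lam"
  shows "wlen (sgen i \<circ> u) = Suc (wlen u)"
proof (rule ccontr)
  note D = reduced_factsD[OF f]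
  assume "wlen (sgen i \<circ> u) \<noteq> Suc (wlen u)"
  then have u: "wlen u = Suc (wlen (sgen i \<circ> u))" using wlen_left_cases[OF D(2), of i] by blast
  have "wlen ((sgen i \<circ> u) \<circ> welt k \<nu>) \<le> wlen (sgen i \<circ> u) + wlen (welt k \<nu>)"
    using D(2) welt_Winf[OF D(3)] by (intro wlen_comp_le) simp_all
  moreover have "(sgen i \<circ> u) \<circ> welt k \<nu> = sgen i \<circ> welt k lam" unfolding comp_assoc D(4) ..
  ultimately show False using asc u D(5) by simp
qed

text \<open>Stripping s_i from the left of u turns a reduced factorization of w_\<lambda> into one
  of s_i w_\<lambda>. Conversely, prefixing s_i must lengthen u, since otherwise w_\<lambda> would
  be too short.\<close>

lemma reduced_facts_descent:
  assumes i: "1 \<le> i" and mu: "welt k mu = sgen i \<circ> welt k lam"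
    and desc: "wlen (welt k lam) = Suc (wlen (welt k mu))"
  shows "bij_betw (\<lambda>(u, \<nu>). (sgen i \<circ> u, \<nu>))
    {(u, \<nu>) \<in> reduced_facts k lam. wlen u = Suc (wlen (sgen i \<circ> u))} (reduced_facts k mu)"
proof (rule bij_betw_byWitness[where f' = "\<lambda>(u, \<nu>). (sgen i \<circ> u, \<nu>)"])
  show "(\<lambda>(u, \<nu>). (sgen i \<circ> u, \<nu>)) ` {(u, \<nu>) \<in> reduced_facts k lam. wlen u = Suc (wlen (sgen i \<circ> u))} \<subseteq> reduced_facts k mu"
  proof (clarsimp)
    fix u \<nu> assume f: "(u, \<nu>) \<in> reduced_facts k lam" and u: "wlen u = Suc (wlen (sgen i \<circ> u))"
    note D = reduced_factsD[OF f]
    have "(sgen i \<circ> u) \<circ> welt k \<nu> = welt k mu" unfolding comp_assoc D(4) mu ..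
    then show "(sgen i \<circ> u, \<nu>) \<in> reduced_facts k mu"
      using Sinf_sgen_comp[OF D(1) i] D(3,5) desc u by (simp add: reduced_facts_def)
  qed
  show "(\<lambda>(u, \<nu>). (sgen i \<circ> u, \<nu>)) ` reduced_facts k mu \<subseteq> {(u, \<nu>) \<in> reduced_facts k lam. wlen u = Suc (wlen (sgen i \<circ> u))}"
  proof (clarsimp)
    fix v \<nu> assume f: "(v, \<nu>) \<in> reduced_facts k mu"
    note D = reduced_factsD[OF f]
    have w: "(sgen i \<circ> v) \<circ> welt k \<nu> = welt k lam" unfolding comp_assoc D(4) mu by simp
    have "wlen ((sgen i \<circ> v) \<circ> welt k \<nu>) \<le> wlen (sgen i \<circ> v) + wlen (welt k \<nu>)"
      using D(2) welt_Winf[OF D(3)] by (intro wlen_comp_le) simp_all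
    then have "wlen (sgen i \<circ> v) = Suc (wlen v)"
      using wlen_left_cases[OF D(2), of i] D(5) desc unfolding w by linarith
    then show "(sgen i \<circ> v, \<nu>) \<in> reduced_facts k lam \<and> wlen (sgen i \<circ> v) = Suc (wlen v)"
      using Sinf_sgen_comp[OF D(1) i] D(3,5) desc w by (simp add: reduced_facts_def)
  qed
qed auto

lemma ex_left_descent:
  assumes "u \<in> Sinf" "u \<noteq> id"
  obtains i where "1 \<le> i" "wlen u = Suc (wlen (sgen i \<circ> u))"
proof -
  have W: "u \<in> Winf" using assms(1) by (rule Sinf_Winf)
  have "inv u \<noteq> id"
  proof
    assume "inv u = id"
    then have "inv (inv u) = id" by simp
    then show False using assms(2) W by simp
  qed
  then obtain i where i: "inv u (int i + 1) < inv u (int i)" using ex_descent[of "inv u"] W by auto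
  have "i \<noteq> 0"
  proof
    assume "i = 0"
    moreover have "0 < inv u 1" using Sinf_inv[OF assms(1)] by (simp add: Sinf_iff)
    ultimately show False using i Winf_zero[of "inv u"] W by simp
  qed
  then show thesis using i wlen_left_desc(1)[OF W, of i] by (intro that[of i]) simp_all
qed

text \<open>A factorization with u \<noteq> id begins with some i \<ge> 1 that is a left descent of
  w_\<lambda>. There are finitely many such i, as the inverse of w_\<lambda> fixes all large
  integers, and those beginning with i correspond to factorizations of a shorter element.\<close>

lemma finite_reduced_facts: "kstrict k lam \<Longrightarrow> finite (reduced_facts k lam)"
proof (induction "wlen (welt k lam)" arbitrary: lam rule: less_induct)
  case less
  let ?w = "welt k lam"
  have W: "?w \<in> Winf" using less.prems by (rule welt_Winf)
  define D where "D = {i. 1 \<le> i \<and> wlen ?w = Suc (wlen (sgen i \<circ> ?w))}"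
  let ?A = "\<lambda>i. {(u, \<nu>) \<in> reduced_facts k lam. wlen u = Suc (wlen (sgen i \<circ> u))}"
  obtain n :: nat where n: "\<forall>x. int n < \<bar>x\<bar> \<longrightarrow> inv ?w x = x"
    using inv_Winf[OF W] unfolding Winf_iff by blast
  have "D \<subseteq> {..n}"
  proof
    fix i assume "i \<in> D"
    then have "inv ?w (int i + 1) < inv ?w (int i)" using wlen_left_desc(1)[OF W] by (simp add: D_def)
    then show "i \<in> {..n}" using n[rule_format, of "int i"] n[rule_format, of "int i + 1"] by (cases "i \<le> n") auto
  qed
  then have fD: "finite D" by (rule finite_subset) simp
  have fA: "finite (?A i)" if i: "i \<in> D" for i
  proof -
    have i1: "1 \<le> i" and d: "wlen ?w = Suc (wlen (sgen i \<circ> ?w))" using i by (simp_all add: D_def)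
    obtain mu j where mu: "kstrict k mu" "welt k mu = sgen i \<circ> ?w" by (rule kstrict_lower[OF less.prems i1 refl d])
    have "finite (reduced_facts k mu)" by (rule less.hyps[OF _ mu(1)]) (use d mu(2) in simp)
    then show ?thesis using bij_betw_finite[OF reduced_facts_descent[OF i1 mu(2)]] d mu(2) by simp
  qed
  have "reduced_facts k lam \<subseteq> insert (id, lam) (\<Union>i\<in>D. ?A i)"
  proof
    fix p assume p: "p \<in> reduced_facts k lam"
    obtain u \<nu> where u: "p = (u, \<nu>)" by fastforce
    show "p \<in> insert (id, lam) (\<Union>i\<in>D. ?A i)"
    proof (cases "u = id")
      case True
      then show ?thesis using reduced_facts_id[OF less.prems] p u by simp
    next
      case False
      have "u \<in> Sinf" using reduced_factsD(1) p u by blast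
      then obtain i where i: "1 \<le> i" "wlen u = Suc (wlen (sgen i \<circ> u))" using False by (rule ex_left_descent)
      have "wlen (sgen i \<circ> ?w) \<noteq> Suc (wlen ?w)"
        using reduced_facts_ascent[of i k lam u \<nu>] p u i(2) by auto
      then have "i \<in> D" using wlen_left_cases[OF W, of i] i(1) by (simp add: D_def)
      then show ?thesis using p u i(2) by blast
    qed
  qed
  then show ?case by (rule finite_subset) (use fD fA in blast)
qed

section \<open>The sum over reduced factorizations\<close>

definition fact_term :: "nat \<Rightarrow> (int \<Rightarrow> int) \<times> nat list \<Rightarrow> Zct" where
  "fact_term k p = const (theta_single k (snd p)) * peval (schubert (inv (fst p))) (\<lambda>i. - Xv i)"

definition fact_sum :: "nat \<Rightarrow> nat list \<Rightarrow> Zct" where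
  "fact_sum k lam = (\<Sum>p\<in>reduced_facts k lam. fact_term k p)"

lemma vswap_peval_neg:
  assumes i: "1 \<le> i"
  shows "vswap i (peval f (\<lambda>j. - Xv j)) = peval (vswap i f) (\<lambda>j. - Xv j :: Zct)"
proof -
  have "peval (vswap i f) (\<lambda>j. - Xv j :: Zct) = peval f (\<lambda>j. peval (vswap i (Xv j)) (\<lambda>j. - Xv j))"
    by (rule rhom_eq_peval[OF rhom_comp[OF rhom_peval rhom_vswap]])
  also have "\<dots> = peval f (\<lambda>j. vswap i (- Xv j))"
  proof (rule peval_cong)
    fix j :: nat assume j: "1 \<le> j"
    have "1 \<le> transpose i (Suc i) j" using i j by (simp add: transpose_def)
    then show "peval (vswap i (Xv j)) (\<lambda>j. - Xv j) = vswap i (- Xv j :: Zct)"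
      unfolding rhom_uminus[OF rhom_vswap] vswap_Xv[OF i j] by (rule peval_Xv)
  qed
  finally show ?thesis unfolding rhom_peval_apply[OF rhom_vswap] by simp
qed

text \<open>The substitution of -t reverses the sign of t_i - t_{i+1}, which turns s_i f = f - (t_i
  - t_{i+1}) (ddiff of f) into the same shape with a plus sign, matching the rule for
  \<Theta>_\<lambda>.\<close>

lemma vswap_peval_neg_ddiff:
  assumes i: "1 \<le> i"
  shows "vswap i (peval f (\<lambda>j. - Xv j)) =
    peval f (\<lambda>j. - Xv j) + (Xv i - Xv (Suc i)) * (peval (ddiff i f) (\<lambda>j. - Xv j) :: Zct)"
proof -
  let ?e = "\<lambda>f. peval f (\<lambda>j. - Xv j) :: Zct"
  have "?e (ddiff i f * (Xv i - Xv (Suc i))) = ?e (f - vswap i f)" unfolding ddiff[OF i] ..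
  then have "?e (ddiff i f) * (- Xv i - - Xv (Suc i)) = ?e f - ?e (vswap i f)"
    unfolding rhom_mult[OF rhom_peval] rhom_diff[OF rhom_peval] using i by (simp add: peval_Xv)
  then show ?thesis unfolding vswap_peval_neg[OF i] by (simp add: algebra_simps)
qed

text \<open>Left descents of u are right descents of its inverse. The divided difference of the
  Schubert polynomial of the inverse is therefore the one for s_i u, or 0.\<close>

lemma vswap_fact_term:
  assumes i: "1 \<le> i" and u: "u \<in> Sinf"
  shows "vswap i (fact_term k (u, \<nu>)) = fact_term k (u, \<nu>) + (Xv i - Xv (Suc i)) *
    (if wlen u = Suc (wlen (sgen i \<circ> u)) then fact_term k (sgen i \<circ> u, \<nu>) else 0)"
proof -
  have W: "u \<in> Winf" using u by (rule Sinf_Winf)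
  let ?e = "\<lambda>f. peval f (\<lambda>j. - Xv j) :: Zct"
  have d: "?e (ddiff i (schubert (inv u))) =
      (if wlen u = Suc (wlen (sgen i \<circ> u)) then ?e (schubert (inv (sgen i \<circ> u))) else 0)"
  proof (cases "wlen u = Suc (wlen (sgen i \<circ> u))")
    case True
    then have "inv u (int i + 1) < inv u (int i)" using wlen_left_desc(1)[OF W] by blast
    then show ?thesis
      using True ddiff_schubert_desc[OF Sinf_inv[OF u] i] inv_comp_Winf[OF sgen_Winf W, of i] by simp
  next
    case False
    then have "inv u (int i) < inv u (int i + 1)" using wlen_left_desc(2)[OF W] wlen_left_cases[OF W] by blast
    then show ?thesis using False ddiff_schubert_asc[OF Sinf_inv[OF u] i] rhom_0[OF rhom_peval] by simp
  qed
  show ?thesis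
    unfolding fact_term_def fst_conv snd_conv vswap_mult vswap_const vswap_peval_neg_ddiff[OF i] d
    by (simp add: algebra_simps)
qed

lemma vswap_fact_sum:
  assumes i: "1 \<le> i" and lam: "kstrict k lam"
  shows "vswap i (fact_sum k lam) = fact_sum k lam + (Xv i - Xv (Suc i)) *
    (\<Sum>(u, \<nu>) | (u, \<nu>) \<in> reduced_facts k lam \<and> wlen u = Suc (wlen (sgen i \<circ> u)). fact_term k (sgen i \<circ> u, \<nu>))"
proof -
  let ?D = "\<lambda>p. wlen (fst p) = Suc (wlen (sgen i \<circ> fst p))" and ?s = "\<lambda>p. fact_term k (sgen i \<circ> fst p, snd p)"
  have "vswap i (fact_sum k lam) = (\<Sum>p\<in>reduced_facts k lam. fact_term k p + (Xv i - Xv (Suc i)) * (if ?D p then ?s p else 0))"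
    unfolding fact_sum_def rhom_sum[OF rhom_vswap]
  proof (rule sum.cong[OF refl])
    fix p assume p: "p \<in> reduced_facts k lam"
    obtain u \<nu> where u: "p = (u, \<nu>)" by fastforce
    show "vswap i (fact_term k p) = fact_term k p + (Xv i - Xv (Suc i)) * (if ?D p then ?s p else 0)"
      unfolding u fst_conv snd_conv by (rule vswap_fact_term[OF i]) (use p u reduced_factsD(1) in blast)
  qed
  also have "\<dots> = fact_sum k lam + (Xv i - Xv (Suc i)) * (\<Sum>p\<in>reduced_facts k lam. if ?D p then ?s p else 0)"
    by (simp add: fact_sum_def sum.distrib sum_distrib_left)
  also have "(\<Sum>p\<in>reduced_facts k lam. if ?D p then ?s p else 0) = (\<Sum>p\<in>{p \<in> reduced_facts k lam. ?D p}. ?s p)"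
    by (rule sum.inter_filter[OF finite_reduced_facts[OF lam], symmetric])
  finally show ?thesis by (simp add: split_beta')
qed

lemma vswap_fact_sum_ascent:
  assumes i: "1 \<le> i" and lam: "kstrict k lam" and asc: "wlen (sgen i \<circ> welt k lam) = Suc (wlen (welt k lam))"
  shows "vswap i (fact_sum k lam) = fact_sum k lam"
proof -
  have none: "{(u, \<nu>). (u, \<nu>) \<in> reduced_facts k lam \<and> wlen u = Suc (wlen (sgen i \<circ> u))} = {}"
    using reduced_facts_ascent[OF asc] by fastforce
  show ?thesis unfolding vswap_fact_sum[OF i lam] none by simp
qed

lemma vswap_fact_sum_descent:
  assumes i: "1 \<le> i" and lam: "kstrict k lam" and mu: "welt k mu = sgen i \<circ> welt k lam"
    and desc: "wlen (welt k lam) = Suc (wlen (welt k mu))"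
  shows "vswap i (fact_sum k lam) = fact_sum k lam + (Xv i - Xv (Suc i)) * fact_sum k mu"
proof -
  have "(\<Sum>(u, \<nu>) | (u, \<nu>) \<in> reduced_facts k lam \<and> wlen u = Suc (wlen (sgen i \<circ> u)). fact_term k (sgen i \<circ> u, \<nu>)) = fact_sum k mu"
    unfolding fact_sum_def
    using sum.reindex_bij_betw[OF reduced_facts_descent[OF i mu desc], of "fact_term k"]
    by (simp add: split_beta')
  then show ?thesis unfolding vswap_fact_sum[OF i lam] by simp
qed

section \<open>Constant terms\<close>

lemma lookup_mult_0:
  fixes f g :: "'a::comm_ring_1 mvpoly"
  shows "Poly_Mapping.lookup (f * g) 0 = Poly_Mapping.lookup f 0 * Poly_Mapping.lookup g 0"
proof (induction f rule: poly_mapping_single_induct)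
  case (single m a)
  show ?case
  proof (induction g rule: poly_mapping_single_induct)
    case (single n b)
    have "m + n = 0 \<longleftrightarrow> m = 0 \<and> n = 0"
    proof
      assume h: "m + n = 0"
      have "Poly_Mapping.lookup m x + Poly_Mapping.lookup n x = 0" for x
        using h by (metis lookup_add lookup_zero)
      then show "m = 0 \<and> n = 0" by (auto intro!: poly_mapping_eqI)
    qed simp
    then show ?case by (auto simp: mult_single lookup_single when_def)
  next
    case (add f g)
    then show ?case by (simp add: distrib_left lookup_add)
  qed
next
  case (add f g)
  then show ?case by (simp add: distrib_right lookup_add)
qed

lemma rhom_lookup_0: "rhom (\<lambda>f :: 'a::comm_ring_1 mvpoly. Poly_Mapping.lookup f 0)"
  by (rule rhomI) (simp_all add: lookup_add lookup_mult_0 lookup_one)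

lemma lookup_Xv_0: "Poly_Mapping.lookup (Xv i) 0 = 0"
proof -
  have "Poly_Mapping.single (i - 1) (1::nat) \<noteq> 0"
  proof
    assume h: "Poly_Mapping.single (i - 1) (1::nat) = 0"
    show False using arg_cong[OF h, of "\<lambda>m. Poly_Mapping.lookup m (i - 1)"] by simp
  qed
  then show ?thesis by (simp add: Xv_def lookup_single when_def)
qed

lemma rhom_theta:
  assumes h: "rhom h"
  shows "h (theta k lam c t) = theta k lam (\<lambda>i. h (c i)) (\<lambda>i. h (t i))"
proof -
  have "(\<lambda>\<alpha>. h (factor_prod L c t \<beta> \<alpha>)) = factor_prod L (\<lambda>i. h (c i)) (\<lambda>i. h (t i)) \<beta>" for L \<beta>
    by (simp add: fun_eq_iff factor_prod_def rhom_prod[OF h] rhom_cup[OF h])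
  then show ?thesis
    unfolding theta_rops[OF order_refl] rops_rhom[OF vanishing_factor_prod all_pairs_rpairs h] by simp
qed

lemma lookup_theta_double_0: "Poly_Mapping.lookup (theta_double k lam) 0 = theta_single k lam"
  unfolding theta_double_def theta_single_def rhom_theta[OF rhom_lookup_0] lookup_Xv_0
  by (simp add: const_def)

lemma lookup_peval_neg_0: "Poly_Mapping.lookup (peval f (\<lambda>i. - Xv i) :: Zct) 0 = of_int (Poly_Mapping.lookup f 0)"
  unfolding rhom_peval_apply[OF rhom_lookup_0] by (simp add: lookup_Xv_0 peval_zero)

text \<open>A Schubert polynomial of an element other than the identity has no constant term, so
  only the factorization with u = id survives, and it forces the second component to be
  \<lambda>.\<close>

lemma lookup_fact_sum_0:
  assumes lam: "kstrict k lam"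
  shows "Poly_Mapping.lookup (fact_sum k lam) 0 = theta_single k lam"
proof -
  have tm: "Poly_Mapping.lookup (fact_term k (u, \<nu>)) 0 =
      theta_single k \<nu> * of_int (Poly_Mapping.lookup (schubert (inv u)) 0)" for u \<nu>
    unfolding fact_term_def lookup_mult_0 lookup_peval_neg_0 by (simp add: const_def)
  have "Poly_Mapping.lookup (fact_term k p) 0 = 0" if p: "p \<in> reduced_facts k lam - {(id, lam)}" for p
  proof -
    obtain u \<nu> where u: "p = (u, \<nu>)" by fastforce
    have S: "u \<in> Sinf" using p u reduced_factsD(1) by blast
    have "u \<noteq> id" using p u reduced_facts_id[OF lam] by blast
    then have "inv u \<noteq> id" using inv_inv_Winf[OF Sinf_Winf[OF S]] by (metis inv_id)
    then show ?thesis using lookup_schubert_0[OF Sinf_inv[OF S]] unfolding u tm by simp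
  qed
  then have "(\<Sum>p\<in>reduced_facts k lam. Poly_Mapping.lookup (fact_term k p) 0) =
      (\<Sum>p\<in>{(id, lam)}. Poly_Mapping.lookup (fact_term k p) 0)"
    by (intro sum.mono_neutral_right finite_reduced_facts lam) (use id_reduced_facts[OF lam] in auto)
  then show ?thesis
    unfolding fact_sum_def rhom_sum[OF rhom_lookup_0] by (simp add: tm schubert_id inv_id lookup_one)
qed

text \<open>Modulo the ideal, the coefficient of a nonconstant monomial does not change when one of its
  variables is moved to an index that no longer occurs in the polynomial, where it vanishes.\<close>

lemma Jideal_symmetric:
  assumes sym: "\<And>i. 1 \<le> i \<Longrightarrow> vswap i h - h \<in> Jideal k" and h0: "Poly_Mapping.lookup h 0 \<in> Iideal k"
  shows "h \<in> Jideal k"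
  unfolding Jideal_def
proof (intro CollectI allI)
  fix m
  show "Poly_Mapping.lookup h m \<in> Iideal k"
  proof (cases "m = 0")
    case True
    then show ?thesis using h0 by simp
  next
    case False
    then obtain a where a: "a \<in> Poly_Mapping.keys m" by (metis keys_eq_empty ex_in_conv)
    have move: "\<exists>n. a + d \<in> Poly_Mapping.keys n \<and> Poly_Mapping.lookup h m - Poly_Mapping.lookup h n \<in> Iideal k" for d
    proof (induction d)
      case 0
      then show ?case using a Iideal_0 by (intro exI[of _ m]) simp
    next
      case (Suc d)
      then obtain n where n: "a + d \<in> Poly_Mapping.keys n" "Poly_Mapping.lookup h m - Poly_Mapping.lookup h n \<in> Iideal k"
        by blast
      let ?i = "Suc (a + d)"
      let ?n = "mon_swap ?i n"
      have "vswap ?i h - h \<in> Jideal k" by (rule sym) simp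
      then have "Poly_Mapping.lookup (vswap ?i h - h) ?n \<in> Iideal k" unfolding Jideal_def by blast
      then have "Poly_Mapping.lookup h n - Poly_Mapping.lookup h ?n \<in> Iideal k"
        by (simp add: lookup_minus lookup_vswap)
      from Iideal_add[OF n(2) this] have "Poly_Mapping.lookup h m - Poly_Mapping.lookup h ?n \<in> Iideal k" by simp
      moreover have "a + Suc d \<in> Poly_Mapping.keys ?n"
        using n(1) by (simp add: in_keys_iff lookup_mon_swap transpose_def)
      ultimately show ?case by blast
    qed
    have fin: "finite (\<Union>n\<in>Poly_Mapping.keys h. Poly_Mapping.keys n)" by simp
    then obtain N where N: "\<forall>x\<in>(\<Union>n\<in>Poly_Mapping.keys h. Poly_Mapping.keys n). x < N"
      using finite_nat_set_iff_bounded by blast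
    obtain n where n: "a + N \<in> Poly_Mapping.keys n" "Poly_Mapping.lookup h m - Poly_Mapping.lookup h n \<in> Iideal k"
      using move by blast
    have "n \<notin> Poly_Mapping.keys h" using n(1) N by fastforce
    then show ?thesis using n(2) by (simp add: in_keys_iff)
  qed
qed

section \<open>The expansion of double theta polynomials\<close>

lemma theta_double_fact_sum:
  "kstrict k lam \<Longrightarrow> theta_double k lam - fact_sum k lam \<in> Jideal k"
proof (induction "wlen (welt k lam)" arbitrary: lam rule: less_induct)
  case less
  let ?w = "welt k lam" and ?h = "theta_double k lam - fact_sum k lam"
  have W: "?w \<in> Winf" using less.prems by (rule welt_Winf)
  show ?case
  proof (rule Jideal_symmetric)
    fix i :: nat assume i: "1 \<le> i"
    consider "wlen ?w = Suc (wlen (sgen i \<circ> ?w))" | "wlen (sgen i \<circ> ?w) = Suc (wlen ?w)"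
      using wlen_left_cases[OF W] by blast
    then show "vswap i ?h - ?h \<in> Jideal k"
    proof cases
      case 1
      obtain mu j where mu: "kstrict k mu" "welt k mu = sgen i \<circ> ?w" "lowers k ?w i j"
        by (rule kstrict_lower[OF less.prems i refl 1])
      have l: "wlen ?w = Suc (wlen (welt k mu))" using 1 mu(2) by simp
      then have "theta_double k mu - fact_sum k mu \<in> Jideal k" by (intro less.hyps mu(1)) simp
      \<comment> \<open>Multiplying the inductive statement by t_i - t_{i+1} is enough: the same
        factor occurs in the rules for both sides, so no cancellation in the quotient is
        involved.\<close>
      then have "(Xv i - Xv (Suc i)) * (theta_double k mu - fact_sum k mu) \<in> Jideal k" by (rule Jideal_mult)
      moreover have "vswap i ?h - ?h = (Xv i - Xv (Suc i)) * (theta_double k mu - fact_sum k mu)"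
        unfolding rhom_diff[OF rhom_vswap] theta_lowers[OF less.prems mu(1) i refl mu(3,2)]
          vswap_fact_sum_descent[OF i less.prems mu(2) l]
        by (simp add: algebra_simps)
      ultimately show ?thesis by simp
    next
      case 2
      have "vswap i ?h - ?h = vswap i (theta_double k lam) - theta_double k lam"
        unfolding rhom_diff[OF rhom_vswap] vswap_fact_sum_ascent[OF i less.prems 2] by simp
      then show ?thesis using theta_ascent[OF less.prems i refl 2] by (simp only:)
    qed
  next
    have "Poly_Mapping.lookup ?h 0 = 0"
      by (simp add: lookup_minus lookup_theta_double_0 lookup_fact_sum_0[OF less.prems])
    then show "Poly_Mapping.lookup ?h 0 \<in> Iideal k" using Iideal_0 by simp
  qed
qed

theorem corollary2:
  fixes k :: nat and lam :: "nat list"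
  assumes "kstrict k lam"
  shows "finite (reduced_facts k lam) \<and>
    eq_in_Ckt k (theta_double k lam)
      (\<Sum>(u, \<mu>)\<in>reduced_facts k lam.
         const (theta_single k \<mu>) * peval (schubert (inv u)) (\<lambda>i. - Xv i))"
proof
  show "finite (reduced_facts k lam)" using assms by (rule finite_reduced_facts)
  show "eq_in_Ckt k (theta_double k lam) (\<Sum>(u, \<mu>)\<in>reduced_facts k lam.
      const (theta_single k \<mu>) * peval (schubert (inv u)) (\<lambda>i. - Xv i))"
    using theta_double_fact_sum[OF assms]
    unfolding eq_in_Ckt_iff fact_sum_def fact_term_def by (simp add: split_beta')
qed

end
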